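(* Let $K$ be a field of characteristic $0$, let $A$ be a standard graded Artinian Gorenstein $K$-algebra having the strong Lefschetz property, and let $f\in A[x]$ be a monic homogeneous polynomial. Then the algebra $B=A[x]/(f)$ has the strong Lefschetz property.
   Context: A standard graded $K$-algebra is a commutative graded algebra $A=\bigoplus_{i\ge 0}A_i$ with $A_0=K$ which is generated over $K$ by the finite-dimensional space $A_1$. The polynomial ring $A[x]$ is graded by extending the grading of $A$ and giving $x$ degree $1$; "homogeneous" refers to this grading, and "monic" means monic as a polynomial in $x$ with coefficients in $A$. $B$ carries the induced grading. For a standard graded Artinian $K$-algebra $A$, a homogeneous element $a\in A$ of degree $k$ is a Lefschetz element if for all integers $i$ the $K$-linear map $A_i\to A_{i+k}$ given by multiplication by $a$ has maximal rank (i.e. is injective or surjective). An element $a\in A_1$ is a strong Lefschetz element if all powers $a^r$, $r\geq 1$ (regarded as elements of $A_r$), are Lefschetz elements. $A$ has the strong Lefschetz property if it admits a strong Lefschetz element. *)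

theory Defs
  imports "HOL-Algebra.Algebra"
begin

text \<open>
  A graded algebra is given by a commutative ring \<open>A\<close>, a subfield \<open>K\<close> of \<open>A\<close>, and the family
  \<open>gr\<close> of its homogeneous components \<open>A\<^sub>i\<close>. The condition \<open>A\<^sub>0 = K\<close> is read literally.
  The library's locale \<open>subalgebra K V A\<close> only says that \<open>V\<close> is a \<open>K\<close>-subspace of \<open>A\<close>, and
  \<open>finite_dimension\<close> is dimension over a subfield.
\<close>

locale standard_graded_algebra =
  K?: subfield K A + A?: cring A
  for K :: "'a set" and A :: "('a, 'b) ring_scheme" (structure) and gr :: "nat \<Rightarrow> 'a set" +
  assumes component_subspace: "subalgebra K (gr i) A"
    and direct_sum:
      "a \<in> carrier A \<Longrightarrow>
        \<exists>!c. (\<forall>i. c i \<in> gr i) \<and> finite {i. c i \<noteq> \<zero>} \<and> a = (\<Oplus>i\<in>{i. c i \<noteq> \<zero>}. c i)"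
    and mult_component: "\<lbrakk> a \<in> gr i; b \<in> gr j \<rbrakk> \<Longrightarrow> a \<otimes> b \<in> gr (i + j)"
    and component_zero: "gr 0 = K"
    and component_one_finite_dimension: "finite_dimension K (gr 1)"
    and generated_in_degree_one: "generate_ring A (K \<union> gr 1) = carrier A"

locale artinian_ring = ring +
  assumes descending_chain:
    "\<lbrakk> \<And>n :: nat. ideal (I n) R; \<And>n. I (Suc n) \<subseteq> I n \<rbrakk> \<Longrightarrow> \<exists>N. \<forall>n\<ge>N. I n = I N"

text \<open>
  The socle is the annihilator of the ideal \<open>\<Oplus>\<^sub>i\<^sub>>\<^sub>0 A\<^sub>i\<close>, which is the maximal ideal when \<open>A\<^sub>0\<close> is
  a field and \<open>A\<close> is Artinian. An Artinian local ring is Gorenstein iff its socle is a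
  one-dimensional vector space over the residue field, here \<open>K\<close>.
\<close>

definition graded_socle :: "('a, 'b) ring_scheme \<Rightarrow> (nat \<Rightarrow> 'a set) \<Rightarrow> 'a set" where
  "graded_socle A gr = {s \<in> carrier A. \<forall>i>0. \<forall>a\<in>gr i. a \<otimes>\<^bsub>A\<^esub> s = \<zero>\<^bsub>A\<^esub>}"

locale artinian_gorenstein_algebra =
  standard_graded_algebra K A gr + artinian_ring A
  for K :: "'a set" and A :: "('a, 'b) ring_scheme" (structure) and gr :: "nat \<Rightarrow> 'a set" +
  assumes socle_dimension: "dimension 1 K (graded_socle A gr)"

text \<open>
  Maximal rank is required of \<open>A\<^sub>i \<rightarrow> A\<^sub>i\<^sub>+\<^sub>k\<close> for natural \<open>i\<close> only: for negative \<open>i\<close> the source is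
  zero and the map is injective.
\<close>

definition lefschetz_element ::
    "('a, 'b) ring_scheme \<Rightarrow> (nat \<Rightarrow> 'a set) \<Rightarrow> nat \<Rightarrow> 'a \<Rightarrow> bool" where
  "lefschetz_element A gr k a \<longleftrightarrow>
     a \<in> gr k \<and>
     (\<forall>i. inj_on (\<lambda>b. a \<otimes>\<^bsub>A\<^esub> b) (gr i) \<or> (\<lambda>b. a \<otimes>\<^bsub>A\<^esub> b) ` gr i = gr (i + k))"

definition strong_lefschetz_element ::
    "('a, 'b) ring_scheme \<Rightarrow> (nat \<Rightarrow> 'a set) \<Rightarrow> 'a \<Rightarrow> bool" where
  "strong_lefschetz_element A gr a \<longleftrightarrow>
     a \<in> gr 1 \<and> (\<forall>r::nat. r \<ge> 1 \<longrightarrow> lefschetz_element A gr r (a [^]\<^bsub>A\<^esub> r))"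

definition strong_lefschetz_property ::
    "('a, 'b) ring_scheme \<Rightarrow> (nat \<Rightarrow> 'a set) \<Rightarrow> bool" where
  "strong_lefschetz_property A gr \<longleftrightarrow> (\<exists>a. strong_lefschetz_element A gr a)"

text \<open>The component of degree \<open>d\<close> of \<open>A[x]\<close> is \<open>\<Oplus>\<^sub>i\<^sub>\<le>\<^sub>d A\<^sub>d\<^sub>-\<^sub>i x\<^sup>i\<close>.\<close>

definition poly_grading ::
    "('a, 'b) ring_scheme \<Rightarrow> (nat \<Rightarrow> 'a set) \<Rightarrow> nat \<Rightarrow> (nat \<Rightarrow> 'a) set" where
  "poly_grading A gr d =
     {p \<in> carrier (UP A).
        \<forall>i. coeff (UP A) p i \<in> (if i \<le> d then gr (d - i) else {\<zero>\<^bsub>A\<^esub>})}"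

definition quotient_grading ::
    "('a, 'b) ring_scheme \<Rightarrow> 'a set \<Rightarrow> (nat \<Rightarrow> 'a set) \<Rightarrow> nat \<Rightarrow> 'a set set" where
  "quotient_grading R I gr d = (\<lambda>p. I +>\<^bsub>R\<^esub> p) ` gr d"

definition monic :: "('a, 'b) ring_scheme \<Rightarrow> (nat \<Rightarrow> 'a) \<Rightarrow> bool" where
  "monic A f \<longleftrightarrow> f \<in> carrier (UP A) \<and> coeff (UP A) f (deg A f) = \<one>\<^bsub>A\<^esub>"

end

theory Submission
  imports Defs "HOL-Computational_Algebra.Polynomial"
begin

text \<open>
  Let \<open>c\<close> be the top degree of \<open>A\<close>, \<open>n\<close> the degree of \<open>f\<close> and \<open>z\<close> a strong Lefschetz element of
  \<open>A\<close>. A linear form \<open>z + s x\<close> with generic \<open>s \<in> K\<close> is a strong Lefschetz element of \<open>B\<close>. Since \<open>B\<close>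
  is again Gorenstein, with top degree \<open>d = c + n - 1\<close>, it is enough that \<open>(z + s x)\<^bsup>d-2i\<^esup>\<close> maps
  \<open>B\<^sub>i\<close> onto \<open>B\<^sub>d\<^sub>-\<^sub>i\<close> whenever \<open>2i \<le> d\<close>.

  After rescaling \<open>x\<close>, this family of maps degenerates for \<open>s \<rightarrow> 0\<close> to multiplication by a power
  of \<open>z + x\<close> on \<open>A[x]/(x\<^sup>n)\<close>, and surjectivity at the limit implies surjectivity for all but
  finitely many \<open>s\<close>. At the limit, the primitive decomposition of \<open>A\<close> with respect to \<open>z\<close> reduces
  the claim to \<open>\<rat>[z, x]/(z\<^bsup>q+1\<^esup>, x\<^sup>n)\<close>. There one has to prescribe a window of coefficients of
  \<open>(1 + x)\<^sup>m g\<close> by the choice of \<open>g\<close>, which is done by differentiating until the window starts at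
  \<open>0\<close>.
\<close>

section \<open>Binomial systems\<close>

text \<open>The symmetric maps suffice because the pairing of \<open>B\<close> into its top degree
  turns their surjectivity into injectivity of the earlier maps, while the later maps inherit
  surjectivity by factorisation; Hilbert functions are never compared. The obstacle is that the
  lower coefficients of \<open>f\<close> are arbitrary: for \<open>f = (z + x)^2\<close> the form
  \<open>z + x\<close> itself can fail, hence the parameter. Substituting \<open>s x\<close> for
  \<open>x\<close> multiplies the coefficient of \<open>x^l\<close> by \<open>s^l\<close>. A product
  that agrees with \<open>b x^k\<close> in \<open>x\<close>-degrees below \<open>n\<close> becomes,
  after this substitution and division by \<open>s^k\<close>, the sum of \<open>b x^k\<close> and
  terms carrying \<open>s^(l-k)\<close> with \<open>l \<ge> n > k\<close>. Reduction modulo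
  \<open>f\<close> thus perturbs the identity matrix by entries vanishing at \<open>s = 0\<close>,
  whatever \<open>f\<close> is. Characteristic zero is used twice: for dividing by integers in the
  binomial systems, and for an infinite supply of \<open>s\<close>. The number \<open>q\<close> is
  \<open>c - 2 l\<close> for a primitive element of degree \<open>l\<close>, whose string has
  \<open>q + 1\<close> members.\<close>

lemma coeff_one_plus_X_power:
  "Polynomial.coeff ([:1, 1 :: 'a :: comm_semiring_1:] ^ m) i = of_nat (m choose i)"
proof (cases "i \<le> m")
  case True
  then show ?thesis
    by (simp add: coeff_linear_poly_power)
next
  case False
  then show ?thesis
    using degree_power_le[of "[:1, 1 :: 'a:]" m] degree_pCons_le[of "1 :: 'a" "[:1:]"]
    by (intro trans[OF coeff_eq_0]) (auto simp: binomial_eq_0 split: if_splits)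
qed

text \<open>As a power series \<open>(1 + x)^m\<close> is a unit, so \<open>g\<close> is the
  truncation of a quotient. The constant coefficient \<open>1\<close> makes the system for the
  coefficients of \<open>g\<close> unitriangular, and each induction step corrects the next
  coefficient without touching the earlier ones.\<close>

lemma exists_truncated_quotient_power:
  fixes t :: "nat \<Rightarrow> rat"
  shows "\<exists>g. Polynomial.degree g \<le> j \<and> (\<forall>l\<le>j. Polynomial.coeff ([:1, 1:] ^ m * g) l = t l)"
proof (induction j)
  case 0
  have "Polynomial.coeff ([:1, 1:] ^ m * [:t 0:]) 0 = t 0"
    by (simp add: coeff_one_plus_X_power)
  then show ?case
    by (intro exI[of _ "[:t 0:]"]) auto
next
  case (Suc j)
  then obtain g where deg: "Polynomial.degree g \<le> j"
    and g: "\<And>l. l \<le> j \<Longrightarrow> Polynomial.coeff ([:1, 1:] ^ m * g) l = t l"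
    by auto
  define c where "c = t (Suc j) - Polynomial.coeff ([:1, 1:] ^ m * g) (Suc j)"
  define g' where "g' = g + Polynomial.monom c (Suc j)"
  have shift: "Polynomial.coeff ([:1, 1:] ^ m * Polynomial.monom c (Suc j)) l =
      (if l < Suc j then 0 else c * Polynomial.coeff ([:1, 1:] ^ m) (l - Suc j))" for l
    by (subst mult.commute) (simp add: coeff_monom_mult)
  have "Polynomial.degree g' \<le> Suc j"
    unfolding g'_def using deg degree_monom_le[of c "Suc j"]
    by (intro degree_add_le) auto
  moreover have "Polynomial.coeff ([:1, 1:] ^ m * g') l = t l" if "l \<le> Suc j" for l
  proof (cases "l = Suc j")
    case True
    then show ?thesis
      unfolding g'_def distrib_left coeff_add shift by (simp add: coeff_one_plus_X_power c_def)
  next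
    case False
    then show ?thesis
      using that g[of l] unfolding g'_def distrib_left coeff_add shift by simp
  qed
  ultimately show ?case
    by blast
qed

text \<open>The operator sending \<open>g\<close> to \<open>m g + (1 + x) g'\<close> is triangular
  on polynomials of degree at most \<open>j\<close>: it multiplies the leading term
  \<open>x^i\<close> by \<open>m + i\<close> and otherwise only produces lower terms. These factors
  are nonzero because \<open>m > 0\<close>, so the operator is invertible. Consequently
  \<open>(1 + x)^m g\<close> is an antiderivative of \<open>(1 + x)^(m-1) h\<close>.\<close>

lemma exists_logarithmic_antiderivative:
  fixes h :: "rat poly"
  assumes "Polynomial.degree h \<le> j" and m: "m > 0"
  shows "\<exists>g. Polynomial.degree g \<le> j \<and>
    Polynomial.smult (of_nat m) g + [:1, 1:] * pderiv g = h"
  using assms(1)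
proof (induction j arbitrary: h)
  case 0
  then obtain a where "h = [:a:]"
    using degree_eq_zeroE[of h] by auto
  then show ?case
    using m by (intro exI[of _ "[:a / of_nat m:]"]) (simp add: pderiv_pCons)
next
  case (Suc j)
  define c where "c = Polynomial.coeff h (Suc j) / of_nat (m + Suc j)"
  define g0 where "g0 = Polynomial.monom c (Suc j)"
  define h' where "h' = h - (Polynomial.smult (of_nat m) g0 + [:1, 1:] * pderiv g0)"
  have cf: "Polynomial.coeff (Polynomial.smult (of_nat m) g0 + [:1, 1:] * pderiv g0) l =
     (if l = Suc j then Polynomial.coeff h (Suc j) else if l = j then of_nat (Suc j) * c else 0)" for l
  proof -
    have "of_nat m + (of_nat (Suc j) :: rat) \<noteq> 0"
      using m by (metis add_gr_0 of_nat_0_less_iff of_nat_add less_irrefl)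
    then have "(of_nat m + of_nat (Suc j)) * c = Polynomial.coeff h (Suc j)"
      unfolding c_def of_nat_add by (simp del: of_nat_Suc)
    then show ?thesis
      by (cases l) (auto simp: g0_def coeff_pderiv ring_distribs mult.commute simp del: of_nat_Suc)
  qed
  have "Polynomial.degree h' \<le> j"
  proof (rule degree_le, intro allI impI)
    fix l assume "j < l"
    then show "Polynomial.coeff h' l = 0"
      unfolding h'_def coeff_diff cf using Suc.prems by (auto simp: coeff_eq_0)
  qed
  from Suc.IH[OF this] obtain g where "Polynomial.degree g \<le> j"
    and g: "Polynomial.smult (of_nat m) g + [:1, 1:] * pderiv g = h'"
    by auto
  then have "Polynomial.degree (g + g0) \<le> Suc j"
    unfolding g0_def using degree_monom_le[of c "Suc j"] by (intro degree_add_le) auto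
  moreover have "Polynomial.smult (of_nat m) (g + g0) + [:1, 1:] * pderiv (g + g0) = h"
    using g unfolding h'_def unfolding smult_add_right pderiv_add distrib_left by (simp only: algebra_simps)
  ultimately show ?case
    by blast
qed

text \<open>
  Differentiation turns \<open>(1 + x)\<^sup>m g\<close> into \<open>(1 + x)\<^bsup>m-1\<^esup> (m g + (1 + x) g')\<close> and shifts the window of
  prescribed coefficients down by one.
\<close>

lemma exists_power_multiple_with_coeffs:
  fixes t :: "nat \<Rightarrow> rat"
  assumes "r \<le> m"
  shows "\<exists>g. Polynomial.degree g \<le> j \<and>
    (\<forall>l. r \<le> l \<and> l \<le> r + j \<longrightarrow> Polynomial.coeff ([:1, 1:] ^ m * g) l = t l)"
  using assms
proof (induction r arbitrary: m t)
  case 0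
  then show ?case
    using exists_truncated_quotient_power[of j m t] by auto
next
  case (Suc r)
  then obtain m' where m: "m = Suc m'" and "r \<le> m'"
    by (metis Suc_le_D Suc_le_mono)
  \<comment> \<open>Coefficient \<open>l\<close> of a derivative is \<open>l + 1\<close> times
    coefficient \<open>l + 1\<close> of the original, hence this target. The window keeps its
    \<open>j + 1\<close> entries while the exponent of \<open>1 + x\<close> drops by one; this is
    why \<open>r \<le> m\<close> is assumed.\<close>
  from Suc.IH[OF this(2), of "\<lambda>l. of_nat (Suc l) * t (Suc l)"] obtain h
    where "Polynomial.degree h \<le> j"
      and h: "\<And>l. r \<le> l \<Longrightarrow> l \<le> r + j \<Longrightarrow>
        Polynomial.coeff ([:1, 1:] ^ m' * h) l = of_nat (Suc l) * t (Suc l)"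
    by auto
  from exists_logarithmic_antiderivative[OF this(1), of m] m obtain g
    where deg: "Polynomial.degree g \<le> j"
      and g: "Polynomial.smult (of_nat m) g + [:1, 1:] * pderiv g = h"
    by auto
  have "pderiv ([:1, 1:] ^ m * g) = [:1, 1:] ^ m' * (Polynomial.smult (of_nat m) g + [:1, 1:] * pderiv g)"
    unfolding m pderiv_mult pderiv_power_Suc
    by (simp add: pderiv_pCons ring_distribs mult.assoc mult.left_commute mult.commute del: of_nat_Suc)
  then have der: "pderiv ([:1, 1:] ^ m * g) = [:1, 1:] ^ m' * h"
    unfolding g .
  have "Polynomial.coeff ([:1, 1:] ^ m * g) l = t l" if l: "Suc r \<le> l" "l \<le> Suc r + j" for l
  proof -
    from l obtain l' where l': "l = Suc l'" "r \<le> l'" "l' \<le> r + j"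
      by (cases l) auto
    have "of_nat (Suc l') * Polynomial.coeff ([:1, 1:] ^ m * g) (Suc l') = of_nat (Suc l') * t (Suc l')"
      using h[OF l'(2,3)] unfolding der[symmetric] coeff_pderiv .
    then show ?thesis
      unfolding l'(1) using of_nat_neq_0 mult_left_cancel by blast
  qed
  with deg show ?case
    by blast
qed

text \<open>The system is solved over the rationals but used over \<open>K\<close>, which receives
  integer scalars through \<open>ring_of_int\<close>. The common denominator \<open>N\<close>
  becomes the right-hand side and is inverted in \<open>K\<close> later.\<close>

lemma exists_common_denominator:
  fixes c :: "nat \<Rightarrow> rat"
  shows "\<exists>N::nat. N > 0 \<and> (\<exists>\<gamma> :: nat \<Rightarrow> int. \<forall>k<n. of_int (\<gamma> k) = of_nat N * c k)"
proof (induction n)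
  case 0
  then show ?case
    by auto
next
  case (Suc n)
  then obtain N \<gamma> where N: "N > 0" and \<gamma>: "\<forall>k<n. of_int (\<gamma> k) = of_nat N * c k"
    by blast
  obtain a b where ab: "quotient_of (c n) = (a, b)"
    by force
  have b: "b > 0" "c n = of_int a / of_int b"
    using ab by (auto simp: quotient_of_denom_pos quotient_of_div)
  let ?\<gamma> = "\<lambda>k. if k = n then int N * a else b * \<gamma> k"
  have bn: "(of_nat (nat b) :: rat) = of_int b"
    using b(1) by simp
  have "of_int (?\<gamma> k) = of_nat (N * nat b) * c k" if "k < Suc n" for k
    using that \<gamma> b unfolding of_nat_mult bn by (auto simp: less_Suc_eq)
  with N b show ?case
    by (intro exI[of _ "N * nat b"] conjI exI[of _ ?\<gamma>]) auto
qed

lemma coeff_linear_power_mult: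
  fixes g :: "rat poly"
  assumes "Polynomial.degree g \<le> j"
  shows "Polynomial.coeff ([:1, 1:] ^ m * g) l =
    (\<Sum>k | k \<le> j \<and> k \<le> l. Polynomial.coeff g k * of_nat (m choose (l - k)))"
proof -
  have "Polynomial.coeff ([:1, 1:] ^ m * g) l = Polynomial.coeff (g * [:1, 1:] ^ m) l"
    by (simp add: mult.commute)
  also have "\<dots> = (\<Sum>k\<le>l. Polynomial.coeff g k * of_nat (m choose (l - k)))"
    by (simp add: coeff_mult coeff_one_plus_X_power)
  also have "\<dots> = (\<Sum>k | k \<le> j \<and> k \<le> l. Polynomial.coeff g k * of_nat (m choose (l - k)))"
    using assms by (intro sum.mono_neutral_right) (auto intro: coeff_eq_0)
  finally show ?thesis .
qed

text \<open>This is multiplication by \<open>(z + x)^m\<close> from degree \<open>j\<close> to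
  degree \<open>j + m\<close> in \<open>\<rat>[z, x]/(z^(q+1), x^(p+1))\<close>, dehomogenised by
  \<open>z = 1\<close>: \<open>c k\<close> is the coefficient of \<open>z^(j-k) x^k\<close>. A
  monomial \<open>z^(j+m-l) x^l\<close> survives exactly when \<open>l \<le> p\<close> and
  \<open>j + m - l \<le> q\<close>, which gives the range of equations. The two degrees are
  symmetric because \<open>q + p = 2 * j + m\<close>.\<close>

lemma binomial_system_rat:
  assumes eq: "q + p = 2 * j + m" and l0: "l0 \<le> p" "j + m \<le> q + l0" "l0 \<le> j + m"
  shows "\<exists>c :: nat \<Rightarrow> rat. \<forall>l. l \<le> p \<and> l \<le> j + m \<and> j + m \<le> q + l \<longrightarrow>
    (\<Sum>k | k \<le> j \<and> k \<le> l. c k * of_nat (m choose (l - k))) = (if l = l0 then 1 else 0)"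
proof (cases "j \<le> q")
  case True
  \<comment> \<open>The lower end \<open>j + m - q\<close> of the window equals
    \<open>p - j\<close>; truncated subtraction covers \<open>p < j\<close>, where the window starts
    at \<open>0\<close>. The case assumption \<open>j \<le> q\<close> keeps the start at most
    \<open>m\<close>.\<close>
  define r where "r = p - j"
  have "r \<le> m"
    using True eq by (simp add: r_def)
  from exists_power_multiple_with_coeffs[OF this, of j "\<lambda>l. if l = l0 then 1 else 0"] obtain g
    where deg: "Polynomial.degree g \<le> j"
      and g: "\<And>l. r \<le> l \<Longrightarrow> l \<le> r + j \<Longrightarrow>
        Polynomial.coeff ([:1, 1:] ^ m * g) l = (if l = l0 then 1 else 0 :: rat)"
    by blast
  have "(\<Sum>k | k \<le> j \<and> k \<le> l. Polynomial.coeff g k * of_nat (m choose (l - k))) =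
      (if l = l0 then 1 else 0)" if "l \<le> p" "j + m \<le> q + l" for l
  proof -
    have "r \<le> l" "l \<le> r + j"
      using that eq True by (auto simp: r_def)
    from g[OF this] show ?thesis
      unfolding coeff_linear_power_mult[OF deg] .
  qed
  then show ?thesis
    by (intro exI[of _ "Polynomial.coeff g"]) blast
next
  case False
  \<comment> \<open>For \<open>q < j\<close> the window starts above \<open>m\<close>, out of reach
    of differentiation. Exchanging \<open>z\<close> and \<open>x\<close>, that is \<open>l\<close>
    with \<open>j + m - l\<close> and \<open>k\<close> with \<open>j - k\<close>, makes it start at
    \<open>0\<close>, and the symmetry of binomial coefficients preserves the system.\<close>
  from exists_power_multiple_with_coeffs[of 0 m j "\<lambda>l. if l = j + m - l0 then 1 else 0"] obtain g
    where deg: "Polynomial.degree g \<le> j"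
      and g: "\<And>l. l \<le> j \<Longrightarrow>
        Polynomial.coeff ([:1, 1:] ^ m * g) l = (if l = j + m - l0 then 1 else 0 :: rat)"
    by auto
  have "(\<Sum>k | k \<le> j \<and> k \<le> l. Polynomial.coeff g (j - k) * of_nat (m choose (l - k))) =
      (if l = l0 then 1 else 0)" if l: "l \<le> p" "l \<le> j + m" "j + m \<le> q + l" for l
  proof -
    let ?l = "j + m - l"
    let ?f = "\<lambda>k. Polynomial.coeff g (j - k) * of_nat (m choose (l - k))"
    let ?h = "\<lambda>k. Polynomial.coeff g k * of_nat (m choose (?l - k))"
    have "(\<Sum>k | k \<le> j \<and> k \<le> l. ?f k) = (\<Sum>k | k \<le> j \<and> k \<le> l \<and> l \<le> k + m. ?f k)"
      by (rule sum.mono_neutral_right) (auto simp: binomial_eq_0)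
    also have "\<dots> = (\<Sum>k | k \<le> j \<and> k \<le> ?l \<and> ?l \<le> k + m. ?h k)"
    proof (rule sum.reindex_bij_witness[of _ "\<lambda>k. j - k" "\<lambda>k. j - k"])
      fix k assume k: "k \<in> {k. k \<le> j \<and> k \<le> l \<and> l \<le> k + m}"
      then have "?l - (j - k) = m - (l - k)" and "l - k \<le> m"
        using l by auto
      then have "m choose (?l - (j - k)) = m choose (l - k)"
        using binomial_symmetric[of "l - k" m] by simp
      with k show "?h (j - k) = ?f k"
        by simp
    qed (use l in auto)
    also have "\<dots> = (\<Sum>k | k \<le> j \<and> k \<le> ?l. ?h k)"
      by (rule sum.mono_neutral_left) (auto simp: binomial_eq_0)
    also have "\<dots> = (if ?l = j + m - l0 then 1 else 0)"
    proof -
      have "?l \<le> j"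
        using l False by simp
      from g[OF this] show ?thesis
        unfolding coeff_linear_power_mult[OF deg] .
    qed
    finally show ?thesis
      using l l0 by auto
  qed
  then show ?thesis
    by (intro exI[of _ "\<lambda>k. Polynomial.coeff g (j - k)"]) blast
qed

lemma binomial_system:
  assumes "q + p = 2 * j + m" "l0 \<le> p" "j + m \<le> q + l0" "l0 \<le> j + m"
  obtains N :: nat and \<gamma> :: "nat \<Rightarrow> int"
  where "N > 0" and "\<And>l. \<lbrakk> l \<le> p; l \<le> j + m; j + m \<le> q + l \<rbrakk> \<Longrightarrow>
    (\<Sum>k | k \<le> j \<and> k \<le> l. \<gamma> k * int (m choose (l - k))) = (if l = l0 then int N else 0)"
proof -
  from binomial_system_rat[OF assms] obtain c :: "nat \<Rightarrow> rat"
    where c: "\<And>l. \<lbrakk> l \<le> p; l \<le> j + m; j + m \<le> q + l \<rbrakk> \<Longrightarrow>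
      (\<Sum>k | k \<le> j \<and> k \<le> l. c k * of_nat (m choose (l - k))) = (if l = l0 then 1 else 0)"
    by blast
  from exists_common_denominator[of "Suc j" c] obtain N \<gamma>
    where N: "N > 0" and \<gamma>: "\<And>k. k \<le> j \<Longrightarrow> of_int (\<gamma> k) = of_nat N * c k"
    by (auto simp: less_Suc_eq_le)
  have "(\<Sum>k | k \<le> j \<and> k \<le> l. \<gamma> k * int (m choose (l - k))) = (if l = l0 then int N else 0)"
    if l: "l \<le> p" "l \<le> j + m" "j + m \<le> q + l" for l
  proof -
    have "rat_of_int (\<Sum>k | k \<le> j \<and> k \<le> l. \<gamma> k * int (m choose (l - k))) =
        of_nat N * (\<Sum>k | k \<le> j \<and> k \<le> l. c k * of_nat (m choose (l - k)))"
      by (simp add: \<gamma> sum_distrib_left mult.assoc)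
    also have "\<dots> = rat_of_int (if l = l0 then int N else 0)"
      by (simp add: c[OF l])
    finally show ?thesis
      by (simp only: of_int_eq_iff)
  qed
  with N that show ?thesis
    by blast
qed

section \<open>Vectors depending polynomially on a parameter\<close>

definition polynomial_function :: "('a, 'b) ring_scheme \<Rightarrow> ('a \<Rightarrow> 'a) \<Rightarrow> bool" where
  "polynomial_function R g \<longleftrightarrow>
     (\<exists>p. set p \<subseteq> carrier R \<and> (\<forall>s\<in>carrier R. g s = ring.eval R p s))"

context cring
begin

lemma polynomial_function_closed:
  assumes "polynomial_function R g" "s \<in> carrier R"
  shows "g s \<in> carrier R"
  using assms eval_in_carrier unfolding polynomial_function_def by auto

lemma polynomial_function_const:
  assumes "a \<in> carrier R"
  shows "polynomial_function R (\<lambda>s. a)"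
  unfolding polynomial_function_def using assms by (intro exI[of _ "[a]"]) auto

lemma polynomial_function_id: "polynomial_function R (\<lambda>s. s)"
  unfolding polynomial_function_def by (intro exI[of _ "[\<one>, \<zero>]"]) auto

lemma polynomial_function_add:
  assumes "polynomial_function R g" "polynomial_function R h"
  shows "polynomial_function R (\<lambda>s. g s \<oplus> h s)"
proof -
  from assms obtain p q where p: "set p \<subseteq> carrier R" "\<And>s. s \<in> carrier R \<Longrightarrow> g s = eval p s"
    and q: "set q \<subseteq> carrier R" "\<And>s. s \<in> carrier R \<Longrightarrow> h s = eval q s"
    unfolding polynomial_function_def by auto
  then have "set (poly_add p q) \<subseteq> carrier R" "\<forall>s\<in>carrier R. g s \<oplus> h s = eval (poly_add p q) s"
    using poly_add_in_carrier eval_poly_add by auto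
  then show ?thesis
    unfolding polynomial_function_def by blast
qed

lemma polynomial_function_mult:
  assumes "polynomial_function R g" "polynomial_function R h"
  shows "polynomial_function R (\<lambda>s. g s \<otimes> h s)"
proof -
  from assms obtain p q where p: "set p \<subseteq> carrier R" "\<And>s. s \<in> carrier R \<Longrightarrow> g s = eval p s"
    and q: "set q \<subseteq> carrier R" "\<And>s. s \<in> carrier R \<Longrightarrow> h s = eval q s"
    unfolding polynomial_function_def by auto
  then have "set (poly_mult p q) \<subseteq> carrier R" "\<forall>s\<in>carrier R. g s \<otimes> h s = eval (poly_mult p q) s"
    using poly_mult_in_carrier eval_poly_mult by auto
  then show ?thesis
    unfolding polynomial_function_def by blast
qed

lemma polynomial_function_minus:
  assumes g: "polynomial_function R g" and h: "polynomial_function R h"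
  shows "polynomial_function R (\<lambda>s. g s \<ominus> h s)"
proof -
  have "polynomial_function R (\<lambda>s. g s \<oplus> \<ominus> \<one> \<otimes> h s)"
    by (intro polynomial_function_add polynomial_function_mult polynomial_function_const g h) simp
  moreover have "g s \<ominus> h s = g s \<oplus> \<ominus> \<one> \<otimes> h s" if "s \<in> carrier R" for s
    using polynomial_function_closed[OF h that] by (simp add: l_minus minus_eq)
  ultimately show ?thesis
    unfolding polynomial_function_def by auto
qed

lemma polynomial_function_pow: "polynomial_function R (\<lambda>s. s [^] (l :: nat))"
proof (induction l)
  case 0
  show ?case
    by (simp add: polynomial_function_const)
next
  case (Suc l)
  then show ?case
    by (simp add: polynomial_function_mult polynomial_function_id)
qed

end

lemma (in domain) finite_polynomial_function_zeros:
  assumes g: "polynomial_function R g" and s0: "s0 \<in> carrier R" "g s0 \<noteq> \<zero>"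
  shows "finite {s \<in> carrier R. g s = \<zero>}"
proof -
  obtain p where p: "set p \<subseteq> carrier R" "\<And>s. s \<in> carrier R \<Longrightarrow> g s = eval p s"
    using g unfolding polynomial_function_def by auto
  let ?p = "normalize p"
  have "?p \<in> carrier (poly_ring R)"
    using normalize_gives_polynomial[OF p(1)] unfolding univ_poly_carrier .
  then have "finite {x. is_root ?p x}"
    by (rule finite_number_of_roots)
  moreover have ev: "g s = eval ?p s" if "s \<in> carrier R" for s
    using p that eval_normalize by simp
  then have "?p \<noteq> []"
    using s0 by auto
  then have "{s \<in> carrier R. g s = \<zero>} \<subseteq> {x. is_root ?p x}"
    using ev by (auto simp: is_root_def)
  ultimately show ?thesis
    using finite_subset by blast
qed

text \<open>
  Gaussian elimination with a parameter \<open>s\<close>: the pivots have the value \<open>\<one>\<close> at \<open>s = \<zero>\<close>, so each of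
  them vanishes for finitely many \<open>s\<close> only.
\<close>

lemma (in module) finite_exceptions_generators_mem:
  assumes "field R" and "finite I"
    and "w \<in> I \<rightarrow> carrier M"
    and "S \<subseteq> carrier R"
    and "\<And>s. s \<in> S \<Longrightarrow> submodule (U s) R M"
    and "\<And>i j. \<lbrakk> i \<in> I; j \<in> I \<rbrakk> \<Longrightarrow> polynomial_function R (c i j)"
    and "\<And>i j. \<lbrakk> i \<in> I; j \<in> I \<rbrakk> \<Longrightarrow> c i j \<zero> = (if i = j then \<one> else \<zero>)"
    and "\<And>s i. \<lbrakk> s \<in> S; i \<in> I \<rbrakk> \<Longrightarrow> (\<Oplus>\<^bsub>M\<^esub>j\<in>I. c i j s \<odot>\<^bsub>M\<^esub> w j) \<in> U s"
  shows "finite {s \<in> S. \<not> w ` I \<subseteq> U s}"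
  using assms(2,3,6-8)
proof (induction I arbitrary: c)
  case empty
  then show ?case
    by simp
next
  case (insert k I)
  interpret field R by fact
  note S = \<open>S \<subseteq> carrier R\<close>
  note sub = submoduleE[OF assms(5)]
  have pf: "polynomial_function R (c i j)" if "i \<in> insert k I" "j \<in> insert k I" for i j
    using insert.prems(2) that .
  have cl: "c i j s \<in> carrier R" if "i \<in> insert k I" "j \<in> insert k I" "s \<in> carrier R" for i j s
    using polynomial_function_closed[OF pf[OF that(1,2)] that(3)] .
  have w: "w i \<in> carrier M" if "i \<in> insert k I" for i
    using insert.prems(1) that by blast
  \<comment> \<open>Row \<open>i\<close> is cross-multiplied with row \<open>k\<close> instead of
    being divided by the pivot, so the entries remain polynomial. At \<open>\<zero>\<close> the
    pivot is \<open>\<one>\<close> and \<open>c i k\<close> vanishes, hence the smaller system is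
    again the identity there.\<close>
  define c' where "c' i j s = c k k s \<otimes> c i j s \<ominus> c i k s \<otimes> c k j s" for i j s
  have split: "(\<Oplus>\<^bsub>M\<^esub>j\<in>insert k I. c i j s \<odot>\<^bsub>M\<^esub> w j) =
      c i k s \<odot>\<^bsub>M\<^esub> w k \<oplus>\<^bsub>M\<^esub> (\<Oplus>\<^bsub>M\<^esub>j\<in>I. c i j s \<odot>\<^bsub>M\<^esub> w j)"
    if "i \<in> insert k I" "s \<in> carrier R" for i s
    using insert.hyps cl w that by (intro M.finsum_insert) auto
  have sumcl: "(\<Oplus>\<^bsub>M\<^esub>j\<in>I. c i j s \<odot>\<^bsub>M\<^esub> w j) \<in> carrier M" if "i \<in> insert k I" "s \<in> carrier R" for i s
    using cl w that by (intro M.finsum_closed) auto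
  have c'_mem: "(\<Oplus>\<^bsub>M\<^esub>j\<in>I. c' i j s \<odot>\<^bsub>M\<^esub> w j) \<in> U s" if s: "s \<in> S" and i: "i \<in> I" for s i
  proof -
    have sc: "s \<in> carrier R" using S s by blast
    let ?g = "\<lambda>i. (\<Oplus>\<^bsub>M\<^esub>j\<in>insert k I. c i j s \<odot>\<^bsub>M\<^esub> w j)"
    let ?h = "\<lambda>i. (\<Oplus>\<^bsub>M\<^esub>j\<in>I. c i j s \<odot>\<^bsub>M\<^esub> w j)"
    have mem: "c k k s \<odot>\<^bsub>M\<^esub> ?g i \<oplus>\<^bsub>M\<^esub> (\<ominus> c i k s) \<odot>\<^bsub>M\<^esub> ?g k \<in> U s"
      using insert.prems(4)[OF s] i cl sc by (intro sub(4,5)[OF s]) auto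
    have "(\<Oplus>\<^bsub>M\<^esub>j\<in>I. c' i j s \<odot>\<^bsub>M\<^esub> w j) =
        (\<Oplus>\<^bsub>M\<^esub>j\<in>I. c k k s \<odot>\<^bsub>M\<^esub> (c i j s \<odot>\<^bsub>M\<^esub> w j) \<oplus>\<^bsub>M\<^esub> (\<ominus> c i k s) \<odot>\<^bsub>M\<^esub> (c k j s \<odot>\<^bsub>M\<^esub> w j))"
    proof (rule M.finsum_cong')
      fix j assume j: "j \<in> I"
      show "c' i j s \<odot>\<^bsub>M\<^esub> w j =
          c k k s \<odot>\<^bsub>M\<^esub> (c i j s \<odot>\<^bsub>M\<^esub> w j) \<oplus>\<^bsub>M\<^esub> (\<ominus> c i k s) \<odot>\<^bsub>M\<^esub> (c k j s \<odot>\<^bsub>M\<^esub> w j)"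
        using cl sc i j w unfolding c'_def a_minus_def
        by (simp add: smult_l_distr smult_assoc1 l_minus smult_l_minus)
    qed (use cl sc i w in auto)
    also have "\<dots> = (\<Oplus>\<^bsub>M\<^esub>j\<in>I. c k k s \<odot>\<^bsub>M\<^esub> (c i j s \<odot>\<^bsub>M\<^esub> w j)) \<oplus>\<^bsub>M\<^esub>
        (\<Oplus>\<^bsub>M\<^esub>j\<in>I. (\<ominus> c i k s) \<odot>\<^bsub>M\<^esub> (c k j s \<odot>\<^bsub>M\<^esub> w j))"
      using cl sc i w by (intro M.finsum_addf) auto
    also have "\<dots> = c k k s \<odot>\<^bsub>M\<^esub> ?h i \<oplus>\<^bsub>M\<^esub> (\<ominus> c i k s) \<odot>\<^bsub>M\<^esub> ?h k"
      using cl sc i w insert.hyps(1) by (subst (1 2) finsum_smult_ldistr) auto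
    also have "\<dots> = c k k s \<odot>\<^bsub>M\<^esub> ?g i \<oplus>\<^bsub>M\<^esub> (\<ominus> c i k s) \<odot>\<^bsub>M\<^esub> ?g k"
    proof -
      let ?x = "(c k k s \<otimes> c i k s) \<odot>\<^bsub>M\<^esub> w k"
      have x: "?x \<in> carrier M" and h: "?h i \<in> carrier M" "?h k \<in> carrier M"
        using cl sc i w sumcl by auto
      have "c k k s \<odot>\<^bsub>M\<^esub> ?g i = ?x \<oplus>\<^bsub>M\<^esub> c k k s \<odot>\<^bsub>M\<^esub> ?h i"
        using split[of i s] cl sc i w h by (simp add: smult_r_distr smult_assoc1)
      moreover have "(\<ominus> c i k s) \<odot>\<^bsub>M\<^esub> ?g k = \<ominus>\<^bsub>M\<^esub> ?x \<oplus>\<^bsub>M\<^esub> (\<ominus> c i k s) \<odot>\<^bsub>M\<^esub> ?h k"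
        using split[of k s] cl sc i w h m_comm[of "c k k s" "c i k s"]
        by (simp add: smult_r_distr smult_assoc1 smult_l_minus)
      moreover have "?x \<oplus>\<^bsub>M\<^esub> c k k s \<odot>\<^bsub>M\<^esub> ?h i \<oplus>\<^bsub>M\<^esub> (\<ominus>\<^bsub>M\<^esub> ?x \<oplus>\<^bsub>M\<^esub> (\<ominus> c i k s) \<odot>\<^bsub>M\<^esub> ?h k) =
          c k k s \<odot>\<^bsub>M\<^esub> ?h i \<oplus>\<^bsub>M\<^esub> (\<ominus> c i k s) \<odot>\<^bsub>M\<^esub> ?h k"
      proof -
        have "y \<oplus>\<^bsub>M\<^esub> z = x \<oplus>\<^bsub>M\<^esub> y \<oplus>\<^bsub>M\<^esub> (\<ominus>\<^bsub>M\<^esub> x \<oplus>\<^bsub>M\<^esub> z)"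
          if "x \<in> carrier M" "y \<in> carrier M" "z \<in> carrier M" for x y z
          using that by (metis M.a_comm M.a_assoc M.add.inv_closed M.add.m_closed M.r_neg1)
        from this[OF x] show ?thesis
          using cl sc i h by simp
      qed
      ultimately show ?thesis
        by simp
    qed
    finally show ?thesis
      using mem by simp
  qed
  have "finite {s \<in> S. \<not> w ` I \<subseteq> U s}"
  proof (rule insert.IH[of c'])
    show "w \<in> I \<rightarrow> carrier M"
      using w by auto
    show "polynomial_function R (c' i j)" if "i \<in> I" "j \<in> I" for i j
      unfolding c'_def using that
      by (intro polynomial_function_minus polynomial_function_mult pf) auto
    show "c' i j \<zero> = (if i = j then \<one> else \<zero>)" if "i \<in> I" "j \<in> I" for i j
      unfolding c'_def using that insert.prems(3) insert.hyps(2) by (auto simp: a_minus_def)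
  qed (rule c'_mem)
  \<comment> \<open>The parameter \<open>\<zero>\<close> serves only to certify that the pivot is
    not identically zero; it need not belong to \<open>S\<close>.\<close>
  moreover have "finite {s \<in> carrier R. c k k s = \<zero>}"
    using insert.prems(3)[of k k] pf[of k k]
    by (intro finite_polynomial_function_zeros[of _ \<zero>]) auto
  \<comment> \<open>Back substitution: once the other generators lie in \<open>U s\<close>, row
    \<open>k\<close> leaves the multiple of \<open>w k\<close> by \<open>c k k s\<close>, and the
    pivot can be inverted.\<close>
  moreover have "w k \<in> U s" if s: "s \<in> S" and nz: "c k k s \<noteq> \<zero>" and I: "w ` I \<subseteq> U s" for s
  proof -
    have sc: "s \<in> carrier R" using S s by blast
    have "(\<Oplus>\<^bsub>M\<^esub>j\<in>J. c k j s \<odot>\<^bsub>M\<^esub> w j) \<in> U s" if "finite J" "J \<subseteq> I" for J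
      using that
    proof (induction J)
      case empty
      then show ?case
        using subgroup.one_closed[OF submodule.axioms(1)[OF assms(5)[OF s]]] by simp
    next
      case (insert j J)
      then have "(\<Oplus>\<^bsub>M\<^esub>j\<in>insert j J. c k j s \<odot>\<^bsub>M\<^esub> w j) = c k j s \<odot>\<^bsub>M\<^esub> w j \<oplus>\<^bsub>M\<^esub> (\<Oplus>\<^bsub>M\<^esub>j\<in>J. c k j s \<odot>\<^bsub>M\<^esub> w j)"
        using cl w sc by (intro M.finsum_insert) auto
      then show ?case
        using insert I cl sc by (auto intro!: sub(4,5)[OF s])
    qed
    from this[of I] have h: "(\<Oplus>\<^bsub>M\<^esub>j\<in>I. c k j s \<odot>\<^bsub>M\<^esub> w j) \<in> U s"
      using insert.hyps by simp
    let ?h = "\<Oplus>\<^bsub>M\<^esub>j\<in>I. c k j s \<odot>\<^bsub>M\<^esub> w j"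
    have eq: "c k k s \<odot>\<^bsub>M\<^esub> w k = (\<Oplus>\<^bsub>M\<^esub>j\<in>insert k I. c k j s \<odot>\<^bsub>M\<^esub> w j) \<oplus>\<^bsub>M\<^esub> \<ominus>\<^bsub>M\<^esub> ?h"
    proof -
      have "x = (x \<oplus>\<^bsub>M\<^esub> y) \<oplus>\<^bsub>M\<^esub> \<ominus>\<^bsub>M\<^esub> y" if "x \<in> carrier M" "y \<in> carrier M" for x y
        using that by (simp add: M.a_assoc M.r_neg)
      from this[of "c k k s \<odot>\<^bsub>M\<^esub> w k" ?h] show ?thesis
        unfolding split[OF insertI1 sc] using cl w sc sumcl by blast
    qed
    have "c k k s \<odot>\<^bsub>M\<^esub> w k \<in> U s"
      by (rule ssubst[OF eq, of "\<lambda>x. x \<in> U s"],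
          rule sub(5)[OF s insert.prems(4)[OF s insertI1] sub(3)[OF s h]])
    moreover have unit: "c k k s \<in> Units R"
      using cl[OF insertI1 insertI1 sc] nz unfolding field_Units by simp
    ultimately have "inv c k k s \<odot>\<^bsub>M\<^esub> (c k k s \<odot>\<^bsub>M\<^esub> w k) \<in> U s"
      by (intro sub(4)[OF s Units_inv_closed])
    moreover have "inv c k k s \<odot>\<^bsub>M\<^esub> (c k k s \<odot>\<^bsub>M\<^esub> w k) = w k"
      using unit w[of k] by (subst smult_assoc1[symmetric]) auto
    ultimately show ?thesis
      by simp
  qed
  then have "{s \<in> S. \<not> w ` insert k I \<subseteq> U s} \<subseteq>
      {s \<in> S. \<not> w ` I \<subseteq> U s} \<union> {s \<in> carrier R. c k k s = \<zero>}"
    using S by auto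
  ultimately show ?case
    using finite_subset by blast
qed

section \<open>Duality and primitive decomposition in Gorenstein algebras\<close>

definition finite_span :: "'a set \<Rightarrow> ('a, 'b) ring_scheme \<Rightarrow> 'a set \<Rightarrow> 'a set" where
  "finite_span K R U = {\<Oplus>\<^bsub>R\<^esub>u\<in>U. k u \<otimes>\<^bsub>R\<^esub> u | k. k \<in> U \<rightarrow> K}"

lemma (in ring) finite_span_empty: "finite_span K R {} = {\<zero>}"
  by (auto simp: finite_span_def)

lemma (in ring) finite_span_insertI:
  assumes "finite U" "e \<notin> U" "insert e U \<subseteq> carrier R" "K \<subseteq> carrier R" "k \<in> K" "v \<in> finite_span K R U"
  shows "k \<otimes> e \<oplus> v \<in> finite_span K R (insert e U)"
proof -
  obtain h where h: "h \<in> U \<rightarrow> K" "v = (\<Oplus>u\<in>U. h u \<otimes> u)"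
    using assms(6) unfolding finite_span_def by blast
  have cl: "h u \<in> carrier R" "u \<in> carrier R" if "u \<in> U" for u
    using h(1) assms(3,4) that by auto
  have "(\<Oplus>u\<in>insert e U. (h(e := k)) u \<otimes> u) = (h(e := k)) e \<otimes> e \<oplus> (\<Oplus>u\<in>U. (h(e := k)) u \<otimes> u)"
    using assms cl by (intro finsum_insert) auto
  also have "(\<Oplus>u\<in>U. (h(e := k)) u \<otimes> u) = v"
    unfolding h(2) using assms(2) cl by (intro finsum_cong') auto
  finally have "k \<otimes> e \<oplus> v = (\<Oplus>u\<in>insert e U. (h(e := k)) u \<otimes> u)"
    by simp
  moreover have "h(e := k) \<in> insert e U \<rightarrow> K"
    using h(1) assms(5) by auto
  ultimately show ?thesis
    unfolding finite_span_def by blast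
qed

text \<open>The sum of all components of degree at least \<open>n\<close>. Generating it inductively
  makes closure under negation and multiplication rule inductions, with no decompositions to be
  chosen.\<close>

inductive_set graded_tail :: "('a, 'b) ring_scheme \<Rightarrow> (nat \<Rightarrow> 'a set) \<Rightarrow> nat \<Rightarrow> 'a set"
  for R gr n where
  component: "\<lbrakk> a \<in> gr i; n \<le> i \<rbrakk> \<Longrightarrow> a \<in> graded_tail R gr n"
| add: "\<lbrakk> a \<in> graded_tail R gr n; b \<in> graded_tail R gr n \<rbrakk> \<Longrightarrow> a \<oplus>\<^bsub>R\<^esub> b \<in> graded_tail R gr n"

section \<open>Homogeneous components and the ideals of elements of degree at least
  \<open>n\<close>\<close>

context standard_graded_algebra
begin

lemma gr_subset: "gr i \<subseteq> carrier A"
  using subalgebra_in_carrier[OF component_subspace] .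

lemma gr_carrier: "a \<in> gr i \<Longrightarrow> a \<in> carrier A"
  using gr_subset by blast

lemma gr_subgroup: "subgroup (gr i) (add_monoid A)"
  using component_subspace unfolding subalgebra_def by blast

lemma gr_zero: "\<zero> \<in> gr i"
  using subgroup.one_closed[OF gr_subgroup] by simp

lemma gr_add: "\<lbrakk> a \<in> gr i; b \<in> gr i \<rbrakk> \<Longrightarrow> a \<oplus> b \<in> gr i"
  using subgroup.m_closed[OF gr_subgroup] by simp

lemma gr_uminus: "a \<in> gr i \<Longrightarrow> \<ominus> a \<in> gr i"
  using subgroup.m_inv_closed[OF gr_subgroup] by (simp add: a_inv_def)

lemma gr_minus: "\<lbrakk> a \<in> gr i; b \<in> gr i \<rbrakk> \<Longrightarrow> a \<ominus> b \<in> gr i"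
  by (simp add: a_minus_def gr_add gr_uminus)

lemma gr_smult: "\<lbrakk> k \<in> K; a \<in> gr i \<rbrakk> \<Longrightarrow> k \<otimes> a \<in> gr i"
  using subalgebra.smult_closed[OF component_subspace] .

lemma K_carrier: "k \<in> K \<Longrightarrow> k \<in> carrier A"
  using gr_subset[of 0] component_zero by auto

lemma gr_one: "\<one> \<in> gr 0"
  using component_zero K.one_closed by simp

lemma gr_pow: "a \<in> gr 1 \<Longrightarrow> a [^] n \<in> gr n"
proof (induction n)
  case 0
  show ?case
    using gr_one by simp
next
  case (Suc n)
  then show ?case
    using mult_component[of "a [^] n" n a 1] by simp
qed

lemma gr_finsum:
  assumes "finite I" "\<And>i. i \<in> I \<Longrightarrow> h i \<in> gr d"
  shows "(\<Oplus>i\<in>I. h i) \<in> gr d"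
  using assms
proof (induction I)
  case empty
  show ?case
    by (simp add: gr_zero)
next
  case (insert i I)
  then have "(\<Oplus>i\<in>insert i I. h i) = h i \<oplus> (\<Oplus>i\<in>I. h i)"
    using gr_carrier by (intro finsum_insert) auto
  then show ?case
    using insert by (simp add: gr_add)
qed

lemma direct_sum_unique:
  assumes "\<And>i. c i \<in> gr i" "finite {i. c i \<noteq> \<zero>}" "\<And>i. c' i \<in> gr i" "finite {i. c' i \<noteq> \<zero>}"
    and "(\<Oplus>i\<in>{i. c i \<noteq> \<zero>}. c i) = (\<Oplus>i\<in>{i. c' i \<noteq> \<zero>}. c' i)"
  shows "c = c'"
proof -
  let ?a = "\<Oplus>i\<in>{i. c i \<noteq> \<zero>}. c i"
  have "?a \<in> carrier A"
    using assms(1) gr_carrier by (intro finsum_closed) auto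
  then have "\<exists>!d. (\<forall>i. d i \<in> gr i) \<and> finite {i. d i \<noteq> \<zero>} \<and> ?a = (\<Oplus>i\<in>{i. d i \<noteq> \<zero>}. d i)"
    by (rule direct_sum)
  then show ?thesis
    by (rule ex1E) (use assms in metis)
qed

lemma component_decomposition:
  assumes "a \<in> gr i"
  defines "c \<equiv> \<lambda>k. if k = i then a else \<zero>"
  shows "\<And>k. c k \<in> gr k" "finite {k. c k \<noteq> \<zero>}" "(\<Oplus>k\<in>{k. c k \<noteq> \<zero>}. c k) = a"
proof -
  show "c k \<in> gr k" for k
    using assms gr_zero by auto
  have sub: "{k. c k \<noteq> \<zero>} \<subseteq> {i}"
    by (auto simp: c_def)
  then show "finite {k. c k \<noteq> \<zero>}"
    using finite_subset by blast
  have "(\<Oplus>k\<in>{k. c k \<noteq> \<zero>}. c k) = (\<Oplus>k\<in>{i}. c k)"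
    using sub gr_carrier[OF assms(1)] by (intro add.finprod_mono_neutral_cong_left) (auto simp: c_def)
  also have "\<dots> = a"
    using gr_carrier[OF assms(1)] by (simp add: c_def)
  finally show "(\<Oplus>k\<in>{k. c k \<noteq> \<zero>}. c k) = a" .
qed

lemma gr_disjoint:
  assumes "a \<in> gr i" "a \<in> gr j" "i \<noteq> j"
  shows "a = \<zero>"
proof -
  have "(\<lambda>k. if k = i then a else \<zero>) = (\<lambda>k. if k = j then a else \<zero>)"
    by (rule direct_sum_unique[OF component_decomposition(1,2)[OF assms(1)]
          component_decomposition(1,2)[OF assms(2)]])
      (simp only: component_decomposition(3)[OF assms(1)] component_decomposition(3)[OF assms(2)])
  from fun_cong[OF this, of i] show ?thesis
    using assms(3) by simp
qed

lemma graded_tail_carrier: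
  assumes "a \<in> graded_tail A gr n"
  shows "a \<in> carrier A"
  using assms
proof (induction rule: graded_tail.induct)
  case (component a i)
  then show ?case
    by (intro gr_carrier)
next
  case (add a b)
  then show ?case
    by (intro a_closed)
qed

lemma graded_tail_uminus:
  assumes "a \<in> graded_tail A gr n"
  shows "\<ominus> a \<in> graded_tail A gr n"
  using assms
proof (induction rule: graded_tail.induct)
  case (component a i)
  then show ?case
    by (intro graded_tail.component[of _ gr i] gr_uminus)
next
  case (add a b)
  have "\<ominus> (a \<oplus> b) = \<ominus> a \<oplus> \<ominus> b"
    by (rule minus_add[OF graded_tail_carrier[OF add(1)] graded_tail_carrier[OF add(2)]])
  with add.IH show ?case
    by (simp only: graded_tail.add)
qed

lemma carrier_graded_tail: "a \<in> carrier A \<Longrightarrow> a \<in> graded_tail A gr 0"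
proof -
  assume "a \<in> carrier A"
  from direct_sum[OF this] obtain c where c: "\<And>i. c i \<in> gr i" "finite {i. c i \<noteq> \<zero>}"
    and a: "a = (\<Oplus>i\<in>{i. c i \<noteq> \<zero>}. c i)"
    by blast
  have "(\<Oplus>i\<in>I. c i) \<in> graded_tail A gr 0" if "finite I" for I
    using that
  proof (induction I)
    case empty
    then show ?case
      using graded_tail.component[of \<zero> gr 0 0 A] gr_zero by simp
  next
    case (insert i I)
    then have "(\<Oplus>i\<in>insert i I. c i) = c i \<oplus> (\<Oplus>i\<in>I. c i)"
      using c(1) gr_carrier by (intro finsum_insert) auto
    moreover have "c i \<in> graded_tail A gr 0"
      by (rule graded_tail.component[of _ gr i, OF c(1)]) simp
    ultimately show ?case
      using insert.IH by (simp only: graded_tail.add)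
  qed
  with a c(2) show ?thesis
    by simp
qed

lemma graded_tail_mult:
  assumes "r \<in> graded_tail A gr m" "a \<in> graded_tail A gr n"
  shows "r \<otimes> a \<in> graded_tail A gr n"
  using assms(1)
proof (induction rule: graded_tail.induct)
  case r: (component r i)
  show ?case
    using assms(2)
  proof (induction rule: graded_tail.induct)
    case (component a j)
    then show ?case
      using mult_component[OF r(1)] by (intro graded_tail.component[of _ gr "i + j"]) auto
  next
    case (add a b)
    have "r \<otimes> (a \<oplus> b) = r \<otimes> a \<oplus> r \<otimes> b"
      by (rule r_distr[OF graded_tail_carrier[OF add(1)] graded_tail_carrier[OF add(2)] gr_carrier[OF r(1)]])
    with add.IH show ?case
      by (simp only: graded_tail.add)
  qed
next
  case (add r s)
  have "(r \<oplus> s) \<otimes> a = r \<otimes> a \<oplus> s \<otimes> a"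
    by (rule l_distr[OF graded_tail_carrier[OF add(1)] graded_tail_carrier[OF add(2)] graded_tail_carrier[OF assms(2)]])
  with add.IH show ?case
    by (simp only: graded_tail.add)
qed

lemma graded_tail_ideal: "ideal (graded_tail A gr n) A"
proof (rule idealI)
  show "ring A"
    by (rule ring_axioms)
  show "subgroup (graded_tail A gr n) (add_monoid A)"
  proof (rule add.subgroupI)
    show "graded_tail A gr n \<subseteq> carrier A"
      using graded_tail_carrier by blast
    show "graded_tail A gr n \<noteq> {}"
      using graded_tail.component[of \<zero> gr n n A] gr_zero by blast
    show "\<ominus> a \<in> graded_tail A gr n" if "a \<in> graded_tail A gr n" for a
      using graded_tail_uminus[OF that] .
  qed (auto intro: graded_tail.add)
  fix a x assume ax: "a \<in> graded_tail A gr n" "x \<in> carrier A"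
  show "x \<otimes> a \<in> graded_tail A gr n"
    using graded_tail_mult[OF carrier_graded_tail[OF ax(2)] ax(1)] .
  then show "a \<otimes> x \<in> graded_tail A gr n"
    using ax graded_tail_carrier m_comm by simp
qed

text \<open>Uniqueness of components can be applied to a decomposition without terms below degree
  \<open>n\<close>: an element of \<open>gr n\<close> in the tail from \<open>Suc n\<close> has two
  decompositions and must vanish.\<close>

lemma graded_tail_decomposition:
  assumes "a \<in> graded_tail A gr n"
  shows "\<exists>c. (\<forall>i. c i \<in> gr i) \<and> finite {i. c i \<noteq> \<zero>} \<and> (\<forall>i<n. c i = \<zero>) \<and>
    a = (\<Oplus>i\<in>{i. c i \<noteq> \<zero>}. c i)"
  using assms
proof (induction rule: graded_tail.induct)
  case (component a i)
  note dec = component_decomposition[OF component(1)]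
  have "\<forall>k<n. (if k = i then a else \<zero>) = \<zero>" "\<forall>k. (if k = i then a else \<zero>) \<in> gr k"
    using component(2) dec(1) by simp_all
  then show ?case
    by (intro exI[of _ "\<lambda>k. if k = i then a else \<zero>"] conjI dec(2) dec(3)[symmetric])
next
  case (add a b)
  from add.IH(1) obtain c where cx: "\<forall>i. c i \<in> gr i" "finite {i. c i \<noteq> \<zero>}" "\<forall>i<n. c i = \<zero>"
      "a = (\<Oplus>i\<in>{i. c i \<noteq> \<zero>}. c i)"
    by (elim exE conjE) (rule that)
  from add.IH(2) obtain c' where cx': "\<forall>i. c' i \<in> gr i" "finite {i. c' i \<noteq> \<zero>}" "\<forall>i<n. c' i = \<zero>"
      "b = (\<Oplus>i\<in>{i. c' i \<noteq> \<zero>}. c' i)"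
    by (elim exE conjE) (rule that)
  note c = cx(1)[rule_format] cx(2) cx(3)[rule_format] cx(4)
  note c' = cx'(1)[rule_format] cx'(2) cx'(3)[rule_format] cx'(4)
  let ?d = "\<lambda>i. c i \<oplus> c' i"
  let ?I = "{i. c i \<noteq> \<zero>} \<union> {i. c' i \<noteq> \<zero>}"
  have sub: "{i. ?d i \<noteq> \<zero>} \<subseteq> ?I"
    by auto
  have fin: "finite ?I"
    using c(2) c'(2) by simp
  have cl: "c i \<in> carrier A" "c' i \<in> carrier A" for i
    using c(1) c'(1) gr_carrier by auto
  have "(\<Oplus>i\<in>{i. ?d i \<noteq> \<zero>}. ?d i) = (\<Oplus>i\<in>?I. ?d i)"
    using sub fin cl by (intro add.finprod_mono_neutral_cong_left) auto
  also have "\<dots> = (\<Oplus>i\<in>?I. c i) \<oplus> (\<Oplus>i\<in>?I. c' i)"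
    using cl by (intro finsum_addf) auto
  also have "(\<Oplus>i\<in>?I. c i) = a"
    unfolding c(4) using fin cl by (intro add.finprod_mono_neutral_cong_right) auto
  also have "(\<Oplus>i\<in>?I. c' i) = b"
    unfolding c'(4) using fin cl by (intro add.finprod_mono_neutral_cong_right) auto
  finally have "a \<oplus> b = (\<Oplus>i\<in>{i. ?d i \<noteq> \<zero>}. ?d i)"
    by (rule sym)
  moreover have "\<forall>i. ?d i \<in> gr i" "\<forall>i<n. ?d i = \<zero>"
    using c(1,3) c'(1,3) gr_add by auto
  ultimately show ?case
    using finite_subset[OF sub fin] by (intro exI[of _ ?d] conjI)
qed

lemma component_inter_graded_tail:
  assumes "a \<in> gr n" "a \<in> graded_tail A gr (Suc n)"
  shows "a = \<zero>"
proof -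
  from graded_tail_decomposition[OF assms(2)] obtain c where cx: "\<forall>i. c i \<in> gr i"
    "finite {i. c i \<noteq> \<zero>}" "\<forall>i<Suc n. c i = \<zero>" "a = (\<Oplus>i\<in>{i. c i \<noteq> \<zero>}. c i)"
    by (elim exE conjE) (rule that)
  note c = cx(1)[rule_format] cx(2) cx(3)[rule_format] cx(4)
  have "c = (\<lambda>k. if k = n then a else \<zero>)"
    by (rule direct_sum_unique[OF c(1,2) component_decomposition(1,2)[OF assms(1)]])
      (simp only: component_decomposition(3)[OF assms(1)] c(4)[symmetric])
  with c(3)[of n] show ?thesis
    by simp
qed

end

section \<open>Top degree and socle\<close>

context artinian_gorenstein_algebra
begin

text \<open>The tails form a descending chain of ideals. Once it is stationary, a component lies in
  the next tail, which it meets only in zero. Hence only finitely many components are nonzero, among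
  them \<open>gr 0\<close>, which contains \<open>\<one>\<close>.\<close>

lemma exists_top_degree: "\<exists>c. gr c \<noteq> {\<zero>} \<and> (\<forall>i>c. gr i = {\<zero>})"
proof -
  have "graded_tail A gr (Suc n) \<subseteq> graded_tail A gr n" for n
  proof
    fix a assume "a \<in> graded_tail A gr (Suc n)"
    then show "a \<in> graded_tail A gr n"
      by (induction rule: graded_tail.induct)
        (auto intro: graded_tail.add graded_tail.component[of _ gr] Suc_leD)
  qed
  then have "\<exists>N. \<forall>n\<ge>N. graded_tail A gr n = graded_tail A gr N"
    by (intro descending_chain graded_tail_ideal)
  then obtain N where N: "\<And>n. n \<ge> N \<Longrightarrow> graded_tail A gr n = graded_tail A gr N"
    by blast
  have zero: "gr i = {\<zero>}" if "i \<ge> N" for i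
  proof -
    have "a = \<zero>" if "a \<in> gr i" for a
    proof (rule component_inter_graded_tail[OF that])
      show "a \<in> graded_tail A gr (Suc i)"
        using graded_tail.component[of a gr i i A] that N[of i] N[of "Suc i"] \<open>i \<ge> N\<close> by simp
    qed
    then show ?thesis
      using gr_zero by blast
  qed
  have "\<one> \<noteq> \<zero>"
    using subfieldE(6)[OF K.subfield_axioms] .
  then have "gr 0 \<noteq> {\<zero>}"
    using gr_one by auto
  then have "0 \<in> {i. gr i \<noteq> {\<zero>}}"
    by simp
  moreover have "{i. gr i \<noteq> {\<zero>}} \<subseteq> {..<N}"
  proof
    fix i assume "i \<in> {i. gr i \<noteq> {\<zero>}}"
    then show "i \<in> {..<N}"
      using zero[of i] by (cases "N \<le> i") simp_all
  qed
  then have fin: "finite {i. gr i \<noteq> {\<zero>}}"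
    by (rule finite_subset) simp
  ultimately have "Max {i. gr i \<noteq> {\<zero>}} \<in> {i. gr i \<noteq> {\<zero>}}"
    by (intro Max_in) auto
  moreover have "gr i = {\<zero>}" if "i > Max {i. gr i \<noteq> {\<zero>}}" for i
    using Max_ge[OF fin, of i] that by (cases "gr i = {\<zero>}") simp_all
  ultimately show ?thesis
    by blast
qed

lemma socle_proportional:
  assumes "x \<in> graded_socle A gr" "y \<in> graded_socle A gr" "x \<noteq> \<zero>"
  shows "\<exists>k\<in>K. y = k \<otimes> x"
proof -
  have "\<exists>v\<in>carrier A. graded_socle A gr = line_extension K v {\<zero>}"
    using socle_dimension
  proof (cases rule: dimension.cases)
    case (Suc_dim v E n)
    then have "E = {\<zero>}"
      using dimension_zero[OF K.subfield_axioms] by simp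
    with Suc_dim show ?thesis
      by blast
  qed simp
  then obtain v where v: "v \<in> carrier A" "graded_socle A gr = line_extension K v {\<zero>}"
    by blast
  obtain k l where k: "k \<in> K" "x = k \<otimes> v" and l: "l \<in> K" "y = l \<otimes> v"
    using assms(1,2) v K_carrier unfolding v(2) line_extension_mem_iff by auto
  have k0: "k \<in> K - {\<zero>}"
    using k v assms(3) by auto
  note inv = subfield_m_inv[OF K.subfield_axioms k0]
  have cl: "k \<in> carrier A" "l \<in> carrier A" "inv k \<in> carrier A"
    using k(1) l(1) inv(1) K_carrier by simp_all
  have "l \<otimes> inv k \<otimes> x = l \<otimes> (inv k \<otimes> k \<otimes> v)"
    unfolding k(2) using cl v(1) by (simp only: m_assoc m_closed)
  also have "\<dots> = y"
    using inv(3) cl v(1) l(2) by simp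
  finally have "y = l \<otimes> inv k \<otimes> x"
    by (rule sym)
  moreover have "l \<otimes> inv k \<in> K"
    using l(1) inv(1) K.m_closed by simp
  ultimately show ?thesis
    by (rule bexI)
qed

end

section \<open>The pairing of \<open>A\<close> into its top component\<close>

locale gorenstein_top = artinian_gorenstein_algebra K A gr
  for K :: "'a set" and A :: "('a, 'b) ring_scheme" (structure) and gr :: "nat \<Rightarrow> 'a set" +
  fixes c :: nat
  assumes top_nonzero: "gr c \<noteq> {\<zero>}"
    and above_top: "i > c \<Longrightarrow> gr i = {\<zero>}"
begin

lemma top_socle: "x \<in> gr c \<Longrightarrow> x \<in> graded_socle A gr"
  using mult_component[of _ _ x c] above_top gr_carrier unfolding graded_socle_def by force

lemma top_proportional: "\<lbrakk> x \<in> gr c; y \<in> gr c; x \<noteq> \<zero> \<rbrakk> \<Longrightarrow> \<exists>k\<in>K. y = k \<otimes> x"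
  by (intro socle_proportional top_socle)

text \<open>The socle is a line over \<open>K\<close> and contains the nonzero component
  \<open>gr c\<close>, so all of it has degree \<open>c\<close>.\<close>

lemma socle_component:
  assumes "a \<in> gr i" "a \<in> graded_socle A gr" "a \<noteq> \<zero>"
  shows "i = c"
proof -
  obtain w where w: "w \<in> gr c" "w \<noteq> \<zero>"
    using top_nonzero gr_zero by blast
  obtain k where "k \<in> K" "a = k \<otimes> w"
    using socle_proportional[OF top_socle[OF w(1)] assms(2) w(2)] by blast
  then have "a \<in> gr c"
    using gr_smult w by blast
  then show ?thesis
    using gr_disjoint assms by blast
qed

lemma degree_le_top: "\<lbrakk> a \<in> gr i; a \<noteq> \<zero> \<rbrakk> \<Longrightarrow> i \<le> c"
  using above_top[of i] by (metis not_le singletonD)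

text \<open>Outside the socle an element has a nonzero product with some element of positive degree.
  This can be repeated until the socle is reached, which happens in degree \<open>c\<close> only;
  the induction is on the distance \<open>c - i\<close>. Thus the product of
  \<open>gr (c - i)\<close> and \<open>gr i\<close> into \<open>gr c\<close> is a pairing without
  kernel.\<close>

lemma nondegenerate:
  assumes "a \<in> gr i" "a \<noteq> \<zero>"
  shows "\<exists>b\<in>gr (c - i). b \<otimes> a \<noteq> \<zero>"
  using assms
proof (induction "c - i" arbitrary: a i rule: less_induct)
  case less
  show ?case
  proof (cases "a \<in> graded_socle A gr")
    case True
    then have "i = c"
      using socle_component less.prems by blast
    then show ?thesis
      using less.prems gr_one gr_carrier by (intro bexI[of _ \<one>]) auto
  next
    case False
    then obtain j b where b: "j > 0" "b \<in> gr j" "b \<otimes> a \<noteq> \<zero>"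
      using less.prems gr_carrier unfolding graded_socle_def by blast
    have ba: "b \<otimes> a \<in> gr (j + i)"
      using mult_component b less.prems by blast
    then have le: "j + i \<le> c"
      using degree_le_top b by blast
    then obtain b' where b': "b' \<in> gr (c - (j + i))" "b' \<otimes> (b \<otimes> a) \<noteq> \<zero>"
      using less.hyps[OF _ ba b(3)] b(1) by force
    then have "(b' \<otimes> b) \<otimes> a \<noteq> \<zero>"
      using b less.prems gr_carrier by (simp add: m_assoc)
    moreover have "b' \<otimes> b \<in> gr (c - i)"
      using mult_component[OF b'(1) b(2)] le by simp
    ultimately show ?thesis
      by blast
  qed
qed

text \<open>Finite-dimensional subspaces of a component coincide with their double annihilators.\<close>

lemma exists_annihilator_separating:
  assumes "finite U" "U \<subseteq> gr i" "i \<le> c" "v \<in> gr i" "v \<notin> finite_span K A U"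
  shows "\<exists>g\<in>gr (c - i). (\<forall>u\<in>U. g \<otimes> u = \<zero>) \<and> g \<otimes> v \<noteq> \<zero>"
  using assms(1,2,4,5)
proof (induction U arbitrary: v)
  case empty
  then have "v \<noteq> \<zero>"
    by (simp add: finite_span_empty)
  then show ?case
    using nondegenerate[OF empty(2)] by auto
next
  case (insert e U)
  have e: "e \<in> gr i" and U: "U \<subseteq> gr i"
    using insert.prems by auto
  have insI: "k \<otimes> e \<oplus> x \<in> finite_span K A (insert e U)" if "k \<in> K" "x \<in> finite_span K A U" for k x
    using that insert.hyps insert.prems(1) gr_subset K_carrier
    by (intro finite_span_insertI) auto
  have cl: "x \<otimes> y \<in> gr c" if "x \<in> gr (c - i)" "y \<in> gr i" for x y
    using mult_component[OF that] assms(3) by simp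
  show ?case
  \<comment> \<open>If everything annihilating \<open>U\<close> also annihilates \<open>e\<close>,
    the induction hypothesis for \<open>U\<close> suffices. Otherwise some \<open>g\<close>
    annihilates \<open>U\<close> but not \<open>e\<close>, and it measures the component of a vector
    along \<open>e\<close>.\<close>
  proof (cases "\<forall>g\<in>gr (c - i). (\<forall>u\<in>U. g \<otimes> u = \<zero>) \<longrightarrow> g \<otimes> e = \<zero>")
    case True
    have "v \<notin> finite_span K A U"
    proof
      assume "v \<in> finite_span K A U"
      from insI[OF _ this, of \<zero>] show False
        using insert.prems e gr_carrier gr_zero component_zero by auto
    qed
    then show ?thesis
      using insert.IH[OF U insert.prems(2)] True by auto
  next
    case False
    then obtain g where g: "g \<in> gr (c - i)" "\<forall>u\<in>U. g \<otimes> u = \<zero>" "g \<otimes> e \<noteq> \<zero>"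
      by blast
    obtain k where k: "k \<in> K" "g \<otimes> v = k \<otimes> (g \<otimes> e)"
      using top_proportional[OF cl[OF g(1) e] cl[OF g(1) insert.prems(2)] g(3)] by blast
    note [simp] = gr_carrier[OF g(1)] gr_carrier[OF e] gr_carrier[OF insert.prems(2)] K_carrier[OF k(1)]
    \<comment> \<open>The part of \<open>v\<close> along \<open>e\<close> is removed, so that
      \<open>g \<otimes> ?v = \<zero>\<close>; the remainder is still outside the span of
      \<open>U\<close>.\<close>
    let ?v = "v \<ominus> k \<otimes> e"
    have "?v \<notin> finite_span K A U"
    proof
      assume "?v \<in> finite_span K A U"
      from insI[OF k(1) this] have "k \<otimes> e \<oplus> ?v \<in> finite_span K A (insert e U)" .
      moreover have "k \<otimes> e \<oplus> ?v = v"
        by (simp add: a_minus_def a_ac r_neg)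
      ultimately show False
        using insert.prems by simp
    qed
    moreover have "?v \<in> gr i"
      using insert.prems(2) e k(1) gr_minus gr_smult by simp
    ultimately obtain g' where g': "g' \<in> gr (c - i)" "\<forall>u\<in>U. g' \<otimes> u = \<zero>" "g' \<otimes> ?v \<noteq> \<zero>"
      using insert.IH[OF U] by blast
    obtain l where l: "l \<in> K" "g' \<otimes> e = l \<otimes> (g \<otimes> e)"
      using top_proportional[OF cl[OF g(1) e] cl[OF g'(1) e] g(3)] by blast
    note [simp] = gr_carrier[OF g'(1)] K_carrier[OF l(1)]
    \<comment> \<open>Subtracting a multiple of \<open>g\<close> makes the separating element
      annihilate \<open>e\<close> as well. Its value on \<open>v\<close> is that of
      \<open>g'\<close> on \<open>?v\<close>, because \<open>g\<close> annihilates
      \<open>?v\<close>.\<close>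
    let ?g = "g' \<ominus> l \<otimes> g"
    have dist: "?g \<otimes> x = g' \<otimes> x \<ominus> l \<otimes> (g \<otimes> x)" if "x \<in> carrier A" for x
      using that by (simp add: a_minus_def l_distr l_minus m_assoc)
    have "?g \<otimes> u = \<zero>" if "u \<in> insert e U" for u
    proof -
      have "u \<in> carrier A"
        using that U e gr_carrier by blast
      from dist[OF this] show ?thesis
        using that g(2) g'(2) l(2) by (elim insertE) (simp_all add: a_minus_def r_neg)
    qed
    moreover have "?g \<otimes> v = g' \<otimes> ?v"
    proof -
      have "?g \<otimes> v = g' \<otimes> v \<ominus> k \<otimes> (l \<otimes> (g \<otimes> e))"
        by (simp add: dist k(2) m_lcomm)
      also have "\<dots> = g' \<otimes> v \<ominus> k \<otimes> (g' \<otimes> e)"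
        by (simp add: l(2))
      also have "\<dots> = g' \<otimes> ?v"
        by (simp add: a_minus_def r_distr r_minus m_lcomm)
      finally show ?thesis .
    qed
    moreover have "?g \<in> gr (c - i)"
      using g'(1) g(1) l(1) gr_minus gr_smult by simp
    ultimately show ?thesis
      using g'(3) by (intro bexI[of _ ?g]) auto
  qed
qed

lemma annihilator_ideal:
  assumes "U \<subseteq> carrier A"
  shows "ideal {a \<in> carrier A. \<forall>u\<in>U. a \<otimes> u = \<zero>} A"
proof (rule idealI)
  show "ring A"
    by (rule ring_axioms)
  show "subgroup {a \<in> carrier A. \<forall>u\<in>U. a \<otimes> u = \<zero>} (add_monoid A)"
  proof (rule add.subgroupI)
    show "{a \<in> carrier A. \<forall>u\<in>U. a \<otimes> u = \<zero>} \<noteq> {}"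
      using assms by (auto intro!: exI[of _ \<zero>])
    fix a assume "a \<in> {a \<in> carrier A. \<forall>u\<in>U. a \<otimes> u = \<zero>}"
    then show "\<ominus> a \<in> {a \<in> carrier A. \<forall>u\<in>U. a \<otimes> u = \<zero>}"
      using assms by (auto simp: l_minus)
  qed (use assms in \<open>auto simp: l_distr\<close>)
  fix a x assume ax: "a \<in> {a \<in> carrier A. \<forall>u\<in>U. a \<otimes> u = \<zero>}" "x \<in> carrier A"
  then have "x \<otimes> a \<otimes> u = \<zero>" if "u \<in> U" for u
    using that assms by (simp add: m_assoc subset_iff)
  then show "x \<otimes> a \<in> {a \<in> carrier A. \<forall>u\<in>U. a \<otimes> u = \<zero>}"
    using ax by auto
  then show "a \<otimes> x \<in> {a \<in> carrier A. \<forall>u\<in>U. a \<otimes> u = \<zero>}"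
    using ax m_comm by auto
qed

text \<open>Vectors chosen successively outside the span of their predecessors would give
  annihilators \<open>I n\<close> that shrink strictly at each step, as each new vector can be
  separated from the old ones; the descending chain condition forbids this.\<close>

lemma component_finite_span:
  assumes "i \<le> c"
  shows "\<exists>U. finite U \<and> U \<subseteq> gr i \<and> gr i \<subseteq> finite_span K A U"
proof (rule ccontr)
  assume "\<not> ?thesis"
  then have "\<exists>v. v \<in> gr i \<and> v \<notin> finite_span K A U" if "finite U" "U \<subseteq> gr i" for U
    using that by blast
  then obtain v where v: "\<And>U. \<lbrakk> finite U; U \<subseteq> gr i \<rbrakk> \<Longrightarrow> v U \<in> gr i \<and> v U \<notin> finite_span K A U"
    by metis
  define U where "U = rec_nat {} (\<lambda>_ U. insert (v U) U)"
  have U_Suc: "U (Suc n) = insert (v (U n)) (U n)" for n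
    by (simp add: U_def)
  have U: "finite (U n) \<and> U n \<subseteq> gr i" for n
  proof (induction n)
    case 0
    then show ?case
      by (simp add: U_def)
  next
    case (Suc n)
    then show ?case
      using v[of "U n"] by (simp add: U_Suc)
  qed
  define I where "I n = {a \<in> carrier A. \<forall>u\<in>U n. a \<otimes> u = \<zero>}" for n
  have "ideal (I n) A" for n
    unfolding I_def using U gr_subset by (intro annihilator_ideal) blast
  moreover have "I (Suc n) \<subseteq> I n" for n
    by (auto simp: I_def U_Suc)
  ultimately have "\<exists>N. \<forall>n\<ge>N. I n = I N"
    by (intro descending_chain)
  then obtain N where "\<forall>n\<ge>N. I n = I N"
    by blast
  then have eq: "I (Suc N) = I N"
    by (elim allE[of _ "Suc N"]) simp
  have UN: "finite (U N)" "U N \<subseteq> gr i"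
    using U[of N] by simp_all
  have "v (U N) \<in> gr i" "v (U N) \<notin> finite_span K A (U N)"
    using v[OF UN] by simp_all
  from exists_annihilator_separating[OF UN assms this] obtain g
    where g: "g \<in> gr (c - i)" "\<forall>u\<in>U N. g \<otimes> u = \<zero>" "g \<otimes> v (U N) \<noteq> \<zero>"
    by (elim bexE conjE)
  then have "g \<in> I N" "g \<notin> I (Suc N)"
    using gr_carrier[OF g(1)] by (simp_all add: I_def U_Suc)
  with eq show False
    by simp
qed

text \<open>Multiplication by \<open>y\<close> is its own transpose for the pairing. If
  \<open>w\<close> were outside the image, separation would give \<open>g\<close> in
  \<open>gr i\<close> annihilating the image but not \<open>w\<close>; then
  \<open>y \<otimes> g\<close> annihilates \<open>gr i\<close>, hence is zero, and injectivity gives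
  \<open>g = \<zero>\<close>.\<close>

lemma injective_imp_surjective:
  assumes "i \<le> c" and y: "y \<in> gr m" and m: "i + m = c - i"
    and inj: "\<And>a. \<lbrakk> a \<in> gr i; y \<otimes> a = \<zero> \<rbrakk> \<Longrightarrow> a = \<zero>"
    and w: "w \<in> gr (c - i)"
  shows "\<exists>a\<in>gr i. w = y \<otimes> a"
proof (rule ccontr)
  assume no: "\<not> ?thesis"
  from component_finite_span[OF assms(1)]
  obtain U where U: "finite U" "U \<subseteq> gr i" "gr i \<subseteq> finite_span K A U"
    by (elim exE conjE)
  let ?U = "(\<otimes>) y ` U"
  have yU: "y \<otimes> a \<in> gr (c - i)" if "a \<in> gr i" for a
    using mult_component[OF y that] m by (simp add: add.commute)
  have "w \<notin> finite_span K A ?U"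
  proof
    assume "w \<in> finite_span K A ?U"
    then obtain k where k: "k \<in> ?U \<rightarrow> K" and wk: "w = (\<Oplus>u\<in>?U. k u \<otimes> u)"
      unfolding finite_span_def by blast
    \<comment> \<open>One preimage for each product: coefficients in \<open>finite_span\<close> are
      indexed by the image set, in which generators with equal products have been merged.\<close>
    define s where "s = (\<lambda>u. SOME a. a \<in> U \<and> u = y \<otimes> a)"
    have s: "s u \<in> U \<and> u = y \<otimes> s u" if "u \<in> ?U" for u
      unfolding s_def by (rule someI_ex) (use that in blast)
    have scl: "s u \<in> carrier A" "k u \<in> carrier A" if "u \<in> ?U" for u
      using s[OF that] U(2) gr_carrier K_carrier[OF funcset_mem[OF k that]] by auto
    have "w = (\<Oplus>u\<in>?U. y \<otimes> (k u \<otimes> s u))"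
      unfolding wk
    proof (rule finsum_cong')
      fix u assume u: "u \<in> ?U"
      have "y \<otimes> (k u \<otimes> s u) = k u \<otimes> (y \<otimes> s u)"
        using scl[OF u] gr_carrier[OF y] by (simp add: m_lcomm)
      then show "k u \<otimes> u = y \<otimes> (k u \<otimes> s u)"
        using s[OF u] by simp
    qed (use scl gr_carrier[OF y] in auto)
    also have "\<dots> = y \<otimes> (\<Oplus>u\<in>?U. k u \<otimes> s u)"
    proof (rule finsum_rdistr[symmetric])
      show "finite ?U" "y \<in> carrier A"
        using U(1) gr_carrier[OF y] by auto
      show "(\<lambda>u. k u \<otimes> s u) \<in> ?U \<rightarrow> carrier A"
        using scl by blast
    qed
    finally have "w = y \<otimes> (\<Oplus>u\<in>?U. k u \<otimes> s u)" .
    moreover have "(\<Oplus>u\<in>?U. k u \<otimes> s u) \<in> gr i"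
      using U s k by (intro gr_finsum gr_smult) auto
    ultimately show False
      using no by blast
  qed
  moreover have "?U \<subseteq> gr (c - i)"
    using U(2) yU by blast
  ultimately have "\<exists>g\<in>gr (c - (c - i)). (\<forall>u\<in>?U. g \<otimes> u = \<zero>) \<and> g \<otimes> w \<noteq> \<zero>"
    using U(1) w by (intro exists_annihilator_separating) simp_all
  then obtain g where g: "g \<in> gr (c - (c - i))" "\<forall>u\<in>?U. g \<otimes> u = \<zero>" "g \<otimes> w \<noteq> \<zero>"
    by (elim bexE conjE)
  then have gi: "g \<in> gr i"
    using assms(1) by simp
  have "(y \<otimes> g) \<otimes> a = \<zero>" if "a \<in> gr i" for a
  proof -
    obtain k where k: "k \<in> U \<rightarrow> K" and a: "a = (\<Oplus>u\<in>U. k u \<otimes> u)"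
      using U(3) \<open>a \<in> gr i\<close> unfolding finite_span_def by blast
    have "(y \<otimes> g) \<otimes> a = (\<Oplus>u\<in>U. (y \<otimes> g) \<otimes> (k u \<otimes> u))"
      unfolding a
    proof (rule finsum_rdistr)
      show "finite U" "y \<otimes> g \<in> carrier A"
        using U(1) gr_carrier[OF y] gr_carrier[OF gi] by auto
      show "(\<lambda>u. k u \<otimes> u) \<in> U \<rightarrow> carrier A"
        using U(2) gr_carrier K_carrier[OF funcset_mem[OF k]] by auto
    qed
    also have "\<dots> = \<zero>"
    proof (rule add.finprod_one_eqI)
      fix u assume u: "u \<in> U"
      have [simp]: "u \<in> carrier A" "k u \<in> carrier A" "y \<in> carrier A" "g \<in> carrier A"
        using u U(2) K_carrier[OF funcset_mem[OF k u]] gr_carrier[OF y] gr_carrier[OF gi] gr_carrier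
        by auto
      have "(y \<otimes> g) \<otimes> (k u \<otimes> u) = k u \<otimes> (g \<otimes> (y \<otimes> u))"
        by (simp add: m_ac)
      then show "(y \<otimes> g) \<otimes> (k u \<otimes> u) = \<zero>"
        using g(2) u by simp
    qed
    finally show ?thesis .
  qed
  then have "a \<otimes> (y \<otimes> g) = \<zero>" if "a \<in> gr i" for a
    using that gr_carrier[OF that] gr_carrier[OF y] gr_carrier[OF gi] by (metis m_closed m_comm)
  then have "y \<otimes> g = \<zero>"
    using nondegenerate[OF yU[OF gi]] assms(1) by auto
  then have "g = \<zero>"
    using inj gi by blast
  then show False
    using g(3) gr_carrier[OF w] by simp
qed

text \<open>Source and target are dual to each other, so either alternative of maximal rank gives
  surjectivity. The exponent \<open>0\<close> is treated apart because the Lefschetz condition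
  starts at \<open>r = 1\<close>.\<close>

lemma strong_lefschetz_surjective:
  assumes z: "strong_lefschetz_element A gr z" and i: "2 * i \<le> c" and w: "w \<in> gr (c - i)"
  shows "\<exists>a\<in>gr i. w = z [^] (c - 2 * i) \<otimes> a"
proof (cases "c - 2 * i = 0")
  case True
  then have "c - i = i"
    using i by simp
  then show ?thesis
    using True w gr_carrier[OF w] by (intro bexI[of _ w]) auto
next
  case False
  let ?m = "c - 2 * i"
  have z1: "z [^] ?m \<in> gr ?m"
    using z gr_pow unfolding strong_lefschetz_element_def by blast
  have eq: "i + ?m = c - i"
    using i by simp
  from z False have "inj_on (\<lambda>b. z [^] ?m \<otimes> b) (gr i) \<or> (\<lambda>b. z [^] ?m \<otimes> b) ` gr i = gr (c - i)"
    unfolding strong_lefschetz_element_def lefschetz_element_def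
    by (metis eq One_nat_def Suc_leI neq0_conv)
  then show ?thesis
  proof
    assume "inj_on (\<lambda>b. z [^] ?m \<otimes> b) (gr i)"
    then have "a = \<zero>" if "a \<in> gr i" "z [^] ?m \<otimes> a = \<zero>" for a
      using that gr_zero[of i] gr_carrier[OF z1] by (auto dest: inj_onD[where y = \<zero>])
    then show ?thesis
      using injective_imp_surjective[OF _ z1 eq _ w] i by simp
  next
    assume "(\<lambda>b. z [^] ?m \<otimes> b) ` gr i = gr (c - i)"
    then show ?thesis
      using w by blast
  qed
qed

text \<open>The primitive decomposition of \<open>A\<close> with respect to \<open>z\<close>, in the form of an induction rule.\<close>

lemma primitive_induct [consumes 3, case_names string add]:
  assumes z: "strong_lefschetz_element A gr z" and "j \<le> c" and b: "b \<in> gr j"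
    and string: "\<And>l t p. \<lbrakk> 2 * l \<le> c; l + t = j; p \<in> gr l; z [^] (c - 2 * l + 1) \<otimes> p = \<zero> \<rbrakk> \<Longrightarrow>
      Q (z [^] t \<otimes> p)"
    and add: "\<And>a b. \<lbrakk> a \<in> gr j; b \<in> gr j; Q a; Q b \<rbrakk> \<Longrightarrow> Q (a \<oplus> b)"
  shows "Q b"
proof -
  have z1: "z \<in> gr 1"
    using z unfolding strong_lefschetz_element_def by blast
  note [simp] = gr_carrier[OF z1]
  \<comment> \<open>The exponent \<open>t\<close> is arbitrary because the induction on
    \<open>l\<close> moves a factor \<open>z\<close> from the element into the power in front of
    it.\<close>
  have low: "Q (z [^] t \<otimes> b)" if "b \<in> gr l" "2 * l \<le> c" "l + t = j" for l t b
    using that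
  proof (induction l arbitrary: t b)
    case 0
    have "z [^] (c + 1) \<otimes> b \<in> gr (c + 1)"
      using mult_component[OF gr_pow[OF z1] 0(1), of "c + 1"] by (simp only: add_0_right)
    then have "z [^] (c + 1) \<otimes> b = \<zero>"
      using above_top[of "c + 1"] by auto
    then show ?case
      using 0 string[of 0 t b] by simp
  next
    case (Suc l)
    \<comment> \<open>This product has degree \<open>c - l\<close> and is therefore also reached
      from degree \<open>l\<close> by \<open>z [^] (c - 2 * l)\<close>, an exponent larger by one.
      Comparing the two gives \<open>b'\<close> such that \<open>b \<ominus> z \<otimes> b'\<close>
      is primitive, which decomposes \<open>b\<close>.\<close>
    let ?w = "z [^] (c - 2 * Suc l + 1) \<otimes> b"
    have eq: "c - 2 * Suc l + 1 + Suc l = c - l" "c - 2 * l = Suc (c - 2 * Suc l + 1)"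
      using Suc.prems(2) by auto
    have "?w \<in> gr (c - l)"
      using mult_component[OF gr_pow[OF z1, of "c - 2 * Suc l + 1"] Suc.prems(1)] unfolding eq(1) .
    then have "\<exists>b'\<in>gr l. ?w = z [^] (c - 2 * l) \<otimes> b'"
      using Suc.prems(2) by (intro strong_lefschetz_surjective[OF z]) simp_all
    then obtain b' where b': "b' \<in> gr l" "?w = z [^] (c - 2 * l) \<otimes> b'"
      by (elim bexE)
    note [simp] = gr_carrier[OF b'(1)] gr_carrier[OF Suc.prems(1)]
    let ?p = "b \<ominus> z \<otimes> b'"
    have zb': "z \<otimes> b' \<in> gr (Suc l)"
      using mult_component[OF z1 b'(1)] by simp
    have p: "?p \<in> gr (Suc l)"
      using gr_minus[OF Suc.prems(1) zb'] .
    have "?w = z [^] (c - 2 * Suc l + 1) \<otimes> (z \<otimes> b')"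
      using b'(2) unfolding eq(2) by (simp add: m_assoc)
    then have "z [^] (c - 2 * Suc l + 1) \<otimes> ?p = \<zero>"
      by (simp add: a_minus_def r_distr r_minus r_neg del: nat_pow_Suc)
    then have "Q (z [^] t \<otimes> ?p)"
      using string[OF Suc.prems(2,3) p] by simp
    moreover have "Q (z [^] Suc t \<otimes> b')"
      using Suc.IH[OF b'(1), of "Suc t"] Suc.prems by simp
    moreover have "z [^] t \<otimes> ?p \<in> gr j"
      using mult_component[OF gr_pow[OF z1, of t] p] Suc.prems(3) by (simp add: add.commute)
    moreover have "z [^] Suc t \<otimes> b' \<in> gr j"
      using mult_component[OF gr_pow[OF z1, of "Suc t"] b'(1)] Suc.prems(3)
      by (simp add: add.commute)
    ultimately have "Q (z [^] t \<otimes> ?p \<oplus> z [^] Suc t \<otimes> b')"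
      using add by blast
    moreover have "z [^] t \<otimes> ?p \<oplus> z [^] Suc t \<otimes> b' = z [^] t \<otimes> b"
      by (simp add: a_minus_def r_distr r_minus m_assoc a_assoc l_neg)
    ultimately show ?case
      by simp
  qed
  show ?thesis
  proof (cases "2 * j \<le> c")
    case True
    then show ?thesis
      using low[OF b, of 0] b gr_carrier by simp
  next
    case False
    \<comment> \<open>Above the middle every element is a power of \<open>z\<close> times an element
      of the mirror degree \<open>c - j\<close>, so the lower half suffices.\<close>
    then have "c - (c - j) = j" "2 * (c - j) \<le> c"
      using \<open>j \<le> c\<close> by auto
    then have "\<exists>b'\<in>gr (c - j). b = z [^] (c - 2 * (c - j)) \<otimes> b'"
      using b by (intro strong_lefschetz_surjective[OF z]) simp_all
    then obtain b' where "b' \<in> gr (c - j)" "b = z [^] (c - 2 * (c - j)) \<otimes> b'"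
      by (elim bexE)
    then show ?thesis
      using low[of b' "c - j" "c - 2 * (c - j)"] False \<open>j \<le> c\<close> by simp
  qed
qed

end

section \<open>Homogeneous polynomials modulo a monic polynomial\<close>

sublocale standard_graded_algebra \<subseteq> UPA: UP_cring A "UP A"
  by (rule UP_cring.intro) (rule cring_axioms)

context standard_graded_algebra
begin

abbreviation cf :: "(nat \<Rightarrow> 'a) \<Rightarrow> nat \<Rightarrow> 'a" where
  "cf \<equiv> up_ring.coeff (UP A)"

abbreviation mn :: "'a \<Rightarrow> nat \<Rightarrow> nat \<Rightarrow> 'a" where
  "mn \<equiv> up_ring.monom (UP A)"

abbreviation H :: "nat \<Rightarrow> (nat \<Rightarrow> 'a) set" where
  "H \<equiv> poly_grading A gr"

lemma hom_carrier: "p \<in> H d \<Longrightarrow> p \<in> carrier (UP A)"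
  by (simp add: poly_grading_def)

lemma hom_coeff: "\<lbrakk> p \<in> H d; k \<le> d \<rbrakk> \<Longrightarrow> cf p k \<in> gr (d - k)"
  unfolding poly_grading_def by (metis (mono_tags, lifting) mem_Collect_eq)

lemma hom_coeff_zero: "\<lbrakk> p \<in> H d; d < k \<rbrakk> \<Longrightarrow> cf p k = \<zero>"
  unfolding poly_grading_def by (metis (mono_tags, lifting) mem_Collect_eq not_le singletonD)

lemma homI:
  assumes "p \<in> carrier (UP A)" "\<And>k. k \<le> d \<Longrightarrow> cf p k \<in> gr (d - k)" "\<And>k. d < k \<Longrightarrow> cf p k = \<zero>"
  shows "p \<in> H d"
  using assms by (auto simp: poly_grading_def)

lemma hom_zero: "\<zero>\<^bsub>UP A\<^esub> \<in> H d"
  by (rule homI) (simp_all add: gr_zero)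

lemma hom_add: "\<lbrakk> p \<in> H d; q \<in> H d \<rbrakk> \<Longrightarrow> p \<oplus>\<^bsub>UP A\<^esub> q \<in> H d"
  by (rule homI) (simp_all add: hom_carrier hom_coeff hom_coeff_zero gr_add)

lemma hom_uminus: "p \<in> H d \<Longrightarrow> \<ominus>\<^bsub>UP A\<^esub> p \<in> H d"
  by (rule homI) (simp_all add: hom_carrier hom_coeff hom_coeff_zero gr_uminus)

lemma hom_minus: "\<lbrakk> p \<in> H d; q \<in> H d \<rbrakk> \<Longrightarrow> p \<ominus>\<^bsub>UP A\<^esub> q \<in> H d"
  by (simp add: a_minus_def hom_add hom_uminus)

lemma hom_monom:
  assumes "a \<in> gr j" "j + k = d"
  shows "mn a k \<in> H d"
  using assms gr_carrier[OF assms(1)] gr_zero by (intro homI) auto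

lemma hom_smult: "\<lbrakk> a \<in> K; p \<in> H d \<rbrakk> \<Longrightarrow> a \<odot>\<^bsub>UP A\<^esub> p \<in> H d"
  by (rule homI) (simp_all add: hom_carrier hom_coeff hom_coeff_zero gr_smult K_carrier)

lemma hom_mult:
  assumes p: "p \<in> H d" and q: "q \<in> H e"
  shows "p \<otimes>\<^bsub>UP A\<^esub> q \<in> H (d + e)"
proof (rule homI)
  note pq = hom_carrier[OF p] hom_carrier[OF q]
  show "p \<otimes>\<^bsub>UP A\<^esub> q \<in> carrier (UP A)"
    using pq by simp
  have summand: "cf p i \<otimes> cf q (k - i) \<in> gr (d + e - k)" if "i \<le> k" "k \<le> d + e" for i k
  proof (cases "i \<le> d \<and> k - i \<le> e")
    case True
    then have "(d - i) + (e - (k - i)) = d + e - k"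
      using that by auto
    then show ?thesis
      using mult_component[OF hom_coeff[OF p, of i] hom_coeff[OF q, of "k - i"]] True by simp
  next
    case False
    then have "cf p i = \<zero> \<or> cf q (k - i) = \<zero>"
      using hom_coeff_zero[OF p, of i] hom_coeff_zero[OF q, of "k - i"] by auto
    then show ?thesis
      using gr_zero UPA.coeff_closed[OF pq(1)] UPA.coeff_closed[OF pq(2)] by auto
  qed
  show "cf (p \<otimes>\<^bsub>UP A\<^esub> q) k \<in> gr (d + e - k)" if "k \<le> d + e" for k
    unfolding UPA.coeff_mult[OF pq] using summand[OF _ that] by (intro gr_finsum) auto
  show "cf (p \<otimes>\<^bsub>UP A\<^esub> q) k = \<zero>" if "d + e < k" for k
  proof -
    have "cf p i \<otimes> cf q (k - i) = \<zero>" if "i \<le> k" for i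
    proof (cases "d < i")
      case True
      then show ?thesis
        using hom_coeff_zero[OF p] UPA.coeff_closed[OF pq(2)] by simp
    next
      case False
      then show ?thesis
        using hom_coeff_zero[OF q, of "k - i"] UPA.coeff_closed[OF pq(1)] \<open>d + e < k\<close> by simp
    qed
    then show ?thesis
      unfolding UPA.coeff_mult[OF pq] by (intro add.finprod_one_eqI) simp
  qed
qed

lemma hom_one: "\<one>\<^bsub>UP A\<^esub> \<in> H 0"
  by (rule homI) (simp_all add: gr_one gr_zero)

lemma hom_pow:
  assumes "p \<in> H 1"
  shows "p [^]\<^bsub>UP A\<^esub> m \<in> H m"
proof (induction m)
  case 0
  show ?case
    using hom_one by simp
next
  case (Suc m)
  then show ?case
    using hom_mult[OF Suc assms] by simp
qed

lemma finsum_monom_coeff: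
  assumes "p \<in> carrier (UP A)" "\<And>k. k \<ge> n \<Longrightarrow> cf p k = \<zero>"
  shows "p = (\<Oplus>\<^bsub>UP A\<^esub>k\<in>{..<n}. mn (cf p k) k)"
proof (rule UPA.up_eqI)
  have cl: "(\<lambda>k. mn (cf p k) k) \<in> {..<n} \<rightarrow> carrier (UP A)"
    using assms(1) by simp
  then show "(\<Oplus>\<^bsub>UP A\<^esub>k\<in>{..<n}. mn (cf p k) k) \<in> carrier (UP A)"
    by (rule UPA.P.finsum_closed)
  fix l
  have "cf (\<Oplus>\<^bsub>UP A\<^esub>k\<in>{..<n}. mn (cf p k) k) l = (\<Oplus>k\<in>{..<n}. cf (mn (cf p k) k) l)"
    using cl by (intro UPA.coeff_finsum) simp
  also have "\<dots> = (\<Oplus>k\<in>{..<n}. if l = k then cf p k else \<zero>)"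
    using assms(1) by (intro finsum_cong') auto
  also have "\<dots> = cf p l"
  proof (cases "l < n")
    case True
    then show ?thesis
      using assms(1) by (subst add.finprod_singleton) auto
  next
    case False
    then show ?thesis
      using assms(2) by (auto intro!: add.finprod_one_eqI)
  qed
  finally show "cf p l = cf (\<Oplus>\<^bsub>UP A\<^esub>k\<in>{..<n}. mn (cf p k) k) l"
    by (rule sym)
qed (rule assms(1))

lemma coeff_monom_mult_add:
  assumes "b \<in> carrier A" "p \<in> carrier (UP A)" "r \<le> l"
  shows "cf (mn b r \<otimes>\<^bsub>UP A\<^esub> p) l = b \<otimes> cf p (l - r)"
  using UPA.coeff_monom_mult[OF assms(1,2), of r "l - r"] assms(3) by simp

end

section \<open>Division by a monic homogeneous polynomial\<close>

locale monic_homogeneous = standard_graded_algebra K A gr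
  for K :: "'a set" and A :: "('a, 'b) ring_scheme" (structure) and gr :: "nat \<Rightarrow> 'a set" +
  fixes f :: "nat \<Rightarrow> 'a" and n :: nat
  assumes f_hom: "f \<in> H n"
    and f_top: "cf f n = \<one>"
begin

abbreviation J :: "(nat \<Rightarrow> 'a) set" where
  "J \<equiv> PIdl\<^bsub>UP A\<^esub> f"

lemma f_carrier: "f \<in> carrier (UP A)"
  using hom_carrier[OF f_hom] .

lemma J_ideal: "ideal J (UP A)"
  using UPA.P.cgenideal_ideal[OF f_carrier] .

lemma mult_f_in_J: "g \<in> carrier (UP A) \<Longrightarrow> g \<otimes>\<^bsub>UP A\<^esub> f \<in> J"
  unfolding cgenideal_def by blast

text \<open>Division with remainder: the top coefficient is cancelled by a monomial multiple of
  \<open>f\<close> that is homogeneous of the same degree \<open>e\<close>, so the remainder stays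
  homogeneous. The induction is on a bound \<open>L\<close> for the range of
  \<open>x\<close>-degrees from \<open>n\<close> upwards that may still be occupied.\<close>

lemma reduction:
  assumes "p \<in> H e"
  shows "\<exists>q\<in>H e. (\<forall>k\<ge>n. cf q k = \<zero>) \<and> p \<ominus>\<^bsub>UP A\<^esub> q \<in> J"
proof -
  have J0: "\<zero>\<^bsub>UP A\<^esub> \<in> J"
    using additive_subgroup.zero_closed[OF ideal.axioms(1)[OF J_ideal]] .
  have "\<exists>q\<in>H e. (\<forall>k\<ge>n. cf q k = \<zero>) \<and> p \<ominus>\<^bsub>UP A\<^esub> q \<in> J"
    if "p \<in> H e" "\<forall>k\<ge>n + L. cf p k = \<zero>" for p L
    using that
  proof (induction L arbitrary: p)
    case 0
    then show ?case
      using J0 hom_carrier[OF 0(1)] by (intro bexI[of _ p]) (simp_all add: a_minus_def UPA.P.r_neg)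
  next
    case (Suc L)
    define a where "a = cf p (n + L)"
    define g where "g = mn a L"
    have pc: "p \<in> carrier (UP A)"
      using hom_carrier[OF Suc.prems(1)] .
    have ac: "a \<in> carrier A"
      unfolding a_def using UPA.coeff_closed[OF pc] .
    have gc: "g \<in> carrier (UP A)"
      unfolding g_def using ac by simp
    have gf: "g \<otimes>\<^bsub>UP A\<^esub> f \<in> H e"
    proof (cases "n + L \<le> e")
      case True
      then have "a \<in> gr (e - (n + L))"
        unfolding a_def using hom_coeff[OF Suc.prems(1)] by blast
      then have "g \<in> H (e - n)"
        unfolding g_def using True by (intro hom_monom) auto
      from hom_mult[OF this f_hom] show ?thesis
        using True by simp
    next
      case False
      then have "a = \<zero>"
        unfolding a_def using hom_coeff_zero[OF Suc.prems(1)] by simp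
      then have "g = \<zero>\<^bsub>UP A\<^esub>"
        unfolding g_def using UPA.monom_zero by simp
      then show ?thesis
        using hom_zero f_carrier by simp
    qed
    let ?p = "p \<ominus>\<^bsub>UP A\<^esub> g \<otimes>\<^bsub>UP A\<^esub> f"
    have "cf ?p k = \<zero>" if "k \<ge> n + L" for k
    proof -
      have "cf (g \<otimes>\<^bsub>UP A\<^esub> f) k = a \<otimes> cf f (k - L)"
        unfolding g_def using coeff_monom_mult_add[OF ac f_carrier] that by simp
      moreover have "a \<otimes> cf f (k - L) = cf p k"
      proof (cases "k = n + L")
        case True
        then show ?thesis
          using f_top ac by (simp add: a_def)
      next
        case False
        then show ?thesis
          using hom_coeff_zero[OF f_hom, of "k - L"] Suc.prems(2) that ac by simp
      qed
      ultimately show ?thesis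
        using UPA.coeff_minus[OF pc UPA.P.m_closed[OF gc f_carrier]] UPA.coeff_closed[OF pc]
        by (simp add: a_minus_def r_neg)
    qed
    moreover have "?p \<in> H e"
      using hom_minus[OF Suc.prems(1) gf] .
    ultimately obtain q where q: "q \<in> H e" "\<forall>k\<ge>n. cf q k = \<zero>" "?p \<ominus>\<^bsub>UP A\<^esub> q \<in> J"
      using Suc.IH[of ?p] by auto
    have "p \<ominus>\<^bsub>UP A\<^esub> q = (?p \<ominus>\<^bsub>UP A\<^esub> q) \<oplus>\<^bsub>UP A\<^esub> g \<otimes>\<^bsub>UP A\<^esub> f"
    proof -
      have "x \<ominus>\<^bsub>UP A\<^esub> y = (x \<ominus>\<^bsub>UP A\<^esub> w \<ominus>\<^bsub>UP A\<^esub> y) \<oplus>\<^bsub>UP A\<^esub> w"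
        if "x \<in> carrier (UP A)" "y \<in> carrier (UP A)" "w \<in> carrier (UP A)" for x y w
        using that UPA.P.a_lcomm[of w x "\<ominus>\<^bsub>UP A\<^esub> w \<oplus>\<^bsub>UP A\<^esub> \<ominus>\<^bsub>UP A\<^esub> y"]
        by (simp add: a_minus_def UPA.P.a_ac UPA.P.r_neg2)
      from this[OF pc hom_carrier[OF q(1)] UPA.P.m_closed[OF gc f_carrier]] show ?thesis .
    qed
    also have "\<dots> \<in> J"
      using additive_subgroup.a_closed[OF ideal.axioms(1)[OF J_ideal] q(3) mult_f_in_J[OF gc]] .
    finally show ?case
      using q(1,2) by blast
  qed
  moreover have "\<forall>k\<ge>n + Suc e. cf p k = \<zero>"
    using hom_coeff_zero[OF assms] by simp
  ultimately show ?thesis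
    using assms by blast
qed

text \<open>Although \<open>A\<close> may have zero divisors, the leading coefficient of
  \<open>g f\<close> is that of \<open>g\<close>, because \<open>f\<close> is monic. A nonzero
  multiple of \<open>f\<close> therefore has \<open>x\<close>-degree at least \<open>n\<close>, and
  remainders are unique.\<close>

lemma reduced_in_J_eq_zero:
  assumes p: "p \<in> J" and red: "\<And>k. k \<ge> n \<Longrightarrow> cf p k = \<zero>"
  shows "p = \<zero>\<^bsub>UP A\<^esub>"
proof -
  obtain g where g: "g \<in> carrier (UP A)" "p = g \<otimes>\<^bsub>UP A\<^esub> f"
    using p unfolding cgenideal_def by blast
  have "g = \<zero>\<^bsub>UP A\<^esub>"
  proof (rule ccontr)
    assume nz: "g \<noteq> \<zero>\<^bsub>UP A\<^esub>"
    let ?D = "deg A g"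
    have "cf p (?D + n) = (\<Oplus>i\<in>{..?D + n}. cf g i \<otimes> cf f (?D + n - i))"
      unfolding g(2) using UPA.coeff_mult[OF g(1) f_carrier] .
    also have "\<dots> = (\<Oplus>i\<in>{..?D + n}. if ?D = i then cf g i else \<zero>)"
    proof (rule finsum_cong')
      fix i assume i: "i \<in> {..?D + n}"
      consider "i = ?D" | "i < ?D" | "?D < i"
        by linarith
      then show "cf g i \<otimes> cf f (?D + n - i) = (if ?D = i then cf g i else \<zero>)"
      proof cases
        case 1
        then show ?thesis
          using f_top UPA.coeff_closed[OF g(1)] by simp
      next
        case 2
        then show ?thesis
          using hom_coeff_zero[OF f_hom, of "?D + n - i"] UPA.coeff_closed[OF g(1)] by simp
      next
        case 3
        then show ?thesis
          using UPA.deg_aboveD[OF 3 g(1)] UPA.coeff_closed[OF f_carrier] by simp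
      qed
    qed (use UPA.coeff_closed[OF g(1)] in auto)
    also have "\<dots> = cf g ?D"
      using UPA.coeff_closed[OF g(1)] by (subst add.finprod_singleton) auto
    finally show False
      using UPA.lcoeff_nonzero[OF nz g(1)] red[of "?D + n"] by simp
  qed
  then show ?thesis
    using g(2) f_carrier by simp
qed

end

section \<open>Duality in the quotient\<close>

locale gorenstein_monic = gorenstein_top K A gr c + monic_homogeneous K A gr f n
  for K :: "'a set" and A :: "('a, 'b) ring_scheme" (structure) and gr :: "nat \<Rightarrow> 'a set"
    and c :: nat and f :: "nat \<Rightarrow> 'a" and n :: nat +
  assumes n_pos: "n > 0"
begin

text \<open>The quotient has top degree \<open>c + n - 1\<close>, spanned by the class of \<open>\<omega> x\<^bsup>n-1\<^esup>\<close> for \<open>\<omega> \<in> gr c\<close>.\<close>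

lemma quotient_nondegenerate:
  assumes u: "u \<in> H i" "u \<notin> J"
  shows "i \<le> c + n - 1 \<and> (\<exists>v\<in>H (c + n - 1 - i). v \<otimes>\<^bsub>UP A\<^esub> u \<notin> J)"
proof -
  obtain q where q: "q \<in> H i" "\<forall>k\<ge>n. cf q k = \<zero>" "u \<ominus>\<^bsub>UP A\<^esub> q \<in> J"
    using reduction[OF u(1)] by blast
  note qc = hom_carrier[OF q(1)] and uc = hom_carrier[OF u(1)]
  interpret J: ideal J "UP A"
    by (rule J_ideal)
  have uq: "u = (u \<ominus>\<^bsub>UP A\<^esub> q) \<oplus>\<^bsub>UP A\<^esub> q"
    using uc qc by (simp add: a_minus_def UPA.P.a_assoc UPA.P.l_neg)
  have "q \<noteq> \<zero>\<^bsub>UP A\<^esub>"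
  proof
    assume "q = \<zero>\<^bsub>UP A\<^esub>"
    then have "u = u \<ominus>\<^bsub>UP A\<^esub> q"
      using uc by (simp add: a_minus_def)
    then show False
      using q(3) u(2) by simp
  qed
  \<comment> \<open>Only the top coefficient of the remainder is paired with an element of
    \<open>A\<close>. Multiplying by \<open>b x^(n-1-k)\<close> carries it to the coefficient of
    \<open>x^(n-1)\<close> in degree \<open>c\<close>, and the product is already reduced since its
    \<open>x\<close>-degree is below \<open>n\<close>.\<close>
  let ?k = "deg A q"
  have a: "cf q ?k \<noteq> \<zero>"
    using UPA.lcoeff_nonzero[OF \<open>q \<noteq> \<zero>\<^bsub>UP A\<^esub>\<close> qc] .
  have kn: "?k < n"
    using a q(2) not_le by blast
  have ki: "?k \<le> i"
    using a hom_coeff_zero[OF q(1)] not_le by blast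
  have ag: "cf q ?k \<in> gr (i - ?k)"
    using hom_coeff[OF q(1) ki] .
  have ic: "i - ?k \<le> c"
    using degree_le_top[OF ag a] .
  obtain b where b: "b \<in> gr (c - (i - ?k))" "b \<otimes> cf q ?k \<noteq> \<zero>"
    using nondegenerate[OF ag a] by blast
  note bc = gr_carrier[OF b(1)]
  let ?r = "n - 1 - ?k"
  let ?v = "mn b ?r"
  have i: "i \<le> c + n - 1"
    using ic kn ki by linarith
  have v: "?v \<in> H (c + n - 1 - i)"
    by (rule hom_monom[OF b(1)]) (use ic kn ki in linarith)
  note vc = hom_carrier[OF v]
  have "?v \<otimes>\<^bsub>UP A\<^esub> q \<notin> J"
  proof
    assume in_J: "?v \<otimes>\<^bsub>UP A\<^esub> q \<in> J"
    have "cf (?v \<otimes>\<^bsub>UP A\<^esub> q) l = \<zero>" if "l \<ge> n" for l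
    proof -
      have "?r \<le> l" "?k < l - ?r"
        using that kn by linarith+
      then show ?thesis
        using coeff_monom_mult_add[OF bc qc] UPA.deg_aboveD[OF _ qc] bc by simp
    qed
    from reduced_in_J_eq_zero[OF in_J this] have "cf (?v \<otimes>\<^bsub>UP A\<^esub> q) (n - 1) = \<zero>"
      by simp
    moreover have "n - 1 - ?r = ?k" "?r \<le> n - 1"
      using kn by linarith+
    ultimately show False
      using coeff_monom_mult_add[OF bc qc, of ?r "n - 1"] b(2) by simp
  qed
  moreover have "?v \<otimes>\<^bsub>UP A\<^esub> q \<in> J" if "?v \<otimes>\<^bsub>UP A\<^esub> u \<in> J"
  proof -
    have "?v \<otimes>\<^bsub>UP A\<^esub> q = ?v \<otimes>\<^bsub>UP A\<^esub> u \<ominus>\<^bsub>UP A\<^esub> ?v \<otimes>\<^bsub>UP A\<^esub> (u \<ominus>\<^bsub>UP A\<^esub> q)"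
      using vc uc qc
      by (simp add: a_minus_def UPA.P.r_distr UPA.P.r_minus UPA.P.minus_add UPA.P.a_assoc[symmetric] UPA.P.r_neg)
    also have "\<dots> \<in> J"
      unfolding a_minus_def
      by (intro J.a_closed that J.a_inv_closed J.I_l_closed vc q(3)[unfolded a_minus_def])
    finally show ?thesis .
  qed
  ultimately show ?thesis
    using i v by blast
qed

end

section \<open>Multiples of powers of linear forms\<close>

definition ring_of_int :: "('a, 'b) ring_scheme \<Rightarrow> int \<Rightarrow> 'a" where
  "ring_of_int R x = [x] \<cdot>\<^bsub>R\<^esub> \<one>\<^bsub>R\<^esub>"

context cring
begin

lemma ring_of_int_closed: "ring_of_int R x \<in> carrier R"
  unfolding ring_of_int_def by simp

lemma ring_of_int_add: "ring_of_int R (x + y) = ring_of_int R x \<oplus> ring_of_int R y"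
  unfolding ring_of_int_def by (simp add: add.int_pow_mult)

lemma ring_of_int_zero: "ring_of_int R 0 = \<zero>"
  unfolding ring_of_int_def by (simp add: add_pow_def)

lemma ring_of_int_one: "ring_of_int R 1 = \<one>"
  unfolding ring_of_int_def using add.int_pow_1[OF one_closed] by simp

lemma ring_of_int_mult: "ring_of_int R (x * y) = ring_of_int R x \<otimes> ring_of_int R y"
  unfolding ring_of_int_def
  using add.int_pow_pow[of \<one> x y] add_pow_ldistr_int[of \<one> "[y] \<cdot> \<one>" x]
  by (simp add: mult.commute)

lemma ring_of_int_sum:
  "finite S \<Longrightarrow> ring_of_int R (\<Sum>k\<in>S. g k) = (\<Oplus>k\<in>S. ring_of_int R (g k))"
proof (induction S rule: finite_induct)
  case empty
  show ?case
    by (simp add: ring_of_int_zero)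
next
  case (insert k S)
  then show ?case
    by (simp add: ring_of_int_add ring_of_int_closed)
qed

end

context standard_graded_algebra
begin

lemma ring_of_int_nat_mem: "ring_of_int A (int x) \<in> K"
proof (induction x)
  case 0
  then show ?case
    using ring_of_int_zero gr_zero[of 0] component_zero by simp
next
  case (Suc x)
  have "ring_of_int A (int (Suc x)) = \<one> \<oplus> ring_of_int A (int x)"
    using ring_of_int_add[of 1 "int x"] ring_of_int_one by simp
  then show ?case
    using gr_add[OF gr_one, of "ring_of_int A (int x)"] Suc component_zero by simp
qed

lemma ring_of_int_mem: "ring_of_int A x \<in> K"
proof (cases "x \<ge> 0")
  case True
  then show ?thesis
    using ring_of_int_nat_mem[of "nat x"] by simp
next
  case False
  have "ring_of_int A x \<oplus> ring_of_int A (- x) = \<zero>"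
    using ring_of_int_add[of x "- x"] ring_of_int_zero by simp
  then have "ring_of_int A x = \<ominus> ring_of_int A (- x)"
    using ring_of_int_closed minus_equality by metis
  then show ?thesis
    using ring_of_int_nat_mem[of "nat (- x)"] False gr_uminus[of "ring_of_int A (- x)" 0] component_zero
    by simp
qed

lemma coeff_mult_linear:
  assumes p: "p \<in> carrier (UP A)" and z: "z \<in> carrier A" and s: "s \<in> carrier A"
  shows "cf (p \<otimes>\<^bsub>UP A\<^esub> (mn z 0 \<oplus>\<^bsub>UP A\<^esub> mn s 1)) r =
    cf p r \<otimes> z \<oplus> (if r = 0 then \<zero> else cf p (r - 1) \<otimes> s)"
proof -
  have "p \<otimes>\<^bsub>UP A\<^esub> (mn z 0 \<oplus>\<^bsub>UP A\<^esub> mn s 1) = mn z 0 \<otimes>\<^bsub>UP A\<^esub> p \<oplus>\<^bsub>UP A\<^esub> mn s 1 \<otimes>\<^bsub>UP A\<^esub> p"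
    using p z s by (simp add: UPA.P.r_distr UPA.P.m_comm)
  then have "cf (p \<otimes>\<^bsub>UP A\<^esub> (mn z 0 \<oplus>\<^bsub>UP A\<^esub> mn s 1)) r =
      cf (mn z 0 \<otimes>\<^bsub>UP A\<^esub> p) r \<oplus> cf (mn s 1 \<otimes>\<^bsub>UP A\<^esub> p) r"
    using p z s by (simp del: UPA.coeff_mult)
  also have "cf (mn z 0 \<otimes>\<^bsub>UP A\<^esub> p) r = cf p r \<otimes> z"
    using coeff_monom_mult_add[OF z p, of 0 r] UPA.coeff_closed[OF p] z by (simp add: m_comm)
  also have "cf (mn s 1 \<otimes>\<^bsub>UP A\<^esub> p) r = (if r = 0 then \<zero> else cf p (r - 1) \<otimes> s)"
  proof (cases "r = 0")
    case True
    then show ?thesis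
      using UPA.coeff_mult[of "mn s 1" p 0] p s UPA.coeff_closed[OF p] by simp
  next
    case False
    then show ?thesis
      using coeff_monom_mult_add[OF s p, of 1 r] UPA.coeff_closed[OF p] s by (simp add: m_comm)
  qed
  finally show ?thesis .
qed

text \<open>The binomial theorem in \<open>A[x]\<close>. For \<open>r > m\<close> the truncated
  exponent \<open>m - r\<close> does no harm since the binomial coefficient vanishes.\<close>

lemma coeff_linear_pow:
  assumes z: "z \<in> carrier A" and s: "s \<in> carrier A"
  shows "cf ((mn z 0 \<oplus>\<^bsub>UP A\<^esub> mn s 1) [^]\<^bsub>UP A\<^esub> m) r =
    ring_of_int A (int (m choose r)) \<otimes> (z [^] (m - r) \<otimes> s [^] r)"
proof (induction m arbitrary: r)
  case 0
  then show ?case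
    by (cases r) (simp_all add: ring_of_int_zero ring_of_int_one s)
next
  case (Suc m)
  let ?Y = "mn z 0 \<oplus>\<^bsub>UP A\<^esub> mn s 1"
  let ?\<iota> = "\<lambda>k. ring_of_int A (int k)"
  have Yc: "?Y \<in> carrier (UP A)"
    using z s by simp
  have \<iota>c: "?\<iota> k \<in> carrier A" for k
    using ring_of_int_closed .
  have step: "cf (?Y [^]\<^bsub>UP A\<^esub> Suc m) r = cf (?Y [^]\<^bsub>UP A\<^esub> m) r \<otimes> z \<oplus>
      (if r = 0 then \<zero> else cf (?Y [^]\<^bsub>UP A\<^esub> m) (r - 1) \<otimes> s)"
    unfolding UPA.P.nat_pow_Suc by (rule coeff_mult_linear[OF UPA.P.nat_pow_closed[OF Yc] z s])
  show ?case
  proof (cases r)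
    case 0
    then show ?thesis
      unfolding step Suc using z s \<iota>c by (simp add: ring_of_int_one)
  next
    case (Suc r')
    have first: "?\<iota> (m choose r) \<otimes> (z [^] (m - r) \<otimes> s [^] r) \<otimes> z =
        ?\<iota> (m choose r) \<otimes> (z [^] (m - r') \<otimes> s [^] r)"
    proof (cases "r \<le> m")
      case True
      then have "m - r' = Suc (m - r)"
        using Suc by simp
      then show ?thesis
        using z s \<iota>c by (simp add: m_ac)
    next
      case False
      then show ?thesis
        using z s by (simp add: binomial_eq_0 ring_of_int_zero)
    qed
    have second: "?\<iota> (m choose r') \<otimes> (z [^] (m - r') \<otimes> s [^] r') \<otimes> s =
        ?\<iota> (m choose r') \<otimes> (z [^] (m - r') \<otimes> s [^] r)"
      using z s \<iota>c Suc by (simp add: m_assoc)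
    have "?\<iota> (Suc m choose r) = ?\<iota> (m choose r) \<oplus> ?\<iota> (m choose r')"
      using Suc ring_of_int_add[of "int (m choose r)" "int (m choose r')"] by (simp add: add.commute)
    then have "?\<iota> (Suc m choose r) \<otimes> (z [^] (Suc m - r) \<otimes> s [^] r) =
        ?\<iota> (m choose r) \<otimes> (z [^] (m - r') \<otimes> s [^] r) \<oplus>
        ?\<iota> (m choose r') \<otimes> (z [^] (m - r') \<otimes> s [^] r)"
      using z s \<iota>c Suc by (simp only: diff_Suc_Suc l_distr m_closed nat_pow_closed)
    then show ?thesis
      unfolding step Suc.IH using first second Suc by simp
  qed
qed

lemma exists_polynomial_with_coeffs:
  assumes "\<And>k. k \<le> j \<Longrightarrow> a k \<in> carrier A"
  shows "\<exists>p\<in>carrier (UP A). \<forall>k. cf p k = (if k \<le> j then a k else \<zero>)"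
proof -
  let ?p = "\<lambda>k. if k \<le> j then a k else \<zero>"
  have "bound \<zero> j ?p"
    by (rule bound.intro) simp
  then have "\<exists>l. bound \<zero> l ?p" ..
  then have up: "?p \<in> up A"
    using assms by (intro mem_upI) simp_all
  have p: "?p \<in> carrier (UP A)"
    unfolding UP_def partial_object.simps by (rule up)
  have "\<forall>k. cf ?p k = ?p k"
    unfolding UP_def up_ring.simps restrict_apply'[OF up] by (rule allI) (rule refl)
  then show ?thesis
    by (rule bexI[OF _ p])
qed

end

section \<open>Powers of \<open>z + s x\<close> and primitive strings\<close>

locale lefschetz_monic = gorenstein_monic K A gr c f n
  for K :: "'a set" and A :: "('a, 'b) ring_scheme" (structure) and gr :: "nat \<Rightarrow> 'a set"
    and c :: nat and f :: "nat \<Rightarrow> 'a" and n :: nat +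
  fixes z :: 'a
  assumes z_lefschetz: "strong_lefschetz_element A gr z"
    and char_zero: "\<And>k::nat. k > 0 \<Longrightarrow> [k] \<cdot> \<one> \<noteq> \<zero>"
begin

abbreviation Y :: "'a \<Rightarrow> nat \<Rightarrow> 'a" where
  "Y s \<equiv> mn z 0 \<oplus>\<^bsub>UP A\<^esub> mn s 1"

lemma z_gr: "z \<in> gr 1"
  using z_lefschetz unfolding strong_lefschetz_element_def by blast

lemma z_carrier: "z \<in> carrier A"
  using gr_carrier[OF z_gr] .

lemma Y_hom: "s \<in> K \<Longrightarrow> Y s \<in> H 1"
  using hom_monom[OF z_gr, of 0 1] hom_monom[of s 0 1 1] component_zero by (intro hom_add) auto

text \<open>The characteristic enters here: these inverses normalise the integer solutions of the
  binomial systems, and they keep the images of distinct integers distinct in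
  \<open>K\<close>.\<close>

lemma ring_of_nat_unit:
  assumes "N > 0"
  shows "\<exists>\<nu>\<in>K. \<nu> \<otimes> ring_of_int A (int N) = \<one>"
proof -
  have "ring_of_int A (int N) = [N] \<cdot> \<one>"
    unfolding ring_of_int_def using add_pow_int_ge[of "int N" A \<one>] by simp
  then have "ring_of_int A (int N) \<in> K - {\<zero>}"
    using ring_of_int_mem[of "int N"] char_zero[OF assms] by simp
  from subfield_m_inv[OF K.subfield_axioms this] show ?thesis
    by blast
qed

text \<open>
  With \<open>p\<close> primitive, \<open>K[z, x] p\<close> is a quotient of \<open>K[z, x]/(z\<^bsup>q+1\<^esup>)\<close>, and modulo \<open>x\<^sup>n\<close> the
  monomial \<open>z\<^sup>t x\<^sup>k p\<close> is a multiple of \<open>(z + x)\<^sup>m\<close> by the binomial system; \<open>x\<close> is then replaced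
  by \<open>s x\<close>.
\<close>

lemma string_multiple_of_linear_power:
  assumes p: "p \<in> gr l0" and prim: "z [^] (q + 1) \<otimes> p = \<zero>"
    and eq: "q + (n - 1) = 2 * j + m" and k: "k < n" and tk: "t + k = j + m" and tq: "t \<le> q"
  shows "\<exists>h. (\<forall>l\<le>l0 + j + m. h l \<in> gr (l0 + j + m - l)) \<and>
    (\<forall>l<n. l \<le> l0 + j + m \<longrightarrow> h l = (if l = k then z [^] t \<otimes> p else \<zero>)) \<and>
    (\<forall>s\<in>K. \<exists>v\<in>H (l0 + j). \<forall>l. cf (Y s [^]\<^bsub>UP A\<^esub> m \<otimes>\<^bsub>UP A\<^esub> v) l = s [^] l \<otimes> h l)"
proof -
  have "k \<le> n - 1" "j + m \<le> q + k" "k \<le> j + m"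
    using k tk tq by linarith+
  from binomial_system[OF eq this] obtain N \<gamma> where N: "N > 0"
    and \<gamma>: "\<And>l. \<lbrakk> l \<le> n - 1; l \<le> j + m; j + m \<le> q + l \<rbrakk> \<Longrightarrow>
      (\<Sum>k' | k' \<le> j \<and> k' \<le> l. \<gamma> k' * int (m choose (l - k'))) = (if l = k then int N else 0)"
    by blast
  obtain \<nu> where \<nu>: "\<nu> \<in> K" "\<nu> \<otimes> ring_of_int A (int N) = \<one>"
    using ring_of_nat_unit[OF N] by blast
  let ?\<iota> = "ring_of_int A"
  define e where "e l = (\<Sum>k' | k' \<le> j \<and> k' \<le> l. \<gamma> k' * int (m choose (l - k')))" for l
  \<comment> \<open>The coefficient of \<open>x^l\<close> in the product for \<open>s = 1\<close>,
    with \<open>\<nu>\<close> dividing out the denominator. Replacing \<open>x\<close> by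
    \<open>s x\<close> multiplies it by \<open>s [^] l\<close>, so \<open>h\<close> can be chosen
    before \<open>s\<close>.\<close>
  define h where "h l = \<nu> \<otimes> (z [^] (j + m - l) \<otimes> p) \<otimes> ?\<iota> (e l)" for l
  note pc = gr_carrier[OF p] and zc = z_carrier and \<nu>c = K_carrier[OF \<nu>(1)]
  have \<iota>c: "?\<iota> x \<in> carrier A" for x
    using ring_of_int_closed .
  have e_zero: "e l = 0" if "l > j + m" for l
    unfolding e_def using that by (intro sum.neutral) (auto simp: binomial_eq_0)
  have h_gr: "h l \<in> gr (l0 + j + m - l)" for l
  proof (cases "l \<le> j + m")
    case True
    have "j + m - l + l0 = l0 + j + m - l"
      using True by linarith
    then have "z [^] (j + m - l) \<otimes> p \<in> gr (l0 + j + m - l)"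
      using mult_component[OF gr_pow[OF z_gr, of "j + m - l"] p] by metis
    then have "?\<iota> (e l) \<otimes> (\<nu> \<otimes> (z [^] (j + m - l) \<otimes> p)) \<in> gr (l0 + j + m - l)"
      by (rule gr_smult[OF ring_of_int_mem gr_smult[OF \<nu>(1)]])
    then show ?thesis
      unfolding h_def using pc zc \<nu>c \<iota>c by (simp add: m_comm)
  next
    case False
    then have "h l = \<zero>"
      unfolding h_def using e_zero[of l] pc zc \<nu>c by (simp add: ring_of_int_zero)
    then show ?thesis
      using gr_zero by simp
  qed
  have h_low: "h l = (if l = k then z [^] t \<otimes> p else \<zero>)" if l: "l < n" for l
  proof (cases "l \<le> j + m")
    case le: True
    show ?thesis
    proof (cases "j + m \<le> q + l")
      case True
      then have el: "e l = (if l = k then int N else 0)"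
        unfolding e_def using \<gamma>[of l] l le by simp
      show ?thesis
      proof (cases "l = k")
        case True
        have "j + m - k = t"
          using tk by simp
        then have "h l = (\<nu> \<otimes> ?\<iota> (int N)) \<otimes> (z [^] t \<otimes> p)"
          unfolding h_def el using True pc zc \<nu>c \<iota>c by (simp add: m_ac)
        then show ?thesis
          using \<nu>(2) True pc zc by simp
      next
        case False
        then show ?thesis
          unfolding h_def el using pc zc \<nu>c by (simp add: ring_of_int_zero)
      qed
    next
      case False
      \<comment> \<open>Below the window no equation was imposed; there the power of
        \<open>z\<close> is at least \<open>q + 1\<close> and annihilates \<open>p\<close>.\<close>
      then have "j + m - l = (j + m - l - (q + 1)) + (q + 1)"
        by linarith
      then have "z [^] (j + m - l) = z [^] (j + m - l - (q + 1)) \<otimes> z [^] (q + 1)"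
        using nat_pow_mult[OF zc, of "j + m - l - (q + 1)" "q + 1"] by simp
      then have "z [^] (j + m - l) \<otimes> p = z [^] (j + m - l - (q + 1)) \<otimes> (z [^] (q + 1) \<otimes> p)"
        using zc pc by (simp only: m_assoc nat_pow_closed)
      then have "z [^] (j + m - l) \<otimes> p = \<zero>"
        unfolding prim using zc by simp
      then show ?thesis
        unfolding h_def using \<nu>c \<iota>c False tk tq by auto
    qed
  next
    case False
    then show ?thesis
      unfolding h_def using e_zero[of l] pc zc \<nu>c tk by (auto simp: ring_of_int_zero)
  qed
  have "\<exists>v\<in>H (l0 + j). \<forall>l. cf (Y s [^]\<^bsub>UP A\<^esub> m \<otimes>\<^bsub>UP A\<^esub> v) l = s [^] l \<otimes> h l" if s: "s \<in> K" for s
  proof -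
    note sc = K_carrier[OF s]
    \<comment> \<open>The solution \<open>\<gamma>\<close>, homogenised to degree \<open>j\<close>
      in \<open>z\<close> and \<open>s x\<close>, scaled by \<open>\<nu>\<close> and applied to
      \<open>p\<close>.\<close>
    let ?a = "\<lambda>k'. \<nu> \<otimes> ?\<iota> (\<gamma> k') \<otimes> (s [^] k' \<otimes> (z [^] (j - k') \<otimes> p))"
    have s_pow: "s [^] (k' :: nat) \<in> K" for k'
      by (induction k') (simp_all add: K.m_closed s)
    have ac: "?a k' \<in> carrier A" for k'
      using sc zc pc \<nu>c \<iota>c by simp
    obtain v where v: "v \<in> carrier (UP A)" "\<And>k'. cf v k' = (if k' \<le> j then ?a k' else \<zero>)"
      using exists_polynomial_with_coeffs[of j ?a] ac by blast
    have "v \<in> H (l0 + j)"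
    proof (rule homI[OF v(1)])
      fix k' assume "k' \<le> l0 + j"
      show "cf v k' \<in> gr (l0 + j - k')"
      proof (cases "k' \<le> j")
        case True
        have "j - k' + l0 = l0 + j - k'"
          using True by linarith
        then have "z [^] (j - k') \<otimes> p \<in> gr (l0 + j - k')"
          using mult_component[OF gr_pow[OF z_gr, of "j - k'"] p] by metis
        then show ?thesis
          unfolding v(2) using True s_pow \<nu>(1) ring_of_int_mem K.m_closed
          by (simp add: gr_smult)
      next
        case False
        then show ?thesis
          unfolding v(2) by (simp add: gr_zero)
      qed
    next
      fix k' assume "l0 + j < k'"
      then show "cf v k' = \<zero>"
        unfolding v(2) by simp
    qed
    moreover have "cf (Y s [^]\<^bsub>UP A\<^esub> m \<otimes>\<^bsub>UP A\<^esub> v) l = s [^] l \<otimes> h l" for l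
    proof -
      let ?W = "s [^] l \<otimes> (\<nu> \<otimes> (z [^] (j + m - l) \<otimes> p))"
      let ?g = "\<lambda>k'. if k' \<le> j then \<gamma> k' * int (m choose (l - k')) else 0"
      have Wc: "?W \<in> carrier A"
        using sc zc pc \<nu>c by simp
      have Yc: "Y s [^]\<^bsub>UP A\<^esub> m \<in> carrier (UP A)"
        using zc sc by simp
      have "Y s [^]\<^bsub>UP A\<^esub> m \<otimes>\<^bsub>UP A\<^esub> v = v \<otimes>\<^bsub>UP A\<^esub> Y s [^]\<^bsub>UP A\<^esub> m"
        using UPA.P.m_comm[OF Yc v(1)] .
      then have "cf (Y s [^]\<^bsub>UP A\<^esub> m \<otimes>\<^bsub>UP A\<^esub> v) l =
          (\<Oplus>k'\<in>{..l}. cf v k' \<otimes> cf (Y s [^]\<^bsub>UP A\<^esub> m) (l - k'))"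
        using UPA.coeff_mult[OF v(1) Yc] by simp
      also have "\<dots> = (\<Oplus>k'\<in>{..l}. ?W \<otimes> ?\<iota> (?g k'))"
      proof (rule finsum_cong')
        fix k' assume k': "k' \<in> {..l}"
        show "cf v k' \<otimes> cf (Y s [^]\<^bsub>UP A\<^esub> m) (l - k') = ?W \<otimes> ?\<iota> (?g k')"
        proof (cases "k' \<le> j \<and> l - k' \<le> m")
          case True
          let ?C = "int (m choose (l - k'))"
          have "k' \<le> l"
            using k' by simp
          then have "(j - k') + (m - (l - k')) = j + m - l"
            using True by linarith
          then have zz: "z [^] (j - k') \<otimes> z [^] (m - (l - k')) = z [^] (j + m - l)"
            using nat_pow_mult[OF zc, of "j - k'" "m - (l - k')"] by metis
          have ss: "s [^] k' \<otimes> s [^] (l - k') = s [^] l"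
            using k' nat_pow_mult[OF sc, of k' "l - k'"] by simp
          have "cf v k' \<otimes> cf (Y s [^]\<^bsub>UP A\<^esub> m) (l - k') =
              ?a k' \<otimes> (?\<iota> ?C \<otimes> (z [^] (m - (l - k')) \<otimes> s [^] (l - k')))"
            unfolding v(2) coeff_linear_pow[OF zc sc] using True by simp
          also have "\<dots> = (s [^] k' \<otimes> s [^] (l - k')) \<otimes>
              (\<nu> \<otimes> ((z [^] (j - k') \<otimes> z [^] (m - (l - k'))) \<otimes> p)) \<otimes> (?\<iota> (\<gamma> k') \<otimes> ?\<iota> ?C)"
            using zc sc pc \<nu>c \<iota>c by (simp add: m_ac)
          also have "\<dots> = ?W \<otimes> ?\<iota> (\<gamma> k' * ?C)"
            unfolding zz ss ring_of_int_mult ..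
          finally show ?thesis
            using True by simp
        next
          case False
          then have "k' \<le> j \<Longrightarrow> m choose (l - k') = 0"
            by (simp add: binomial_eq_0)
          then have "?g k' = 0"
            by simp
          moreover have "cf v k' \<otimes> cf (Y s [^]\<^bsub>UP A\<^esub> m) (l - k') = \<zero>"
          proof (cases "k' \<le> j")
            case True
            then have "int (m choose (l - k')) = 0"
              using \<open>k' \<le> j \<Longrightarrow> m choose (l - k') = 0\<close> by simp
            then have "cf (Y s [^]\<^bsub>UP A\<^esub> m) (l - k') = \<zero>"
              unfolding coeff_linear_pow[OF zc sc] using zc sc by (simp only: ring_of_int_zero) simp
            then show ?thesis
              using UPA.coeff_closed[OF v(1)] by simp
          next
            case False
            then show ?thesis
              using v(2)[of k'] UPA.coeff_closed[OF Yc] by simp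
          qed
          ultimately show ?thesis
            using Wc by (simp only: ring_of_int_zero r_null)
        qed
      qed (use Wc \<iota>c in auto)
      also have "\<dots> = ?W \<otimes> (\<Oplus>k'\<in>{..l}. ?\<iota> (?g k'))"
        using Wc \<iota>c by (intro finsum_rdistr[symmetric]) auto
      also have "(\<Oplus>k'\<in>{..l}. ?\<iota> (?g k')) = ?\<iota> (\<Sum>k'\<in>{..l}. ?g k')"
        by (rule ring_of_int_sum[symmetric]) simp
      also have "(\<Sum>k'\<in>{..l}. ?g k') = e l"
        unfolding e_def by (rule sum.mono_neutral_cong_right) auto
      also have "?W \<otimes> ?\<iota> (e l) = s [^] l \<otimes> h l"
        unfolding h_def using sc zc pc \<nu>c \<iota>c by (simp add: m_assoc)
      finally show ?thesis .
    qed
    ultimately show ?thesis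
      by blast
  qed
  then show ?thesis
    using h_gr h_low by blast
qed

text \<open>The claim is additive in \<open>b\<close>, so the primitive decomposition reduces it to
  strings \<open>z^t p\<close>. For \<open>p\<close> of degree \<open>l0\<close> the binomial system
  has \<open>q = c - 2 * l0\<close> and source degree \<open>i - l0\<close>, so that all strings are
  symmetric about the same middle degree. That \<open>h\<close> precedes \<open>s\<close> in the
  quantifiers is essential: what lies in \<open>x\<close>-degree at least \<open>n\<close> then
  depends on \<open>s\<close> through explicit powers only.\<close>

lemma monomial_multiple_of_linear_power:
  assumes i: "2 * i + m = c + n - 1" and k: "k < n" "k \<le> i + m" and b: "b \<in> gr (i + m - k)"
  shows "\<exists>h. (\<forall>l\<le>i + m. h l \<in> gr (i + m - l)) \<and>
    (\<forall>l<n. l \<le> i + m \<longrightarrow> h l = (if l = k then b else \<zero>)) \<and>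
    (\<forall>s\<in>K. \<exists>v\<in>H i. \<forall>l. cf (Y s [^]\<^bsub>UP A\<^esub> m \<otimes>\<^bsub>UP A\<^esub> v) l = s [^] l \<otimes> h l)"
    (is "?Q b")
proof -
  have pow_c: "s [^] (l :: nat) \<in> carrier A" if "s \<in> K" for s l
    using K_carrier[OF that] by simp
  have Yc: "Y s [^]\<^bsub>UP A\<^esub> m \<in> carrier (UP A)" if "s \<in> K" for s
    using K_carrier[OF that] z_carrier by simp
  have Q0: "?Q \<zero>"
  proof (intro exI[of _ "\<lambda>l. \<zero>"] conjI allI impI ballI)
    fix s assume s: "s \<in> K"
    have "\<forall>l. cf (Y s [^]\<^bsub>UP A\<^esub> m \<otimes>\<^bsub>UP A\<^esub> \<zero>\<^bsub>UP A\<^esub>) l = s [^] l \<otimes> \<zero>"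
      using pow_c[OF s] Yc[OF s] by simp
    then show "\<exists>v\<in>H i. \<forall>l. cf (Y s [^]\<^bsub>UP A\<^esub> m \<otimes>\<^bsub>UP A\<^esub> v) l = s [^] l \<otimes> \<zero>"
      using hom_zero by blast
  qed (simp_all add: gr_zero)
  show ?thesis
  proof (cases "i + m - k \<le> c")
    case False
    then have "b = \<zero>"
      using degree_le_top[OF b] by blast
    from ssubst[OF this, of ?Q, OF Q0] show ?thesis .
  next
    case True
    from z_lefschetz True b show ?thesis
    proof (induction rule: primitive_induct)
      case (string l0 t p)
      show ?case
      proof (cases "t \<le> c - 2 * l0")
        case False
        then have "t = (t - (c - 2 * l0 + 1)) + (c - 2 * l0 + 1)"
          by linarith
        then have "z [^] t = z [^] (t - (c - 2 * l0 + 1)) \<otimes> z [^] (c - 2 * l0 + 1)"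
          using nat_pow_mult[OF z_carrier, of "t - (c - 2 * l0 + 1)" "c - 2 * l0 + 1"] by simp
        then have "z [^] t \<otimes> p = z [^] (t - (c - 2 * l0 + 1)) \<otimes> (z [^] (c - 2 * l0 + 1) \<otimes> p)"
          using z_carrier gr_carrier[OF string(3)] by (simp only: m_assoc nat_pow_closed)
        then have "z [^] t \<otimes> p = \<zero>"
          unfolding string(4) using z_carrier by simp
        from ssubst[OF this, of ?Q, OF Q0] show ?thesis .
      next
        case tq: True
        \<comment> \<open>A string that reaches degree \<open>i + m - k\<close> ends in degree
          \<open>c - l0\<close>; as \<open>k \<le> n - 1\<close>, the equation for
          \<open>c + n - 1\<close> gives the bound.\<close>
        have le: "l0 \<le> i"
          using tq string(1,2) k i by linarith
        have e1: "(c - 2 * l0) + (n - 1) = 2 * (i - l0) + m"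
          using le i string(1) n_pos by linarith
        have e2: "t + k = (i - l0) + m"
          using le string(2) k by linarith
        have e3: "l0 + (i - l0) = i"
          using le by simp
        show ?thesis
          using string_multiple_of_linear_power[OF string(3,4) e1 k(1) e2 tq] unfolding e3 .
      qed
    next
      case (add a b)
      from add(3) obtain h where h: "\<forall>l\<le>i + m. h l \<in> gr (i + m - l)"
        "\<forall>l<n. l \<le> i + m \<longrightarrow> h l = (if l = k then a else \<zero>)"
        "\<forall>s\<in>K. \<exists>v\<in>H i. \<forall>l. cf (Y s [^]\<^bsub>UP A\<^esub> m \<otimes>\<^bsub>UP A\<^esub> v) l = s [^] l \<otimes> h l"
        by (elim exE conjE)
      from add(4) obtain h' where h': "\<forall>l\<le>i + m. h' l \<in> gr (i + m - l)"
        "\<forall>l<n. l \<le> i + m \<longrightarrow> h' l = (if l = k then b else \<zero>)"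
        "\<forall>s\<in>K. \<exists>v\<in>H i. \<forall>l. cf (Y s [^]\<^bsub>UP A\<^esub> m \<otimes>\<^bsub>UP A\<^esub> v) l = s [^] l \<otimes> h' l"
        by (elim exE conjE)
      \<comment> \<open>Above \<open>i + m\<close> nothing is known about \<open>h\<close> and
        \<open>h'\<close>, not even membership in \<open>A\<close>. The value zero is correct there
        because the product is homogeneous of degree \<open>m + i\<close>.\<close>
      define g where "g l = (if l \<le> i + m then h l \<oplus> h' l else \<zero>)" for l
      have "\<exists>v\<in>H i. \<forall>l. cf (Y s [^]\<^bsub>UP A\<^esub> m \<otimes>\<^bsub>UP A\<^esub> v) l = s [^] l \<otimes> g l" if s: "s \<in> K" for s
      proof -
        obtain v where v: "v \<in> H i" "\<forall>l. cf (Y s [^]\<^bsub>UP A\<^esub> m \<otimes>\<^bsub>UP A\<^esub> v) l = s [^] l \<otimes> h l"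
          using bspec[OF h(3) s] by (elim bexE)
        obtain v' where v': "v' \<in> H i" "\<forall>l. cf (Y s [^]\<^bsub>UP A\<^esub> m \<otimes>\<^bsub>UP A\<^esub> v') l = s [^] l \<otimes> h' l"
          using bspec[OF h'(3) s] by (elim bexE)
        note vc = hom_carrier[OF v(1)] hom_carrier[OF v'(1)]
        have vv: "v \<oplus>\<^bsub>UP A\<^esub> v' \<in> H i"
          using hom_add[OF v(1) v'(1)] .
        have "cf (Y s [^]\<^bsub>UP A\<^esub> m \<otimes>\<^bsub>UP A\<^esub> (v \<oplus>\<^bsub>UP A\<^esub> v')) l = s [^] l \<otimes> g l" for l
        proof (cases "l \<le> i + m")
          case True
          have hc: "h l \<in> carrier A" "h' l \<in> carrier A"
            using h(1) h'(1) True gr_carrier by auto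
          have "cf (Y s [^]\<^bsub>UP A\<^esub> m \<otimes>\<^bsub>UP A\<^esub> (v \<oplus>\<^bsub>UP A\<^esub> v')) l = s [^] l \<otimes> h l \<oplus> s [^] l \<otimes> h' l"
            using v(2) v'(2) vc Yc[OF s] by (simp add: UPA.P.r_distr del: UPA.coeff_mult)
          then show ?thesis
            using hc pow_c[OF s] True by (simp add: g_def r_distr)
        next
          case False
          have "Y s [^]\<^bsub>UP A\<^esub> m \<otimes>\<^bsub>UP A\<^esub> (v \<oplus>\<^bsub>UP A\<^esub> v') \<in> H (m + i)"
            using hom_mult[OF hom_pow[OF Y_hom[OF s]] vv] .
          then show ?thesis
            using hom_coeff_zero[of _ "m + i" l] False pow_c[OF s] by (simp add: g_def)
        qed
        then show ?thesis
          using vv by blast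
      qed
      moreover have "\<forall>l\<le>i + m. g l \<in> gr (i + m - l)"
        using h(1) h'(1) gr_add by (simp add: g_def)
      moreover have "\<forall>l<n. l \<le> i + m \<longrightarrow> g l = (if l = k then a \<oplus> b else \<zero>)"
        using h(2) h'(2) by (simp add: g_def)
      ultimately show ?case
        by blast
    qed
  qed
qed

end

section \<open>Generic parameters\<close>

context standard_graded_algebra
begin

text \<open>\<open>K\<close> as a ring in its own right, with the operations of \<open>A\<close>:
  counting zeros of the pivots takes place over a field of parameters, and \<open>A[x]\<close> is a
  module over it.\<close>

abbreviation KF :: "('a, 'b) ring_scheme" where
  "KF \<equiv> A\<lparr>carrier := K\<rparr>"

lemma KF_field: "field KF"
  using subfield_iff(2)[OF K.subfield_axioms] .

lemma KF_cring: "cring KF"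
  using KF_field unfolding field_def domain_def by blast

lemma KF_polynomial_add:
  "\<lbrakk> polynomial_function KF g; polynomial_function KF h \<rbrakk> \<Longrightarrow> polynomial_function KF (\<lambda>s. g s \<oplus> h s)"
  using cring.polynomial_function_add[OF KF_cring, of g h] by simp

lemma KF_polynomial_mult:
  "\<lbrakk> polynomial_function KF g; polynomial_function KF h \<rbrakk> \<Longrightarrow> polynomial_function KF (\<lambda>s. g s \<otimes> h s)"
  using cring.polynomial_function_mult[OF KF_cring, of g h] by simp

lemma KF_polynomial_const: "a \<in> K \<Longrightarrow> polynomial_function KF (\<lambda>s. a)"
  using cring.polynomial_function_const[OF KF_cring, of a] by simp

lemma KF_polynomial_pow: "polynomial_function KF (\<lambda>s. s [^] (l :: nat))"
  using cring.polynomial_function_pow[OF KF_cring, of l] nat_pow_consistent by simp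

lemma KF_polynomial_closed: "\<lbrakk> polynomial_function KF g; s \<in> K \<rbrakk> \<Longrightarrow> g s \<in> K"
  using cring.polynomial_function_closed[OF KF_cring, of g s] by simp

lemma KF_module: "module KF (UP A)"
proof (rule moduleI)
  show "cring KF"
    by (rule KF_cring)
  show "abelian_group (UP A)"
    by (rule UPA.P.is_abelian_group)
qed (simp_all add: K_carrier UPA.UP_smult_l_distr UPA.UP_smult_r_distr UPA.UP_smult_assoc1)

end

context monic_homogeneous
begin

abbreviation cls :: "(nat \<Rightarrow> 'a) \<Rightarrow> (nat \<Rightarrow> 'a) set" where
  "cls p \<equiv> J +>\<^bsub>UP A\<^esub> p"

lemma cls_eq_iff:
  "\<lbrakk> p \<in> carrier (UP A); q \<in> carrier (UP A) \<rbrakk> \<Longrightarrow> cls p = cls q \<longleftrightarrow> p \<ominus>\<^bsub>UP A\<^esub> q \<in> J"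
  using UPA.P.quotient_eq_iff_same_a_r_cos[OF J_ideal] by blast

lemma cls_add_cong:
  assumes "cls a = cls a'" "cls b = cls b'"
    and "a \<in> carrier (UP A)" "a' \<in> carrier (UP A)" "b \<in> carrier (UP A)" "b' \<in> carrier (UP A)"
  shows "cls (a \<oplus>\<^bsub>UP A\<^esub> b) = cls (a' \<oplus>\<^bsub>UP A\<^esub> b')"
  using ideal.a_rcos_sum[OF J_ideal assms(3,5)] ideal.a_rcos_sum[OF J_ideal assms(4,6)] assms(1,2)
  by simp

lemma cls_mult_cong:
  assumes "cls a = cls a'" "cls b = cls b'"
    and "a \<in> carrier (UP A)" "a' \<in> carrier (UP A)" "b \<in> carrier (UP A)" "b' \<in> carrier (UP A)"
  shows "cls (a \<otimes>\<^bsub>UP A\<^esub> b) = cls (a' \<otimes>\<^bsub>UP A\<^esub> b')"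
  using ideal.rcoset_mult_add[OF J_ideal assms(3,5)] ideal.rcoset_mult_add[OF J_ideal assms(4,6)]
    assms(1,2)
  by simp

lemma cls_smult_cong:
  assumes "cls a = cls a'" "k \<in> carrier A" "a \<in> carrier (UP A)" "a' \<in> carrier (UP A)"
  shows "cls (k \<odot>\<^bsub>UP A\<^esub> a) = cls (k \<odot>\<^bsub>UP A\<^esub> a')"
  using cls_mult_cong[OF refl assms(1), of "mn k 0"] assms(2-4) UPA.monom_mult_is_smult by simp

end

section \<open>Coordinates of homogeneous classes\<close>

context gorenstein_monic
begin

text \<open>An index \<open>(k, u)\<close> stands for the monomial \<open>u x^k\<close>; scalars are
  taken in \<open>K\<close>, over which finitely many monomials generate a component of the
  quotient.\<close>

abbreviation comb :: "(nat \<times> 'a) set \<Rightarrow> (nat \<times> 'a \<Rightarrow> 'a) \<Rightarrow> nat \<Rightarrow> 'a" where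
  "comb I \<kappa> \<equiv> \<Oplus>\<^bsub>UP A\<^esub>i\<in>I. \<kappa> i \<odot>\<^bsub>UP A\<^esub> mn (snd i) (fst i)"

lemma comb_closed:
  assumes "snd ` I \<subseteq> carrier A" "\<And>i. i \<in> I \<Longrightarrow> \<kappa> i \<in> K"
  shows "comb I \<kappa> \<in> carrier (UP A)"
  using assms K_carrier by (intro UPA.P.finsum_closed) auto

lemma comb_add:
  assumes "snd ` I \<subseteq> carrier A" "\<And>i. i \<in> I \<Longrightarrow> \<kappa> i \<in> K" "\<And>i. i \<in> I \<Longrightarrow> \<kappa>' i \<in> K"
  shows "comb I (\<lambda>i. \<kappa> i \<oplus> \<kappa>' i) = comb I \<kappa> \<oplus>\<^bsub>UP A\<^esub> comb I \<kappa>'"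
proof -
  have cl: "snd i \<in> carrier A" "\<kappa> i \<in> carrier A" "\<kappa>' i \<in> carrier A" if "i \<in> I" for i
    using assms K_carrier that by auto
  have "comb I (\<lambda>i. \<kappa> i \<oplus> \<kappa>' i) = (\<Oplus>\<^bsub>UP A\<^esub>i\<in>I. \<kappa> i \<odot>\<^bsub>UP A\<^esub> mn (snd i) (fst i) \<oplus>\<^bsub>UP A\<^esub>
      \<kappa>' i \<odot>\<^bsub>UP A\<^esub> mn (snd i) (fst i))"
    using cl by (intro UPA.P.finsum_cong') (simp_all add: UPA.UP_smult_l_distr)
  also have "\<dots> = comb I \<kappa> \<oplus>\<^bsub>UP A\<^esub> comb I \<kappa>'"
    using cl by (intro UPA.P.finsum_addf) simp_all
  finally show ?thesis .
qed

lemma comb_smult: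
  assumes "finite I" "snd ` I \<subseteq> carrier A" "\<And>i. i \<in> I \<Longrightarrow> \<kappa> i \<in> K" "a \<in> K"
  shows "comb I (\<lambda>i. a \<otimes> \<kappa> i) = a \<odot>\<^bsub>UP A\<^esub> comb I \<kappa>"
proof -
  have cl: "snd i \<in> carrier A" "\<kappa> i \<in> carrier A" if "i \<in> I" for i
    using assms K_carrier that by auto
  have "comb I (\<lambda>i. a \<otimes> \<kappa> i) = (\<Oplus>\<^bsub>UP A\<^esub>i\<in>I. a \<odot>\<^bsub>UP A\<^esub> (\<kappa> i \<odot>\<^bsub>UP A\<^esub> mn (snd i) (fst i)))"
    using cl K_carrier[OF assms(4)] by (intro UPA.P.finsum_cong') (simp_all add: UPA.UP_smult_assoc1)
  also have "\<dots> = a \<odot>\<^bsub>UP A\<^esub> comb I \<kappa>"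
    using cl K_carrier[OF assms(4)] assms(1) by (intro UPA.finsum_smult_ldistr[symmetric]) simp_all
  finally show ?thesis .
qed

lemma comb_single:
  assumes "finite I" "snd ` I \<subseteq> carrier A" "j \<in> I" "a \<in> K"
  shows "comb I (\<lambda>i. if i = j then a else \<zero>) = a \<odot>\<^bsub>UP A\<^esub> mn (snd j) (fst j)"
proof -
  have cl: "snd i \<in> carrier A" if "i \<in> I" for i
    using assms that by auto
  have "comb I (\<lambda>i. if i = j then a else \<zero>) =
      (\<Oplus>\<^bsub>UP A\<^esub>i\<in>I. if j = i then a \<odot>\<^bsub>UP A\<^esub> mn (snd i) (fst i) else \<zero>\<^bsub>UP A\<^esub>)"
    using cl K_carrier[OF assms(4)] by (intro UPA.P.finsum_cong') simp_all
  also have "\<dots> = a \<odot>\<^bsub>UP A\<^esub> mn (snd j) (fst j)"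
    using cl K_carrier[OF assms(4)] assms(1,3) by (intro UPA.P.finsum_singleton) simp_all
  finally show ?thesis .
qed

text \<open>Remainders modulo \<open>f\<close> involve only \<open>x^k\<close> with
  \<open>k < n\<close>, and their coefficients lie in the finite-dimensional components
  \<open>gr (e - k)\<close>. Spanning is enough for the elimination argument, in which coordinates
  need not be unique.\<close>

lemma exists_monomial_span:
  "\<exists>I. finite I \<and> (\<forall>i\<in>I. fst i < n \<and> fst i \<le> e \<and> snd i \<in> gr (e - fst i)) \<and>
    (\<forall>q\<in>H e. \<exists>\<kappa>. (\<forall>i\<in>I. \<kappa> i \<in> K) \<and> cls q = cls (comb I \<kappa>))"
proof -
  have "\<exists>U. finite U \<and> U \<subseteq> gr j \<and> gr j \<subseteq> finite_span K A U" for j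
  proof (cases "j \<le> c")
    case True
    then show ?thesis
      by (rule component_finite_span)
  next
    case False
    then show ?thesis
      using above_top[of j] finite_span_empty[of K] by (intro exI[of _ "{}"]) simp
  qed
  then obtain V where V: "\<And>j. finite (V j)" "\<And>j. V j \<subseteq> gr j" "\<And>j. gr j \<subseteq> finite_span K A (V j)"
    by metis
  define I where "I = Sigma {k. k < n \<and> k \<le> e} (\<lambda>k. V (e - k))"
  have fin: "finite I"
    unfolding I_def using V(1) by (intro finite_SigmaI) auto
  have Ie: "fst i < n \<and> fst i \<le> e \<and> snd i \<in> gr (e - fst i)" if "i \<in> I" for i
    using that subsetD[OF V(2)] unfolding I_def by auto
  have Ic: "snd ` I \<subseteq> carrier A"
    using Ie gr_carrier by blast
  define T where "T q \<longleftrightarrow> q \<in> carrier (UP A) \<and> (\<exists>\<kappa>. (\<forall>i\<in>I. \<kappa> i \<in> K) \<and> cls q = cls (comb I \<kappa>))" for q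
  have K0: "\<zero> \<in> K"
    using gr_zero[of 0] component_zero by simp
  have Kadd: "a \<oplus> b \<in> K" if "a \<in> K" "b \<in> K" for a b
    using gr_add[of a 0 b] that component_zero by simp
  have T_gen: "T (a \<odot>\<^bsub>UP A\<^esub> mn (snd j) (fst j))" if "j \<in> I" "a \<in> K" for a j
  proof -
    have "a \<odot>\<^bsub>UP A\<^esub> mn (snd j) (fst j) \<in> carrier (UP A)"
      using K_carrier[OF that(2)] Ic that(1) by auto
    moreover have "cls (a \<odot>\<^bsub>UP A\<^esub> mn (snd j) (fst j)) = cls (comb I (\<lambda>i. if i = j then a else \<zero>))"
      using comb_single[OF fin Ic that] by (simp only:)
    moreover have "\<forall>i\<in>I. (if i = j then a else \<zero>) \<in> K"
      using that K0 by simp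
    ultimately show ?thesis
      unfolding T_def by (intro conjI exI[of _ "\<lambda>i. if i = j then a else \<zero>"])
  qed
  have T_add: "T (p \<oplus>\<^bsub>UP A\<^esub> q)" if p: "T p" and q: "T q" for p q
  proof -
    from p obtain \<kappa> where \<kappa>: "\<forall>i\<in>I. \<kappa> i \<in> K" "cls p = cls (comb I \<kappa>)"
      unfolding T_def by (elim conjE exE)
    from q obtain \<kappa>' where \<kappa>': "\<forall>i\<in>I. \<kappa>' i \<in> K" "cls q = cls (comb I \<kappa>')"
      unfolding T_def by (elim conjE exE)
    have cl: "p \<in> carrier (UP A)" "q \<in> carrier (UP A)"
      using p q unfolding T_def by simp_all
    have "cls (p \<oplus>\<^bsub>UP A\<^esub> q) = cls (comb I \<kappa> \<oplus>\<^bsub>UP A\<^esub> comb I \<kappa>')"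
      using \<kappa> \<kappa>' by (intro cls_add_cong cl comb_closed Ic) simp_all
    also have "\<dots> = cls (comb I (\<lambda>i. \<kappa> i \<oplus> \<kappa>' i))"
      using comb_add[OF Ic, of \<kappa> \<kappa>'] \<kappa>(1) \<kappa>'(1) by simp
    finally have "cls (p \<oplus>\<^bsub>UP A\<^esub> q) = cls (comb I (\<lambda>i. \<kappa> i \<oplus> \<kappa>' i))" .
    moreover have "\<forall>i\<in>I. \<kappa> i \<oplus> \<kappa>' i \<in> K"
      using \<kappa>(1) \<kappa>'(1) Kadd by simp
    ultimately show ?thesis
      unfolding T_def using UPA.P.a_closed[OF cl] by (intro conjI exI[of _ "\<lambda>i. \<kappa> i \<oplus> \<kappa>' i"])
  qed
  have T_zero: "T \<zero>\<^bsub>UP A\<^esub>"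
  proof -
    have "comb I (\<lambda>i. \<zero>) = \<zero>\<^bsub>UP A\<^esub>"
      using Ic by (intro UPA.P.add.finprod_one_eqI) auto
    then have "cls \<zero>\<^bsub>UP A\<^esub> = cls (comb I (\<lambda>i. \<zero>))"
      by (simp only:)
    moreover have "\<forall>i\<in>I. \<zero> \<in> K"
      using K0 by simp
    ultimately show ?thesis
      unfolding T_def by (intro conjI exI[of _ "\<lambda>i. \<zero>"] UPA.UP_zero_closed)
  qed
  have T_monom: "T (mn b k)" if k: "k < n" "k \<le> e" and b: "b \<in> gr (e - k)" for b k
  proof -
    let ?V = "V (e - k)"
    obtain \<kappa> where \<kappa>: "\<kappa> \<in> ?V \<rightarrow> K" "b = (\<Oplus>u\<in>?V. \<kappa> u \<otimes> u)"
      using V(3)[of "e - k"] b unfolding finite_span_def by blast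
    have cl: "u \<in> carrier A" "\<kappa> u \<in> carrier A" "\<kappa> u \<in> K" if "u \<in> ?V" for u
      using subsetD[OF V(2) that] gr_carrier funcset_mem[OF \<kappa>(1) that]
        K_carrier[OF funcset_mem[OF \<kappa>(1) that]] by auto
    have "T (mn (\<Oplus>u\<in>W. \<kappa> u \<otimes> u) k)" if "finite W" "W \<subseteq> ?V" for W
      using that
    proof (induction W)
      case empty
      then show ?case
        using T_zero UPA.monom_zero by simp
    next
      case (insert u W)
      have u: "u \<in> ?V" and W: "W \<subseteq> ?V"
        using insert.prems by simp_all
      have sumc: "(\<Oplus>u\<in>W. \<kappa> u \<otimes> u) \<in> carrier A"
        using W cl by (intro finsum_closed) auto
      have "(\<Oplus>u\<in>insert u W. \<kappa> u \<otimes> u) = \<kappa> u \<otimes> u \<oplus> (\<Oplus>u\<in>W. \<kappa> u \<otimes> u)"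
        using insert.hyps W cl u by (intro finsum_insert) auto
      then have "mn (\<Oplus>u\<in>insert u W. \<kappa> u \<otimes> u) k =
          \<kappa> u \<odot>\<^bsub>UP A\<^esub> mn u k \<oplus>\<^bsub>UP A\<^esub> mn (\<Oplus>u\<in>W. \<kappa> u \<otimes> u) k"
        using cl[OF u] sumc UPA.monom_add UPA.monom_mult_smult by simp
      moreover have "T (\<kappa> u \<odot>\<^bsub>UP A\<^esub> mn u k)"
        using T_gen[of "(k, u)" "\<kappa> u"] cl[OF u] u k unfolding I_def by simp
      ultimately show ?case
        using T_add insert.IH[OF W] by simp
    qed
    from this[OF V(1) subset_refl] show ?thesis
      unfolding \<kappa>(2) .
  qed
  have "T q" if q: "q \<in> H e" for q
  proof -
    obtain q' where q': "q' \<in> H e" "\<forall>k\<ge>n. cf q' k = \<zero>" "q \<ominus>\<^bsub>UP A\<^esub> q' \<in> J"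
      using reduction[OF q] by blast
    note cl = hom_carrier[OF q] hom_carrier[OF q'(1)]
    have "T (\<Oplus>\<^bsub>UP A\<^esub>k\<in>L. mn (cf q' k) k)" if "finite L" "L \<subseteq> {..<n}" for L
      using that
    proof (induction L)
      case empty
      then show ?case
        using T_zero by simp
    next
      case (insert k L)
      have "T (mn (cf q' k) k)"
      proof (cases "k \<le> e")
        case True
        then show ?thesis
          using T_monom[OF _ True hom_coeff[OF q'(1) True]] insert.prems by simp
      next
        case False
        then show ?thesis
          using hom_coeff_zero[OF q'(1)] T_zero UPA.monom_zero by simp
      qed
      moreover have "(\<Oplus>\<^bsub>UP A\<^esub>k\<in>insert k L. mn (cf q' k) k) =
          mn (cf q' k) k \<oplus>\<^bsub>UP A\<^esub> (\<Oplus>\<^bsub>UP A\<^esub>k\<in>L. mn (cf q' k) k)"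
        using insert.hyps cl(2) by (intro UPA.P.finsum_insert) simp_all
      ultimately show ?case
        using T_add insert by simp
    qed
    from this[of "{..<n}"] have "T q'"
      using finsum_monom_coeff[OF cl(2), of n] q'(2) by simp
    moreover have "cls q = cls q'"
      using cls_eq_iff[OF cl] q'(3) by simp
    ultimately show ?thesis
      unfolding T_def using cl(1) by simp
  qed
  then have "\<forall>q\<in>H e. \<exists>\<kappa>. (\<forall>i\<in>I. \<kappa> i \<in> K) \<and> cls q = cls (comb I \<kappa>)"
    unfolding T_def by simp
  moreover have "\<forall>i\<in>I. fst i < n \<and> fst i \<le> e \<and> snd i \<in> gr (e - fst i)"
    using Ie by simp
  ultimately show ?thesis
    using fin by (intro exI[of _ I] conjI)
qed

text \<open>The coordinates of each \<open>q l\<close> are chosen once, independently of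
  \<open>s\<close>, and the power \<open>s [^] r l\<close> multiplies them. Positive exponents make
  all of them vanish at \<open>s = \<zero>\<close>: these are the error terms of the
  degeneration.\<close>

lemma polynomial_family_comb:
  assumes I: "finite I" "snd ` I \<subseteq> carrier A"
    and span: "\<And>q. q \<in> H e \<Longrightarrow> \<exists>\<kappa>. (\<forall>i\<in>I. \<kappa> i \<in> K) \<and> cls q = cls (comb I \<kappa>)"
    and L: "finite L" "\<And>l. l \<in> L \<Longrightarrow> r l > (0 :: nat)" "\<And>l. l \<in> L \<Longrightarrow> q l \<in> H e"
  shows "\<exists>\<kappa>. (\<forall>i\<in>I. polynomial_function KF (\<kappa> i) \<and> \<kappa> i \<zero> = \<zero>) \<and>
    (\<forall>s\<in>K. cls (\<Oplus>\<^bsub>UP A\<^esub>l\<in>L. s [^] r l \<odot>\<^bsub>UP A\<^esub> q l) = cls (comb I (\<lambda>i. \<kappa> i s)))"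
  using L
proof (induction L)
  case empty
  have "comb I (\<lambda>i. \<zero>) = \<zero>\<^bsub>UP A\<^esub>"
    using I by (intro UPA.P.add.finprod_one_eqI) auto
  moreover have "polynomial_function KF (\<lambda>s. \<zero>)"
    using gr_zero[of 0] component_zero by (intro KF_polynomial_const) simp
  ultimately show ?case
    by (intro exI[of _ "\<lambda>i s. \<zero>"]) simp
next
  case (insert l L)
  from insert.IH insert.prems obtain \<kappa> where \<kappa>: "\<forall>i\<in>I. polynomial_function KF (\<kappa> i) \<and> \<kappa> i \<zero> = \<zero>"
    "\<forall>s\<in>K. cls (\<Oplus>\<^bsub>UP A\<^esub>l\<in>L. s [^] r l \<odot>\<^bsub>UP A\<^esub> q l) = cls (comb I (\<lambda>i. \<kappa> i s))"
    by auto
  have ql: "q l \<in> H e" and rl: "r l > 0"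
    using insert.prems by simp_all
  from span[OF ql] obtain \<kappa>0 where \<kappa>0: "\<forall>i\<in>I. \<kappa>0 i \<in> K" "cls (q l) = cls (comb I \<kappa>0)"
    by (elim exE conjE)
  let ?\<kappa> = "\<lambda>i s. s [^] r l \<otimes> \<kappa>0 i \<oplus> \<kappa> i s"
  have "polynomial_function KF (?\<kappa> i)" if "i \<in> I" for i
    using that \<kappa>(1) \<kappa>0(1)
    by (intro KF_polynomial_add KF_polynomial_mult KF_polynomial_pow KF_polynomial_const) simp_all
  moreover have "?\<kappa> i \<zero> = \<zero>" if "i \<in> I" for i
    using that \<kappa>(1) \<kappa>0(1) rl K_carrier by (simp add: nat_pow_zero)
  moreover have "cls (\<Oplus>\<^bsub>UP A\<^esub>l\<in>insert l L. s [^] r l \<odot>\<^bsub>UP A\<^esub> q l) = cls (comb I (\<lambda>i. ?\<kappa> i s))"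
    if s: "s \<in> K" for s
  proof -
    have powK: "s [^] (t :: nat) \<in> K" for t
      using KF_polynomial_closed[OF KF_polynomial_pow s] .
    note powc = K_carrier[OF powK]
    have \<kappa>K: "\<kappa> i s \<in> K" if "i \<in> I" for i
      using KF_polynomial_closed[of "\<kappa> i" s] \<kappa>(1) that s by simp
    have \<kappa>0K: "s [^] r l \<otimes> \<kappa>0 i \<in> K" if "i \<in> I" for i
      using \<kappa>0(1) that powK K.m_closed by simp
    have qc: "q l' \<in> carrier (UP A)" if "l' \<in> insert l L" for l'
      using insert.prems(2)[OF that] hom_carrier by blast
    have "(\<Oplus>\<^bsub>UP A\<^esub>l\<in>insert l L. s [^] r l \<odot>\<^bsub>UP A\<^esub> q l) =
        s [^] r l \<odot>\<^bsub>UP A\<^esub> q l \<oplus>\<^bsub>UP A\<^esub> (\<Oplus>\<^bsub>UP A\<^esub>l\<in>L. s [^] r l \<odot>\<^bsub>UP A\<^esub> q l)"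
      using insert.hyps qc powc by (intro UPA.P.finsum_insert) auto
    moreover have sumc: "(\<Oplus>\<^bsub>UP A\<^esub>l\<in>L. s [^] r l \<odot>\<^bsub>UP A\<^esub> q l) \<in> carrier (UP A)"
      using qc powc by (intro UPA.P.finsum_closed) auto
    moreover have "cls (s [^] r l \<odot>\<^bsub>UP A\<^esub> q l \<oplus>\<^bsub>UP A\<^esub> (\<Oplus>\<^bsub>UP A\<^esub>l\<in>L. s [^] r l \<odot>\<^bsub>UP A\<^esub> q l)) =
        cls (s [^] r l \<odot>\<^bsub>UP A\<^esub> comb I \<kappa>0 \<oplus>\<^bsub>UP A\<^esub> comb I (\<lambda>i. \<kappa> i s))"
    proof (rule cls_add_cong)
      have \<kappa>0c: "comb I \<kappa>0 \<in> carrier (UP A)"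
        using \<kappa>0(1) by (intro comb_closed I) simp
      show "cls (s [^] r l \<odot>\<^bsub>UP A\<^esub> q l) = cls (s [^] r l \<odot>\<^bsub>UP A\<^esub> comb I \<kappa>0)"
        by (rule cls_smult_cong[OF \<kappa>0(2) powc qc[OF insertI1] \<kappa>0c])
      show "cls (\<Oplus>\<^bsub>UP A\<^esub>l\<in>L. s [^] r l \<odot>\<^bsub>UP A\<^esub> q l) = cls (comb I (\<lambda>i. \<kappa> i s))"
        using \<kappa>(2) s by blast
      show "s [^] r l \<odot>\<^bsub>UP A\<^esub> q l \<in> carrier (UP A)"
        by (rule UPA.UP_smult_closed[OF powc qc[OF insertI1]])
      show "s [^] r l \<odot>\<^bsub>UP A\<^esub> comb I \<kappa>0 \<in> carrier (UP A)"
        by (rule UPA.UP_smult_closed[OF powc \<kappa>0c])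
      show "(\<Oplus>\<^bsub>UP A\<^esub>l\<in>L. s [^] r l \<odot>\<^bsub>UP A\<^esub> q l) \<in> carrier (UP A)"
        by (rule sumc)
      show "comb I (\<lambda>i. \<kappa> i s) \<in> carrier (UP A)"
        by (rule comb_closed[OF I(2) \<kappa>K])
    qed
    moreover have "s [^] r l \<odot>\<^bsub>UP A\<^esub> comb I \<kappa>0 \<oplus>\<^bsub>UP A\<^esub> comb I (\<lambda>i. \<kappa> i s) = comb I (\<lambda>i. ?\<kappa> i s)"
      using comb_add[OF I(2) \<kappa>0K \<kappa>K] comb_smult[OF I _ powK, of \<kappa>0 "r l"] \<kappa>0(1) by simp
    ultimately show ?thesis
      by (simp only:)
  qed
  ultimately have "(\<forall>i\<in>I. polynomial_function KF (?\<kappa> i) \<and> ?\<kappa> i \<zero> = \<zero>) \<and>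
    (\<forall>s\<in>K. cls (\<Oplus>\<^bsub>UP A\<^esub>l\<in>insert l L. s [^] r l \<odot>\<^bsub>UP A\<^esub> q l) = cls (comb I (\<lambda>i. ?\<kappa> i s)))"
    by (intro conjI ballI)
  then show ?case
    by (intro exI[of _ ?\<kappa>])
qed

end

section \<open>Surjectivity for all but finitely many parameters\<close>

context lefschetz_monic
begin

text \<open>A suitable multiple of the power of \<open>Y s\<close> has
  \<open>s [^] l \<otimes> h l\<close> as coefficient of \<open>x^l\<close>; below \<open>n\<close>
  only \<open>l = fst j\<close> remains. Division by \<open>s [^] fst j\<close> turns this term into
  the generator itself and leaves \<open>s [^] (l - fst j)\<close> in front of the terms with
  \<open>l \<ge> n > fst j\<close>, whose reduction modulo \<open>f\<close> gives
  \<open>\<kappa>\<close>.\<close>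

lemma generator_relation:
  assumes eq: "2 * i + m = c + n - 1"
    and I: "finite I" "\<And>j. j \<in> I \<Longrightarrow> fst j < n \<and> fst j \<le> i + m \<and> snd j \<in> gr (i + m - fst j)"
    and span: "\<And>q. q \<in> H (i + m) \<Longrightarrow> \<exists>\<kappa>. (\<forall>j\<in>I. \<kappa> j \<in> K) \<and> cls q = cls (comb I \<kappa>)"
    and j: "j \<in> I"
  shows "\<exists>\<kappa>. (\<forall>j\<in>I. polynomial_function KF (\<kappa> j) \<and> \<kappa> j \<zero> = \<zero>) \<and>
    (\<forall>s\<in>K - {\<zero>}. \<exists>v\<in>H i. cls (mn (snd j) (fst j) \<oplus>\<^bsub>UP A\<^esub> comb I (\<lambda>j. \<kappa> j s)) =
      cls (Y s [^]\<^bsub>UP A\<^esub> m \<otimes>\<^bsub>UP A\<^esub> v))"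
proof -
  let ?k = "fst j" and ?u = "snd j"
  have k: "?k < n" "?k \<le> i + m" and u: "?u \<in> gr (i + m - ?k)"
    using I(2)[OF j] by simp_all
  note uc = gr_carrier[OF u]
  have Ic: "snd ` I \<subseteq> carrier A"
    using I(2) gr_carrier by blast
  from monomial_multiple_of_linear_power[OF eq k u] obtain h
    where h: "\<forall>l\<le>i + m. h l \<in> gr (i + m - l)"
      "\<forall>l<n. l \<le> i + m \<longrightarrow> h l = (if l = ?k then ?u else \<zero>)"
      "\<forall>s\<in>K. \<exists>v\<in>H i. \<forall>l. cf (Y s [^]\<^bsub>UP A\<^esub> m \<otimes>\<^bsub>UP A\<^esub> v) l = s [^] l \<otimes> h l"
    by (elim exE conjE)
  let ?L = "{n..i + m}"
  have hc: "h l \<in> carrier A" if "l \<le> i + m" for l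
    using h(1) that gr_carrier by blast
  have "\<exists>\<kappa>. (\<forall>i\<in>I. polynomial_function KF (\<kappa> i) \<and> \<kappa> i \<zero> = \<zero>) \<and>
    (\<forall>s\<in>K. cls (\<Oplus>\<^bsub>UP A\<^esub>l\<in>?L. s [^] (l - ?k) \<odot>\<^bsub>UP A\<^esub> mn (h l) l) = cls (comb I (\<lambda>i. \<kappa> i s)))"
  proof (rule polynomial_family_comb[OF I(1) Ic span])
    show "mn (h l) l \<in> H (i + m)" if "l \<in> ?L" for l
      using h(1) that by (intro hom_monom[of _ "i + m - l"]) simp_all
  qed (use k in auto)
  then obtain \<kappa> where \<kappa>: "\<forall>i\<in>I. polynomial_function KF (\<kappa> i) \<and> \<kappa> i \<zero> = \<zero>"
    "\<forall>s\<in>K. cls (\<Oplus>\<^bsub>UP A\<^esub>l\<in>?L. s [^] (l - ?k) \<odot>\<^bsub>UP A\<^esub> mn (h l) l) = cls (comb I (\<lambda>i. \<kappa> i s))"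
    by (elim exE conjE)
  have "\<exists>v\<in>H i. cls (mn ?u ?k \<oplus>\<^bsub>UP A\<^esub> comb I (\<lambda>j. \<kappa> j s)) = cls (Y s [^]\<^bsub>UP A\<^esub> m \<otimes>\<^bsub>UP A\<^esub> v)"
    if s: "s \<in> K - {\<zero>}" for s
  proof -
    have sK: "s \<in> K" and sc: "s \<in> carrier A"
      using s K_carrier by simp_all
    note inv = subfield_m_inv[OF K.subfield_axioms s]
    \<comment> \<open>The factor that undoes \<open>s [^] ?k\<close>; this is why
      \<open>s = \<zero>\<close> is excluded.\<close>
    let ?\<tau> = "inv s [^] ?k"
    have \<tau>K: "?\<tau> \<in> K"
      using KF_polynomial_closed[OF KF_polynomial_pow, of "inv s"] inv(1) by simp
    note \<tau>c = K_carrier[OF \<tau>K]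
    have ic: "inv s \<in> carrier A"
      using inv(1) K_carrier by simp
    have \<tau>s: "?\<tau> \<otimes> s [^] ?k = \<one>"
      using nat_pow_distrib[OF ic sc, of ?k] inv(3) by simp
    have \<tau>l: "?\<tau> \<otimes> s [^] l = s [^] (l - ?k)" if "?k \<le> l" for l
    proof -
      have "s [^] l = s [^] ?k \<otimes> s [^] (l - ?k)"
        using nat_pow_mult[OF sc, of ?k "l - ?k"] that by simp
      then have "?\<tau> \<otimes> s [^] l = (?\<tau> \<otimes> s [^] ?k) \<otimes> s [^] (l - ?k)"
        using \<tau>c sc by (simp add: m_assoc)
      then show ?thesis
        unfolding \<tau>s using sc by simp
    qed
    from h(3) sK obtain v where v: "v \<in> H i"
      "\<forall>l. cf (Y s [^]\<^bsub>UP A\<^esub> m \<otimes>\<^bsub>UP A\<^esub> v) l = s [^] l \<otimes> h l"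
      by blast
    note vc = hom_carrier[OF v(1)]
    let ?p = "Y s [^]\<^bsub>UP A\<^esub> m \<otimes>\<^bsub>UP A\<^esub> v"
    have Yc: "Y s [^]\<^bsub>UP A\<^esub> m \<in> carrier (UP A)"
      using z_carrier sc by simp
    have pH: "?p \<in> H (m + i)"
      by (rule hom_mult[OF hom_pow[OF Y_hom[OF sK]] v(1)])
    let ?S = "\<Oplus>\<^bsub>UP A\<^esub>l\<in>?L. s [^] (l - ?k) \<odot>\<^bsub>UP A\<^esub> mn (h l) l"
    have Smem: "(\<lambda>l. s [^] (l - ?k) \<odot>\<^bsub>UP A\<^esub> mn (h l) l) \<in> ?L \<rightarrow> carrier (UP A)"
      using hc sc by auto
    then have Sc: "?S \<in> carrier (UP A)"
      by (rule UPA.P.finsum_closed)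
    have coeff_S: "cf ?S l = (if l \<in> ?L then s [^] (l - ?k) \<otimes> h l else \<zero>)" for l
    proof -
      have "cf ?S l = (\<Oplus>l'\<in>?L. cf (s [^] (l' - ?k) \<odot>\<^bsub>UP A\<^esub> mn (h l') l') l)"
        using Smem by (intro UPA.coeff_finsum) simp_all
      also have "\<dots> = (\<Oplus>l'\<in>?L. if l = l' then s [^] (l' - ?k) \<otimes> h l' else \<zero>)"
        using hc sc by (intro finsum_cong') auto
      also have "\<dots> = (if l \<in> ?L then s [^] (l - ?k) \<otimes> h l else \<zero>)"
      proof (cases "l \<in> ?L")
        case True
        have "(\<Oplus>l'\<in>?L. if l = l' then s [^] (l' - ?k) \<otimes> h l' else \<zero>) = s [^] (l - ?k) \<otimes> h l"
          using True hc sc by (intro finsum_singleton) auto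
        then show ?thesis
          using True by (simp only: if_True)
      next
        case False
        have "(\<Oplus>l'\<in>?L. if l = l' then s [^] (l' - ?k) \<otimes> h l' else \<zero>) = \<zero>"
          using False by (intro add.finprod_one_eqI) auto
        then show ?thesis
          using False by (simp only: if_False)
      qed
      finally show ?thesis .
    qed
    have "?\<tau> \<odot>\<^bsub>UP A\<^esub> ?p = mn ?u ?k \<oplus>\<^bsub>UP A\<^esub> ?S"
    proof (rule UPA.up_eqI)
      show "?\<tau> \<odot>\<^bsub>UP A\<^esub> ?p \<in> carrier (UP A)"
        using \<tau>c Yc vc by simp
      show "mn ?u ?k \<oplus>\<^bsub>UP A\<^esub> ?S \<in> carrier (UP A)"
        using uc Sc by simp
      fix l
      have lhs: "cf (?\<tau> \<odot>\<^bsub>UP A\<^esub> ?p) l = ?\<tau> \<otimes> cf ?p l"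
        by (rule UPA.coeff_smult[OF \<tau>c hom_carrier[OF pH]])
      have rhs: "cf (mn ?u ?k \<oplus>\<^bsub>UP A\<^esub> ?S) l =
          (if ?k = l then ?u else \<zero>) \<oplus> (if l \<in> ?L then s [^] (l - ?k) \<otimes> h l else \<zero>)"
        unfolding UPA.coeff_add[OF UPA.monom_closed[OF uc] Sc] coeff_S UPA.coeff_monom[OF uc] ..
      consider "l > i + m" | "l \<le> i + m" "l < n" "l = ?k" | "l \<le> i + m" "l < n" "l \<noteq> ?k"
        | "l \<le> i + m" "n \<le> l"
        by linarith
      then show "cf (?\<tau> \<odot>\<^bsub>UP A\<^esub> ?p) l = cf (mn ?u ?k \<oplus>\<^bsub>UP A\<^esub> ?S) l"
      proof cases
        case 1
        have "cf ?p l = \<zero>"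
          by (rule hom_coeff_zero[OF pH]) (use 1 in simp)
        then show ?thesis
          unfolding lhs rhs using 1 k \<tau>c by simp
      next
        case 2
        have "cf ?p l = s [^] ?k \<otimes> ?u"
          using v(2) h(2) 2 by simp
        then have "?\<tau> \<otimes> cf ?p l = (?\<tau> \<otimes> s [^] ?k) \<otimes> ?u"
          using \<tau>c sc uc by (simp only: m_assoc nat_pow_closed)
        then show ?thesis
          unfolding lhs rhs \<tau>s using 2 uc by simp
      next
        case 3
        have "cf ?p l = s [^] l \<otimes> \<zero>"
          using v(2) h(2) 3 by simp
        then show ?thesis
          unfolding lhs rhs using 3 \<tau>c sc by simp
      next
        case 4
        have "?\<tau> \<otimes> cf ?p l = (?\<tau> \<otimes> s [^] l) \<otimes> h l"
          using v(2) \<tau>c sc hc[OF 4(1)] by (simp only: m_assoc nat_pow_closed)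
        moreover have "?k \<le> l" "?k \<noteq> l"
          using 4 k by simp_all
        ultimately show ?thesis
          unfolding lhs rhs using 4 \<tau>l[of l] sc hc[OF 4(1)] by simp
      qed
    qed
    moreover have "?\<tau> \<odot>\<^bsub>UP A\<^esub> ?p = Y s [^]\<^bsub>UP A\<^esub> m \<otimes>\<^bsub>UP A\<^esub> (?\<tau> \<odot>\<^bsub>UP A\<^esub> v)"
    proof -
      let ?M = "Y s [^]\<^bsub>UP A\<^esub> m"
      have "?\<tau> \<odot>\<^bsub>UP A\<^esub> (?M \<otimes>\<^bsub>UP A\<^esub> v) = ?\<tau> \<odot>\<^bsub>UP A\<^esub> (v \<otimes>\<^bsub>UP A\<^esub> ?M)"
        unfolding UPA.P.m_comm[OF Yc vc] ..
      also have "\<dots> = (?\<tau> \<odot>\<^bsub>UP A\<^esub> v) \<otimes>\<^bsub>UP A\<^esub> ?M"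
        by (rule UPA.UP_smult_assoc2[OF \<tau>c vc Yc, symmetric])
      also have "\<dots> = ?M \<otimes>\<^bsub>UP A\<^esub> (?\<tau> \<odot>\<^bsub>UP A\<^esub> v)"
        by (rule UPA.P.m_comm[OF UPA.UP_smult_closed[OF \<tau>c vc] Yc])
      finally show ?thesis .
    qed
    ultimately have key: "mn ?u ?k \<oplus>\<^bsub>UP A\<^esub> ?S = Y s [^]\<^bsub>UP A\<^esub> m \<otimes>\<^bsub>UP A\<^esub> (?\<tau> \<odot>\<^bsub>UP A\<^esub> v)"
      by (rule trans[OF sym])
    have "cls (mn ?u ?k \<oplus>\<^bsub>UP A\<^esub> comb I (\<lambda>j. \<kappa> j s)) = cls (mn ?u ?k \<oplus>\<^bsub>UP A\<^esub> ?S)"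
    proof (rule cls_add_cong)
      show "cls (comb I (\<lambda>j. \<kappa> j s)) = cls ?S"
        using \<kappa>(2) sK by simp
      show "comb I (\<lambda>j. \<kappa> j s) \<in> carrier (UP A)"
        using KF_polynomial_closed \<kappa>(1) sK by (intro comb_closed[OF Ic]) blast
    qed (use uc Sc in simp_all)
    then show ?thesis
      unfolding key using hom_smult[OF \<tau>K v(1)] by blast
  qed
  then have "\<forall>s\<in>K - {\<zero>}. \<exists>v\<in>H i. cls (mn ?u ?k \<oplus>\<^bsub>UP A\<^esub> comb I (\<lambda>j. \<kappa> j s)) =
      cls (Y s [^]\<^bsub>UP A\<^esub> m \<otimes>\<^bsub>UP A\<^esub> v)"
    by (rule ballI)
  with \<kappa>(1) show ?thesis
    by (intro exI[of _ \<kappa>] conjI)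
qed

text \<open>The relations of the generators form a matrix that is the identity plus entries
  vanishing at \<open>s = \<zero>\<close>. Elimination then places every generator, and hence the
  whole component, in the image of the power of \<open>Y s\<close>, except for finitely many
  \<open>s\<close>.\<close>

lemma finite_exceptional_parameters:
  assumes eq: "2 * i + m = c + n - 1"
  shows "finite {s \<in> K - {\<zero>}. \<not> (\<forall>q\<in>H (i + m). \<exists>v\<in>H i. cls q = cls (Y s [^]\<^bsub>UP A\<^esub> m \<otimes>\<^bsub>UP A\<^esub> v))}"
proof -
  from exists_monomial_span[of "i + m"] obtain I where I: "finite I"
    "\<forall>j\<in>I. fst j < n \<and> fst j \<le> i + m \<and> snd j \<in> gr (i + m - fst j)"
    "\<forall>q\<in>H (i + m). \<exists>\<kappa>. (\<forall>j\<in>I. \<kappa> j \<in> K) \<and> cls q = cls (comb I \<kappa>)"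
    by (elim exE conjE)
  have Ic: "snd ` I \<subseteq> carrier A"
    using I(2) gr_carrier by blast
  let ?w = "\<lambda>j. mn (snd j) (fst j)"
  have wc: "?w j \<in> carrier (UP A)" if "j \<in> I" for j
    using Ic that by auto
  have "\<forall>j\<in>I. \<exists>\<kappa>. (\<forall>j\<in>I. polynomial_function KF (\<kappa> j) \<and> \<kappa> j \<zero> = \<zero>) \<and>
    (\<forall>s\<in>K - {\<zero>}. \<exists>v\<in>H i. cls (?w j \<oplus>\<^bsub>UP A\<^esub> comb I (\<lambda>j. \<kappa> j s)) =
      cls (Y s [^]\<^bsub>UP A\<^esub> m \<otimes>\<^bsub>UP A\<^esub> v))"
    by (intro ballI generator_relation[OF eq I(1) I(2)[rule_format] I(3)[rule_format]])
  from bchoice[OF this] obtain \<kappa> where rel: "\<forall>j\<in>I.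
      (\<forall>j'\<in>I. polynomial_function KF (\<kappa> j j') \<and> \<kappa> j j' \<zero> = \<zero>) \<and>
      (\<forall>s\<in>K - {\<zero>}. \<exists>v\<in>H i. cls (?w j \<oplus>\<^bsub>UP A\<^esub> comb I (\<lambda>j'. \<kappa> j j' s)) =
        cls (Y s [^]\<^bsub>UP A\<^esub> m \<otimes>\<^bsub>UP A\<^esub> v))"
    by (elim exE)
  note \<kappa> = bspec[OF conjunct1[OF bspec[OF rel]]] bspec[OF conjunct2[OF bspec[OF rel]]]
  \<comment> \<open>The image is pulled back from the quotient to \<open>A[x]\<close>, a module over
    \<open>KF\<close> that does not depend on \<open>s\<close> and in which elimination can be
    carried out.\<close>
  define U where "U s = {p \<in> carrier (UP A). \<exists>v\<in>H i. cls p = cls (Y s [^]\<^bsub>UP A\<^esub> m \<otimes>\<^bsub>UP A\<^esub> v)}" for s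
  have Yc: "Y s [^]\<^bsub>UP A\<^esub> m \<in> carrier (UP A)" if "s \<in> K" for s
    using z_carrier K_carrier[OF that] by simp
  have U_add: "a \<oplus>\<^bsub>UP A\<^esub> b \<in> U s" if "a \<in> U s" "b \<in> U s" "s \<in> K" for a b s
  proof -
    from that obtain v v' where v: "v \<in> H i" "cls a = cls (Y s [^]\<^bsub>UP A\<^esub> m \<otimes>\<^bsub>UP A\<^esub> v)"
      and v': "v' \<in> H i" "cls b = cls (Y s [^]\<^bsub>UP A\<^esub> m \<otimes>\<^bsub>UP A\<^esub> v')"
      and ab: "a \<in> carrier (UP A)" "b \<in> carrier (UP A)"
      unfolding U_def by blast
    note vc = hom_carrier[OF v(1)] hom_carrier[OF v'(1)]
    note Ys = Yc[OF that(3)]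
    have "cls (a \<oplus>\<^bsub>UP A\<^esub> b) = cls (Y s [^]\<^bsub>UP A\<^esub> m \<otimes>\<^bsub>UP A\<^esub> v \<oplus>\<^bsub>UP A\<^esub> Y s [^]\<^bsub>UP A\<^esub> m \<otimes>\<^bsub>UP A\<^esub> v')"
      by (rule cls_add_cong[OF v(2) v'(2) ab(1) UPA.P.m_closed[OF Ys vc(1)] ab(2) UPA.P.m_closed[OF Ys vc(2)]])
    also have "\<dots> = cls (Y s [^]\<^bsub>UP A\<^esub> m \<otimes>\<^bsub>UP A\<^esub> (v \<oplus>\<^bsub>UP A\<^esub> v'))"
      using UPA.P.r_distr[OF vc Ys] by simp
    finally show ?thesis
      unfolding U_def using hom_add[OF v(1) v'(1)] UPA.P.a_closed[OF ab] by blast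
  qed
  have U_smult: "a \<odot>\<^bsub>UP A\<^esub> p \<in> U s" if "a \<in> K" "p \<in> U s" "s \<in> K" for a p s
  proof -
    from that obtain v where v: "v \<in> H i" "cls p = cls (Y s [^]\<^bsub>UP A\<^esub> m \<otimes>\<^bsub>UP A\<^esub> v)"
      and pc: "p \<in> carrier (UP A)"
      unfolding U_def by blast
    note vc = hom_carrier[OF v(1)] and Ys = Yc[OF that(3)] and ac = K_carrier[OF that(1)]
    have "cls (a \<odot>\<^bsub>UP A\<^esub> p) = cls (a \<odot>\<^bsub>UP A\<^esub> (Y s [^]\<^bsub>UP A\<^esub> m \<otimes>\<^bsub>UP A\<^esub> v))"
      by (rule cls_smult_cong[OF v(2) ac pc UPA.P.m_closed[OF Ys vc]])
    also have "\<dots> = cls (Y s [^]\<^bsub>UP A\<^esub> m \<otimes>\<^bsub>UP A\<^esub> (a \<odot>\<^bsub>UP A\<^esub> v))"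
      using UPA.UP_smult_assoc2[OF ac vc Ys] UPA.P.m_comm[OF Ys vc]
        UPA.P.m_comm[OF Ys UPA.UP_smult_closed[OF ac vc]]
      by simp
    finally show ?thesis
      unfolding U_def using hom_smult[OF that(1) v(1)] UPA.UP_smult_closed[OF ac pc] by blast
  qed
  have U_zero: "\<zero>\<^bsub>UP A\<^esub> \<in> U s" if "s \<in> K" for s
  proof -
    have "cls \<zero>\<^bsub>UP A\<^esub> = cls (Y s [^]\<^bsub>UP A\<^esub> m \<otimes>\<^bsub>UP A\<^esub> \<zero>\<^bsub>UP A\<^esub>)"
      using Yc[OF that] by simp
    then show ?thesis
      unfolding U_def using hom_zero by blast
  qed
  have K1: "\<one> \<in> K" and Km1: "\<ominus> \<one> \<in> K" and K0: "\<zero> \<in> K"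
    using gr_one gr_uminus[OF gr_one] gr_zero[of 0] component_zero by simp_all
  have sub: "submodule (U s) KF (UP A)" if "s \<in> K - {\<zero>}" for s
  proof (rule module.submoduleI[OF KF_module])
    have s: "s \<in> K"
      using that by simp
    show "U s \<subseteq> carrier (UP A)"
      unfolding U_def by blast
    show "\<zero>\<^bsub>UP A\<^esub> \<in> U s"
      by (rule U_zero[OF s])
    show "a \<oplus>\<^bsub>UP A\<^esub> b \<in> U s" if "a \<in> U s" "b \<in> U s" for a b
      by (rule U_add[OF that s])
    show "a \<odot>\<^bsub>UP A\<^esub> p \<in> U s" if "a \<in> carrier KF" "p \<in> U s" for a p
      using U_smult[OF _ that(2) s] that(1) by simp
    show "\<ominus>\<^bsub>UP A\<^esub> p \<in> U s" if "p \<in> U s" for p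
    proof -
      have "p \<in> carrier (UP A)"
        using that unfolding U_def by simp
      then have "\<ominus>\<^bsub>UP A\<^esub> p = (\<ominus> \<one>) \<odot>\<^bsub>UP A\<^esub> p"
        using UPA.smult_l_minus[OF one_closed] by simp
      then show ?thesis
        using U_smult[OF Km1 that s] by simp
    qed
  qed
  define C where "C j j' s = (if j' = j then \<one> else \<zero>) \<oplus> \<kappa> j j' s" for j j' s
  have "finite {s \<in> K - {\<zero>}. \<not> ?w ` I \<subseteq> U s}"
  proof (rule module.finite_exceptions_generators_mem[OF KF_module KF_field I(1), of ?w "K - {\<zero>}" U C])
    show "?w \<in> I \<rightarrow> carrier (UP A)"
      using wc by blast
    show "K - {\<zero>} \<subseteq> carrier KF"
      by auto
    show "submodule (U s) KF (UP A)" if "s \<in> K - {\<zero>}" for s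
      by (rule sub[OF that])
    show "polynomial_function KF (C j j')" if "j \<in> I" "j' \<in> I" for j j'
    proof -
      have "(if j' = j then \<one> else \<zero>) \<in> K"
        using K1 K0 by simp
      then show ?thesis
        unfolding C_def[abs_def] using \<kappa>(1)[OF that]
        by (intro KF_polynomial_add KF_polynomial_const) simp_all
    qed
    show "C j j' \<zero>\<^bsub>KF\<^esub> = (if j = j' then \<one>\<^bsub>KF\<^esub> else \<zero>\<^bsub>KF\<^esub>)" if "j \<in> I" "j' \<in> I" for j j'
      unfolding C_def using \<kappa>(1)[OF that] by auto
    show "(\<Oplus>\<^bsub>UP A\<^esub>j'\<in>I. C j j' s \<odot>\<^bsub>UP A\<^esub> ?w j') \<in> U s" if s: "s \<in> K - {\<zero>}" and j: "j \<in> I" for s j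
    proof -
      have sK: "s \<in> K"
        using s by simp
      have \<kappa>K: "\<kappa> j j' s \<in> K" if "j' \<in> I" for j'
        using KF_polynomial_closed[OF conjunct1[OF \<kappa>(1)[OF j that]] sK] .
      have \<delta>K: "(if j' = j then \<one> else \<zero>) \<in> K" for j'
        using K1 K0 by simp
      have "comb I (\<lambda>j'. C j j' s) = comb I (\<lambda>j'. if j' = j then \<one> else \<zero>) \<oplus>\<^bsub>UP A\<^esub> comb I (\<lambda>j'. \<kappa> j j' s)"
        unfolding C_def by (rule comb_add[OF Ic \<delta>K \<kappa>K])
      also have "comb I (\<lambda>j'. if j' = j then \<one> else \<zero>) = ?w j"
        using comb_single[OF I(1) Ic j K1] wc[OF j] by simp
      finally have eqC: "comb I (\<lambda>j'. C j j' s) = ?w j \<oplus>\<^bsub>UP A\<^esub> comb I (\<lambda>j'. \<kappa> j j' s)" .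
      have "?w j \<oplus>\<^bsub>UP A\<^esub> comb I (\<lambda>j'. \<kappa> j j' s) \<in> carrier (UP A)"
        by (rule UPA.P.a_closed[OF wc[OF j] comb_closed[OF Ic \<kappa>K]])
      then have "?w j \<oplus>\<^bsub>UP A\<^esub> comb I (\<lambda>j'. \<kappa> j j' s) \<in> U s"
        unfolding U_def using \<kappa>(2)[OF j s] by blast
      then show ?thesis
        unfolding eqC .
    qed
  qed
  moreover have "\<forall>q\<in>H (i + m). \<exists>v\<in>H i. cls q = cls (Y s [^]\<^bsub>UP A\<^esub> m \<otimes>\<^bsub>UP A\<^esub> v)"
    if s: "s \<in> K - {\<zero>}" and gen: "?w ` I \<subseteq> U s" for s
  proof
    fix q assume q: "q \<in> H (i + m)"
    have sK: "s \<in> K"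
      using s by simp
    obtain \<mu> where \<mu>: "\<forall>j\<in>I. \<mu> j \<in> K" "cls q = cls (comb I \<mu>)"
      using bspec[OF I(3) q] by (elim exE conjE)
    have "comb W \<mu> \<in> U s" if "finite W" "W \<subseteq> I" for W
      using that
    proof (induction W)
      case empty
      then show ?case
        using U_zero[OF sK] by simp
    next
      case (insert j W)
      then have j: "j \<in> I" and W: "W \<subseteq> I"
        by simp_all
      have cl: "\<mu> j' \<odot>\<^bsub>UP A\<^esub> ?w j' \<in> carrier (UP A)" if "j' \<in> I" for j'
        using UPA.UP_smult_closed[OF K_carrier wc[OF that]] \<mu>(1) that by blast
      have "comb (insert j W) \<mu> = \<mu> j \<odot>\<^bsub>UP A\<^esub> ?w j \<oplus>\<^bsub>UP A\<^esub> comb W \<mu>"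
        using insert.hyps cl W j by (intro UPA.P.finsum_insert) auto
      moreover have "\<mu> j \<odot>\<^bsub>UP A\<^esub> ?w j \<in> U s"
        using \<mu>(1) j gen by (intro U_smult[OF _ _ sK]) auto
      ultimately show ?case
        using U_add[OF _ insert.IH[OF W] sK] by simp
    qed
    from this[OF I(1) subset_refl] have "comb I \<mu> \<in> U s" .
    then show "\<exists>v\<in>H i. cls q = cls (Y s [^]\<^bsub>UP A\<^esub> m \<otimes>\<^bsub>UP A\<^esub> v)"
      unfolding U_def \<mu>(2) by blast
  qed
  ultimately show ?thesis
    by (elim finite_subset[rotated]) blast
qed

end

section \<open>The strong Lefschetz property of the quotient\<close>

context monic_homogeneous
begin

abbreviation B :: "(nat \<Rightarrow> 'a) set ring" where
  "B \<equiv> UP A Quot J"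

abbreviation grB :: "nat \<Rightarrow> (nat \<Rightarrow> 'a) set set" where
  "grB \<equiv> quotient_grading (UP A) J H"

lemma cls_hom: "ring_hom_cring (UP A) B cls"
  by (rule ideal.rcos_ring_hom_cring[OF J_ideal UPA.P.is_cring])

lemma grB_memI: "p \<in> H d \<Longrightarrow> cls p \<in> grB d"
  unfolding quotient_grading_def by blast

lemma cls_mult:
  "\<lbrakk> p \<in> carrier (UP A); q \<in> carrier (UP A) \<rbrakk> \<Longrightarrow> cls p \<otimes>\<^bsub>B\<^esub> cls q = cls (p \<otimes>\<^bsub>UP A\<^esub> q)"
  using ring_hom_mult[OF ideal.rcos_ring_hom[OF J_ideal]] by simp

lemma cls_pow: "p \<in> carrier (UP A) \<Longrightarrow> cls p [^]\<^bsub>B\<^esub> (r :: nat) = cls (p [^]\<^bsub>UP A\<^esub> r)"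
  using ring_hom_cring.hom_pow[OF cls_hom] by simp

lemma cls_zero_iff: "p \<in> carrier (UP A) \<Longrightarrow> cls p = cls \<zero>\<^bsub>UP A\<^esub> \<longleftrightarrow> p \<in> J"
  using cls_eq_iff[of p "\<zero>\<^bsub>UP A\<^esub>"] by (simp add: a_minus_def)

lemma lefschetz_elementI:
  assumes y: "y \<in> H 1"
    and "\<And>i. (\<forall>u\<in>H i. y [^]\<^bsub>UP A\<^esub> r \<otimes>\<^bsub>UP A\<^esub> u \<in> J \<longrightarrow> u \<in> J) \<or>
      (\<forall>q\<in>H (i + r). \<exists>v\<in>H i. cls q = cls (y [^]\<^bsub>UP A\<^esub> r \<otimes>\<^bsub>UP A\<^esub> v))"
  shows "lefschetz_element B grB r (cls y [^]\<^bsub>B\<^esub> r)"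
proof -
  note yc = hom_carrier[OF y]
  let ?y = "y [^]\<^bsub>UP A\<^esub> r"
  have yr: "?y \<in> H r" and yrc: "?y \<in> carrier (UP A)"
    using hom_pow[OF y] yc by simp_all
  have "inj_on (\<lambda>b. cls ?y \<otimes>\<^bsub>B\<^esub> b) (grB i) \<or> (\<lambda>b. cls ?y \<otimes>\<^bsub>B\<^esub> b) ` grB i = grB (i + r)" for i
    using assms(2)[of i]
  proof
    assume inj: "\<forall>u\<in>H i. ?y \<otimes>\<^bsub>UP A\<^esub> u \<in> J \<longrightarrow> u \<in> J"
    have "inj_on (\<lambda>b. cls ?y \<otimes>\<^bsub>B\<^esub> b) (grB i)"
    proof (rule inj_onI)
      fix b b' assume "b \<in> grB i" "b' \<in> grB i" and eq: "cls ?y \<otimes>\<^bsub>B\<^esub> b = cls ?y \<otimes>\<^bsub>B\<^esub> b'"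
      then obtain p p' where p: "p \<in> H i" "b = cls p" and p': "p' \<in> H i" "b' = cls p'"
        unfolding quotient_grading_def by blast
      note pc = hom_carrier[OF p(1)] hom_carrier[OF p'(1)]
      have "cls (?y \<otimes>\<^bsub>UP A\<^esub> p) = cls (?y \<otimes>\<^bsub>UP A\<^esub> p')"
        using eq unfolding p(2) p'(2) cls_mult[OF yrc pc(1)] cls_mult[OF yrc pc(2)] .
      then have "?y \<otimes>\<^bsub>UP A\<^esub> p \<ominus>\<^bsub>UP A\<^esub> ?y \<otimes>\<^bsub>UP A\<^esub> p' \<in> J"
        using cls_eq_iff[OF UPA.P.m_closed[OF yrc pc(1)] UPA.P.m_closed[OF yrc pc(2)]] by simp
      moreover have "?y \<otimes>\<^bsub>UP A\<^esub> p \<ominus>\<^bsub>UP A\<^esub> ?y \<otimes>\<^bsub>UP A\<^esub> p' = ?y \<otimes>\<^bsub>UP A\<^esub> (p \<ominus>\<^bsub>UP A\<^esub> p')"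
        using yrc pc by (simp add: a_minus_def UPA.P.r_distr UPA.P.r_minus)
      ultimately have "p \<ominus>\<^bsub>UP A\<^esub> p' \<in> J"
        using inj hom_minus[OF p(1) p'(1)] by simp
      then show "b = b'"
        unfolding p(2) p'(2) using cls_eq_iff[OF pc] by simp
    qed
    then show ?thesis ..
  next
    assume surj: "\<forall>q\<in>H (i + r). \<exists>v\<in>H i. cls q = cls (?y \<otimes>\<^bsub>UP A\<^esub> v)"
    have "(\<lambda>b. cls ?y \<otimes>\<^bsub>B\<^esub> b) ` grB i = grB (i + r)"
    proof
      show "(\<lambda>b. cls ?y \<otimes>\<^bsub>B\<^esub> b) ` grB i \<subseteq> grB (i + r)"
      proof
        fix b assume "b \<in> (\<lambda>b. cls ?y \<otimes>\<^bsub>B\<^esub> b) ` grB i"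
        then obtain p where p: "p \<in> H i" "b = cls ?y \<otimes>\<^bsub>B\<^esub> cls p"
          unfolding quotient_grading_def by blast
        show "b \<in> grB (i + r)"
          unfolding p(2) cls_mult[OF yrc hom_carrier[OF p(1)]]
          using grB_memI[OF hom_mult[OF yr p(1)]] by (simp add: add.commute)
      qed
      show "grB (i + r) \<subseteq> (\<lambda>b. cls ?y \<otimes>\<^bsub>B\<^esub> b) ` grB i"
      proof
        fix b assume "b \<in> grB (i + r)"
        then obtain q where q: "q \<in> H (i + r)" "b = cls q"
          unfolding quotient_grading_def by blast
        obtain v where v: "v \<in> H i" "cls q = cls (?y \<otimes>\<^bsub>UP A\<^esub> v)"
          using bspec[OF surj q(1)] by (elim bexE)
        have "b = cls ?y \<otimes>\<^bsub>B\<^esub> cls v"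
          unfolding q(2) v(2) cls_mult[OF yrc hom_carrier[OF v(1)]] ..
        then show "b \<in> (\<lambda>b. cls ?y \<otimes>\<^bsub>B\<^esub> b) ` grB i"
          using grB_memI[OF v(1)] by (rule image_eqI)
      qed
    qed
    then show ?thesis ..
  qed
  then show ?thesis
    unfolding lefschetz_element_def cls_pow[OF yc] using grB_memI[OF yr] by blast
qed

lemma strong_lefschetz_propertyI:
  assumes y: "y \<in> H 1"
    and "\<And>r i. (\<forall>u\<in>H i. y [^]\<^bsub>UP A\<^esub> r \<otimes>\<^bsub>UP A\<^esub> u \<in> J \<longrightarrow> u \<in> J) \<or>
      (\<forall>q\<in>H (i + r). \<exists>v\<in>H i. cls q = cls (y [^]\<^bsub>UP A\<^esub> r \<otimes>\<^bsub>UP A\<^esub> v))"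
  shows "strong_lefschetz_property B grB"
proof -
  have "strong_lefschetz_element B grB (cls y)"
    unfolding strong_lefschetz_element_def
    using grB_memI[OF y] lefschetz_elementI[OF y assms(2)] by blast
  then show ?thesis
    unfolding strong_lefschetz_property_def by (rule exI)
qed

text \<open>For \<open>n = 0\<close> every remainder vanishes, so the quotient is zero and the zero
  form serves. The case is separate because \<open>c + n - 1\<close> is the top degree of the
  quotient only for \<open>n > 0\<close>.\<close>

lemma strong_lefschetz_property_degree_zero:
  assumes "n = 0"
  shows "strong_lefschetz_property B grB"
proof (rule strong_lefschetz_propertyI[OF hom_zero])
  have "u \<in> J" if u: "u \<in> H i" for u i
  proof -
    obtain q where q: "q \<in> H i" "\<forall>k\<ge>n. cf q k = \<zero>" "u \<ominus>\<^bsub>UP A\<^esub> q \<in> J"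
      using reduction[OF u] by blast
    have "q = \<zero>\<^bsub>UP A\<^esub>"
      using q(2) assms hom_carrier[OF q(1)] by (intro UPA.up_eqI) simp_all
    then show ?thesis
      using q(3) hom_carrier[OF u] by (simp add: a_minus_def)
  qed
  then show "(\<forall>u\<in>H i. \<zero>\<^bsub>UP A\<^esub> [^]\<^bsub>UP A\<^esub> r \<otimes>\<^bsub>UP A\<^esub> u \<in> J \<longrightarrow> u \<in> J) \<or>
      (\<forall>q\<in>H (i + r). \<exists>v\<in>H i. cls q = cls (\<zero>\<^bsub>UP A\<^esub> [^]\<^bsub>UP A\<^esub> r \<otimes>\<^bsub>UP A\<^esub> v))" for r :: nat and i
    by simp
qed

end

section \<open>From symmetric degrees to all degrees\<close>

context lefschetz_monic
begin

lemma infinite_K: "infinite K"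
proof
  assume fin: "finite K"
  have "inj (\<lambda>k. ring_of_int A (int k))"
  proof (rule linorder_injI)
    fix k l :: nat assume "k < l"
    show "ring_of_int A (int k) \<noteq> ring_of_int A (int l)"
    proof
      assume eq: "ring_of_int A (int k) = ring_of_int A (int l)"
      let ?d = "ring_of_int A (int (l - k))"
      have kl: "k + (l - k) = l"
        using \<open>k < l\<close> by simp
      have "ring_of_int A (int l) = ring_of_int A (int k) \<oplus> ?d"
        using ring_of_int_add[of "int k" "int (l - k)"] unfolding of_nat_add[symmetric] kl .
      then have "ring_of_int A (int k) = ring_of_int A (int k) \<oplus> ?d"
        unfolding eq[symmetric] .
      then have "?d = \<zero>"
        by (simp only: add.l_cancel_one'[OF ring_of_int_closed ring_of_int_closed])
      moreover obtain \<nu> where "\<nu> \<in> K" "\<nu> \<otimes> ?d = \<one>"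
        using ring_of_nat_unit[of "l - k"] \<open>k < l\<close> by auto
      ultimately show False
        using K_carrier subfieldE(6)[OF K.subfield_axioms] by simp
    qed
  qed
  moreover have "finite (range (\<lambda>k. ring_of_int A (int k)))"
    using fin by (rule finite_subset[rotated]) (use ring_of_int_mem in blast)
  ultimately show False
    using finite_imageD infinite_UNIV_nat by blast
qed

text \<open>Only finitely many pairs \<open>(i, m)\<close> satisfy the equation and each excludes
  finitely many nonzero \<open>s\<close>, so one value in the infinite field works for all of
  them.\<close>

lemma exists_generic_parameter:
  "\<exists>s\<in>K. \<forall>i m. 2 * i + m = c + n - 1 \<longrightarrow>
    (\<forall>q\<in>H (i + m). \<exists>v\<in>H i. cls q = cls (Y s [^]\<^bsub>UP A\<^esub> m \<otimes>\<^bsub>UP A\<^esub> v))"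
proof -
  define P where "P s i m \<longleftrightarrow> (\<forall>q\<in>H (i + m). \<exists>v\<in>H i. cls q = cls (Y s [^]\<^bsub>UP A\<^esub> m \<otimes>\<^bsub>UP A\<^esub> v))"
    for s i m
  let ?S = "{(i, m). 2 * i + m = c + n - 1}"
  have "?S \<subseteq> {..c + n} \<times> {..c + n}"
    by auto
  then have finS: "finite ?S"
    by (rule finite_subset) simp
  have "finite {s \<in> K - {\<zero>}. \<not> P s i m}" if "(i, m) \<in> ?S" for i m
    unfolding P_def using finite_exceptional_parameters[of i m] that by simp
  then have "finite (\<Union>(i, m)\<in>?S. {s \<in> K - {\<zero>}. \<not> P s i m})"
    using finS by (intro finite_UN_I) auto
  then have "infinite (K - insert \<zero> (\<Union>(i, m)\<in>?S. {s \<in> K - {\<zero>}. \<not> P s i m}))"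
    using infinite_K by (intro Diff_infinite_finite) simp_all
  then obtain s where s: "s \<in> K - insert \<zero> (\<Union>(i, m)\<in>?S. {s \<in> K - {\<zero>}. \<not> P s i m})"
    using infinite_imp_nonempty by blast
  then have "P s i m" if "2 * i + m = c + n - 1" for i m
    using that by auto
  with s show ?thesis
    unfolding P_def by blast
qed

lemma strong_lefschetz_property_quotient: "strong_lefschetz_property B grB"
proof -
  obtain s where sK: "s \<in> K" and generic: "\<And>i m. 2 * i + m = c + n - 1 \<Longrightarrow>
      (\<forall>q\<in>H (i + m). \<exists>v\<in>H i. cls q = cls (Y s [^]\<^bsub>UP A\<^esub> m \<otimes>\<^bsub>UP A\<^esub> v))"
    using exists_generic_parameter by blast
  let ?y = "Y s"
  note y = Y_hom[OF sK]
  note yc = hom_carrier[OF y]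
  have pc: "?y [^]\<^bsub>UP A\<^esub> (r :: nat) \<in> carrier (UP A)" for r
    using UPA.P.nat_pow_closed[OF yc] .
  have pow_add: "?y [^]\<^bsub>UP A\<^esub> (a + b) = ?y [^]\<^bsub>UP A\<^esub> a \<otimes>\<^bsub>UP A\<^esub> ?y [^]\<^bsub>UP A\<^esub> b" for a b :: nat
    using UPA.P.nat_pow_mult[OF yc] by simp
  interpret J: ideal J "UP A"
    by (rule J_ideal)
  show ?thesis
  proof (rule strong_lefschetz_propertyI[OF y])
    fix r i :: nat
    let ?d = "c + n - 1"
    consider "2 * i + r \<le> ?d" | "?d < 2 * i + r" "i + r \<le> ?d" | "?d < i + r"
      by linarith
    then show "(\<forall>u\<in>H i. ?y [^]\<^bsub>UP A\<^esub> r \<otimes>\<^bsub>UP A\<^esub> u \<in> J \<longrightarrow> u \<in> J) \<or>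
      (\<forall>q\<in>H (i + r). \<exists>v\<in>H i. cls q = cls (?y [^]\<^bsub>UP A\<^esub> r \<otimes>\<^bsub>UP A\<^esub> v))"
    proof cases
      case 1
      \<comment> \<open>The exponent is raised to the symmetric one. Since that power reaches all of
        degree \<open>?d - i\<close>, an element annihilated by the smaller power pairs to zero with
        that whole degree, so nondegeneracy puts it in \<open>J\<close>.\<close>
      define m where "m = ?d - 2 * i"
      have m: "2 * i + m = ?d" "m = (m - r) + r" "?d - i = i + m"
        using 1 unfolding m_def by linarith+
      have "u \<in> J" if u: "u \<in> H i" and yu: "?y [^]\<^bsub>UP A\<^esub> r \<otimes>\<^bsub>UP A\<^esub> u \<in> J" for u
      proof (rule ccontr)
        assume "u \<notin> J"
        from conjunct2[OF quotient_nondegenerate[OF u this]]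
        obtain v where v: "v \<in> H (i + m)" "v \<otimes>\<^bsub>UP A\<^esub> u \<notin> J"
          unfolding m(3) by (elim bexE)
        obtain v' where v': "v' \<in> H i" "cls v = cls (?y [^]\<^bsub>UP A\<^esub> m \<otimes>\<^bsub>UP A\<^esub> v')"
          using bspec[OF generic[OF m(1)] v(1)] by (elim bexE)
        note uc = hom_carrier[OF u] and vc = hom_carrier[OF v(1)] and v'c = hom_carrier[OF v'(1)]
        let ?w = "?y [^]\<^bsub>UP A\<^esub> m \<otimes>\<^bsub>UP A\<^esub> v'"
        have wc: "?w \<in> carrier (UP A)"
          using pc v'c by (rule UPA.P.m_closed)
        have "?w = ?y [^]\<^bsub>UP A\<^esub> (m - r) \<otimes>\<^bsub>UP A\<^esub> ?y [^]\<^bsub>UP A\<^esub> r \<otimes>\<^bsub>UP A\<^esub> v'"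
          using pow_add[of "m - r" r] m(2) by simp
        then have "?w \<otimes>\<^bsub>UP A\<^esub> u =
            (?y [^]\<^bsub>UP A\<^esub> (m - r) \<otimes>\<^bsub>UP A\<^esub> v') \<otimes>\<^bsub>UP A\<^esub> (?y [^]\<^bsub>UP A\<^esub> r \<otimes>\<^bsub>UP A\<^esub> u)"
          using pc[of r] pc[of "m - r"] v'c uc by (simp add: UPA.P.m_ac)
        then have "?w \<otimes>\<^bsub>UP A\<^esub> u \<in> J"
          using J.I_l_closed[OF yu UPA.P.m_closed[OF pc v'c]] by simp
        moreover have "cls (v \<otimes>\<^bsub>UP A\<^esub> u) = cls (?w \<otimes>\<^bsub>UP A\<^esub> u)"
          by (rule cls_mult_cong[OF v'(2) refl vc wc uc uc])
        ultimately have "v \<otimes>\<^bsub>UP A\<^esub> u \<in> J"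
          using cls_zero_iff[OF UPA.P.m_closed[OF vc uc]] cls_zero_iff[OF UPA.P.m_closed[OF wc uc]]
          by simp
        then show False
          using v(2) by simp
      qed
      then show ?thesis
        by blast
    next
      case 2
      \<comment> \<open>The degree dual to the target \<open>i + r\<close>. It lies below
        \<open>i\<close>, so the surjective symmetric map from degree \<open>j\<close> factors
        through degree \<open>i\<close>, and its last part is surjective.\<close>
      define j where "j = ?d - (i + r)"
      have j: "2 * j + (r + (i - j)) = ?d" "j + (r + (i - j)) = i + r" "(i - j) + j = i"
        using 2 unfolding j_def by linarith+
      have "\<exists>v\<in>H i. cls q = cls (?y [^]\<^bsub>UP A\<^esub> r \<otimes>\<^bsub>UP A\<^esub> v)" if q: "q \<in> H (i + r)" for q
      proof -
        obtain v where v: "v \<in> H j" "cls q = cls (?y [^]\<^bsub>UP A\<^esub> (r + (i - j)) \<otimes>\<^bsub>UP A\<^esub> v)"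
          using generic[OF j(1)] q unfolding j(2) by blast
        note vc = hom_carrier[OF v(1)]
        have "?y [^]\<^bsub>UP A\<^esub> (i - j) \<otimes>\<^bsub>UP A\<^esub> v \<in> H i"
          using hom_mult[OF hom_pow[OF y, of "i - j"] v(1)] unfolding j(3) .
        moreover have "?y [^]\<^bsub>UP A\<^esub> (r + (i - j)) \<otimes>\<^bsub>UP A\<^esub> v =
            ?y [^]\<^bsub>UP A\<^esub> r \<otimes>\<^bsub>UP A\<^esub> (?y [^]\<^bsub>UP A\<^esub> (i - j) \<otimes>\<^bsub>UP A\<^esub> v)"
          unfolding pow_add by (rule UPA.P.m_assoc[OF pc pc vc])
        ultimately show ?thesis
          using v(2) by auto
      qed
      then show ?thesis
        by blast
    next
      case 3
      have "\<exists>v\<in>H i. cls q = cls (?y [^]\<^bsub>UP A\<^esub> r \<otimes>\<^bsub>UP A\<^esub> v)" if q: "q \<in> H (i + r)" for q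
      proof -
        have "q \<in> J"
          using quotient_nondegenerate[OF q] 3 by (cases "q \<in> J") simp_all
        then have "cls q = cls (?y [^]\<^bsub>UP A\<^esub> r \<otimes>\<^bsub>UP A\<^esub> \<zero>\<^bsub>UP A\<^esub>)"
          using cls_zero_iff[OF hom_carrier[OF q]] pc[of r] by simp
        then show ?thesis
          using hom_zero by blast
      qed
      then show ?thesis
        by blast
    qed
  qed
qed

end

theorem mainTheorem1:
  fixes K :: "'a set" and A :: "('a, 'b) ring_scheme"
    and gr :: "nat \<Rightarrow> 'a set" and f :: "nat \<Rightarrow> 'a"
  assumes "artinian_gorenstein_algebra K A gr"
    and char_zero: "\<forall>n::nat. n > 0 \<longrightarrow> [n] \<cdot>\<^bsub>A\<^esub> \<one>\<^bsub>A\<^esub> \<noteq> \<zero>\<^bsub>A\<^esub>"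
    and "strong_lefschetz_property A gr"
    and "monic A f"
    and homogeneous: "\<exists>d. f \<in> poly_grading A gr d"
  shows "strong_lefschetz_property (UP A Quot PIdl\<^bsub>UP A\<^esub> f)
           (quotient_grading (UP A) (PIdl\<^bsub>UP A\<^esub> f) (poly_grading A gr))"
proof -
  interpret artinian_gorenstein_algebra K A gr
    by fact
  obtain d where d: "f \<in> poly_grading A gr d"
    using homogeneous by (elim exE)
  have lead: "cf f (deg A f) = \<one>\<^bsub>A\<^esub>"
    using \<open>monic A f\<close> unfolding monic_def by simp
  have one: "\<one>\<^bsub>A\<^esub> \<noteq> \<zero>\<^bsub>A\<^esub>"
    using subfieldE(6)[OF K.subfield_axioms] .
  \<comment> \<open>The homogeneity degree \<open>d\<close> equals the degree in \<open>x\<close>: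
    the leading coefficient \<open>1\<close> lies in degree \<open>d - deg A f\<close> as well as in
    degree \<open>0\<close>, and it is nonzero.\<close>
  have "deg A f \<le> d"
    using hom_coeff_zero[OF d, of "deg A f"] lead one by (cases "deg A f \<le> d") simp_all
  moreover from hom_coeff[OF d this] have "d - deg A f = 0"
    using gr_disjoint[OF _ gr_one, of "d - deg A f"] one unfolding lead by blast
  ultimately have "d = deg A f"
    by simp
  then have top: "cf f d = \<one>\<^bsub>A\<^esub>"
    using lead by simp
  interpret monic_homogeneous K A gr f d
    by unfold_locales (rule d, rule top)
  show ?thesis
  proof (cases "d = 0")
    case True
    then show ?thesis
      by (rule strong_lefschetz_property_degree_zero)
  next
    case False
    obtain c where c: "gr c \<noteq> {\<zero>\<^bsub>A\<^esub>}" "\<forall>i>c. gr i = {\<zero>\<^bsub>A\<^esub>}"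
      using exists_top_degree by (elim exE conjE)
    obtain z where z: "strong_lefschetz_element A gr z"
      using \<open>strong_lefschetz_property A gr\<close> unfolding strong_lefschetz_property_def by (elim exE)
    interpret lefschetz_monic K A gr c f d z
      by unfold_locales (use c z False char_zero in simp_all)
    show ?thesis
      by (rule strong_lefschetz_property_quotient)
  qed
qed

end
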